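(* Let $T>0$, $H\in]\frac14,\frac12[$ and let $n\ge1$ be an integer. Let $h\in\mathbb{H}^\lambda(\Lambda_T^{(n)})$ for some $\lambda\in]0,1[$ satisfying $\lambda+H>\frac12$. Then, for $0\le s<t\le T$, $$\big\|K^{*,(n)}_{H,s,t}h\big\|_{L^2([0,t]^n)}\le C(T,\lambda,H)\,\|h\|_{\mathbb{H}^\lambda(\Lambda_t^{(n)})}\,|t-s|^H,$$ with some positive constant $C(T,\lambda,H)$ (for the fixed $n$; independent of $h,s,t$). Thus $K^{*,(n)}_{H,s,t}:\mathbb{H}^\lambda(\Lambda_t^{(n)})\to L^2([0,t]^n)$ is a continuous linear operator.
   Context: $\Lambda^{(n)}_t=\{(\theta_1,\dots,\theta_n)\in\mathbb{R}_+^n:0\le\theta_1\le\dots\le\theta_n\le t\}$. For $0<\theta<t$, $$K_H(t,\theta)=c_H\Big\{(t-\theta)^{H-\frac12}+\big(\tfrac12-H\big)\int_\theta^t(u-\theta)^{H-\frac32}\big(1-(\tfrac{\theta}{u})^{\frac12-H}\big)du\Big\},$$ where $c_H>0$ is the constant for which $\int_0^tK_H(t,\theta)\,dW_\theta$ ($W$ a standard Brownian motion) is a fractional Brownian motion with Hurst parameter $H$; thus $\frac{\partial K_H}{\partial t}(t,\theta)=c_H(H-\frac12)(\frac\theta t)^{\frac12-H}(t-\theta)^{H-\frac32}$. Write $K_H(dr,\theta)=\frac{\partial K_H}{\partial r}(r,\theta)\,dr$. $\mathbb{H}^\lambda(\Lambda_t^{(n)})$ is the space of functions $g$ on $\Lambda^{(n)}_t$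 that are $\lambda$-Hölder continuous on the $k$-cubes contained in $\Lambda^{(n)}_t$, $1\le k\le n$, i.e. with finite norm $$\|g\|_{\mathbb{H}^\lambda(\Lambda_t^{(n)})}=\sup_{\Lambda_t^{(n)}}|g|+\sum_{k=1}^n\sum_{1\le i_1<\dots<i_k\le n}\sup\frac{|\Delta^{i_1,\dots,i_k}g(\theta_1,\dots,\theta_n;r_{i_1},\dots,r_{i_k})|}{\prod_{j=1}^k|r_{i_j}-\theta_{i_j}|^\lambda},$$ the inner supremum being over $(\theta_1,\dots,\theta_n)\in\Lambda_t^{(n)}$ and $0\le\theta_{i_1}<r_{i_1}\le\theta_{i_2}<r_{i_2}\le\dots\le\theta_{i_k}<r_{i_k}\le t$ such that the corresponding $k$-cube (with vertices obtained by replacing some of the $\theta_{i_j}$ by $r_{i_j}$) is contained in $\Lambda_t^{(n)}$. Here $\Delta^{i}g(\theta;r_i)$ is the difference of $g$ when the $i$-th coordinate $\theta_i$ is replaced by $r_i$ (value at $r_i$ minus value at $\theta_i$), and $\Delta^{i_1,\dots,i_k}$ is the iterated such difference in coordinates $i_1,\dots,i_k$. Kernels: for $0\le s<t\le T$, $$\begin{aligned}(K^{*,(1)}_{H,s,t}h)(\theta_1)=&\,h(\theta_1)K_H(t,\theta_1)\mathbf{1}_{]s,t[}(\theta_1)+\int_{\theta_1}^t[h(r_1)-h(\theta_1)]K_H(dr_1,\theta_1)\,\mathbf{1}_{]s,t[}(\theta_1)\\&+\int_s^th(r_1)K_H(dr_1,\theta_1)\,\mathbf{1}_{]0,s[}(\theta_1)\mathbf{1}_{\{s\ne0\}},\end{aligned}$$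 and for $n\ge2$, writing $K^{*,(m)}_{H,r}:=K^{*,(m)}_{H,0,r}$, $\vee$ for maximum and $\bar\theta=(\theta_1,\dots,\theta_{n-1})$, $$\begin{aligned}(K^{*,(n)}_{H,s,t}h)(\theta_1,\dots,\theta_n)=&\,\big(K^{*,(n-1)}_{H,\theta_n}h(\cdot,\theta_n)\big)(\bar\theta)\,K_H(t,\theta_n)\,\mathbf{1}_{[0,\theta_n]^{n-1}}(\bar\theta)\mathbf{1}_{]s,t[}(\theta_n)\\&+\int_{\theta_n}^t\big(K^{*,(n-1)}_{H,\theta_n}[h(\cdot,r_n)-h(\cdot,\theta_n)]\big)(\bar\theta)\,K_H(dr_n,\theta_n)\,\mathbf{1}_{[0,\theta_n]^{n-1}}(\bar\theta)\mathbf{1}_{]s,t[}(\theta_n)\\&+\int_{\vee_{i=1}^n\theta_i}^t\big(K^{*,(n-1)}_{H,\theta_n,r_n}h(\cdot,r_n)\big)(\bar\theta)\,K_H(dr_n,\theta_n)\,\mathbf{1}_{[0,t]^{n-1}}(\bar\theta)\mathbf{1}_{]s,t[}(\theta_n)\\&+\int_{\vee_{i=1}^{n-1}\theta_i\vee s}^t\big(K^{*,(n-1)}_{H,r_n}h(\cdot,r_n)\big)(\bar\theta)\,K_H(dr_n,\theta_n)\,\mathbf{1}_{[0,t]^{n-1}}(\bar\theta)\mathbf{1}_{]0,s[}(\theta_n)\mathbf{1}_{\{s\ne0\}}.\end{aligned}$$ *)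

theory Defs
  imports "HOL-Probability.Probability"
begin

section \<open>Fractional Brownian motion and the kernel of its Volterra representation\<close>

text \<open>Degenerate (almost surely constant) variables count as Gaussian.\<close>

definition gaussian_rv :: "'a measure \<Rightarrow> ('a \<Rightarrow> real) \<Rightarrow> bool" where
  "gaussian_rv M X \<longleftrightarrow> X \<in> borel_measurable M \<and>
     ((\<exists>m \<sigma>. 0 < \<sigma> \<and> distributed M lborel X (normal_density m \<sigma>)) \<or>
      (\<exists>m. AE \<omega> in M. X \<omega> = m))"

definition gaussian_process :: "'a measure \<Rightarrow> (real \<Rightarrow> 'a \<Rightarrow> real) \<Rightarrow> bool" where
  "gaussian_process M X \<longleftrightarrow> (\<forall>t\<ge>0. X t \<in> borel_measurable M) \<and>
     (\<forall>F a. finite F \<and> F \<subseteq> {0..} \<longrightarrow> gaussian_rv M (\<lambda>\<omega>. \<Sum>t\<in>F. a t * X t \<omega>))"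

definition fractional_brownian_motion :: "'a measure \<Rightarrow> real \<Rightarrow> (real \<Rightarrow> 'a \<Rightarrow> real) \<Rightarrow> bool" where
  "fractional_brownian_motion M H B \<longleftrightarrow> prob_space M \<and> gaussian_process M B \<and>
     (\<forall>t\<ge>0. prob_space.expectation M (B t) = 0) \<and>
     (\<forall>s\<ge>0. \<forall>t\<ge>0. prob_space.expectation M (\<lambda>\<omega>. B s \<omega> * B t \<omega>) =
        (s powr (2 * H) + t powr (2 * H) - \<bar>t - s\<bar> powr (2 * H)) / 2)"

definition brownian_motion :: "'a measure \<Rightarrow> (real \<Rightarrow> 'a \<Rightarrow> real) \<Rightarrow> bool" where
  "brownian_motion M W \<longleftrightarrow> prob_space M \<and>
     (\<forall>t\<ge>0. W t \<in> borel_measurable M) \<and>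
     (AE \<omega> in M. W 0 \<omega> = 0) \<and>
     (\<forall>s t. 0 \<le> s \<and> s < t \<longrightarrow>
        distributed M lborel (\<lambda>\<omega>. W t \<omega> - W s \<omega>) (normal_density 0 (sqrt (t - s)))) \<and>
     (\<forall>(\<tau> :: nat \<Rightarrow> real) N. 0 \<le> \<tau> 0 \<and> mono \<tau> \<longrightarrow>
        prob_space.indep_vars M (\<lambda>_. borel) (\<lambda>i \<omega>. W (\<tau> (Suc i)) \<omega> - W (\<tau> i) \<omega>) {..<N}) \<and>
     (AE \<omega> in M. continuous_on {0..} (\<lambda>t. W t \<omega>))"

text \<open>
  \<open>is_wiener_integral M W t f X\<close> says that \<open>X\<close> is a version of the Wiener integral of the
  deterministic function \<open>f\<close> with respect to \<open>W\<close> over \<open>]0,t[\<close>: the mean-square limit of the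
  elementary integrals of step functions converging to \<open>f\<close> in \<open>L\<^sup>2(]0,t[)\<close>.
\<close>

definition is_wiener_integral ::
    "'a measure \<Rightarrow> (real \<Rightarrow> 'a \<Rightarrow> real) \<Rightarrow> real \<Rightarrow> (real \<Rightarrow> real) \<Rightarrow> ('a \<Rightarrow> real) \<Rightarrow> bool" where
  "is_wiener_integral M W t f X \<longleftrightarrow>
     X \<in> borel_measurable M \<and> set_borel_measurable lborel {0<..<t} f \<and>
     (\<exists>(N :: nat \<Rightarrow> nat) (a :: nat \<Rightarrow> nat \<Rightarrow> real) (\<tau> :: nat \<Rightarrow> nat \<Rightarrow> real).
        (\<forall>k. mono (\<tau> k) \<and> range (\<tau> k) \<subseteq> {0..t}) \<and>
        (\<lambda>k. \<integral>\<^sup>+u\<in>{0<..<t}. ennreal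
            ((f u - (\<Sum>i<N k. a k i * indicator {\<tau> k i<..\<tau> k (Suc i)} u))\<^sup>2) \<partial>lborel)
          \<longlonglongrightarrow> 0 \<and>
        (\<lambda>k. \<integral>\<^sup>+\<omega>. ennreal
            ((X \<omega> - (\<Sum>i<N k. a k i * (W (\<tau> k (Suc i)) \<omega> - W (\<tau> k i) \<omega>)))\<^sup>2) \<partial>M)
          \<longlonglongrightarrow> 0)"

text \<open>The kernel with a free multiplicative constant \<open>c\<close>; it is meaningful for \<open>0 < \<theta> < t\<close>.\<close>

definition KH_with_const :: "real \<Rightarrow> real \<Rightarrow> real \<Rightarrow> real \<Rightarrow> real" where
  "KH_with_const c H t \<theta> = c * ((t - \<theta>) powr (H - 1/2) +
     (1/2 - H) * (LINT u:{\<theta><..<t}|lborel.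
        (u - \<theta>) powr (H - 3/2) * (1 - (\<theta> / u) powr (1/2 - H))))"

text \<open>
  Whether a constant normalises the kernel depends only on the law of Brownian motion, and
  Brownian motion exists on a probability space over the reals, so fixing the sample space to
  be of type \<open>real\<close> loses no generality.
\<close>

definition cH :: "real \<Rightarrow> real" where
  "cH H = (THE c. 0 < c \<and>
     (\<forall>(M :: real measure) W B.
        brownian_motion M W \<and>
        (\<forall>t\<ge>0. is_wiener_integral M W t (KH_with_const c H t) (B t)) \<longrightarrow>
        fractional_brownian_motion M H B))"

definition KH :: "real \<Rightarrow> real \<Rightarrow> real \<Rightarrow> real" where
  "KH H t \<theta> = KH_with_const (cH H) H t \<theta>"

text \<open>The density of \<open>K\<^sub>H(dr, \<theta>)\<close>, i.e. the partial derivative in the time variable.\<close>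

definition dKH :: "real \<Rightarrow> real \<Rightarrow> real \<Rightarrow> real" where
  "dKH H r \<theta> = deriv (\<lambda>t. KH H t \<theta>) r"

section \<open>Hoelder spaces on the simplex\<close>

text \<open>
  A vector of length \<open>n\<close> is a function in \<open>{1..n} \<rightarrow>\<^sub>E UNIV\<close>. Functions on the simplex are
  represented by total functions; their values off the simplex are irrelevant.
\<close>

definition ordered_simplex :: "nat \<Rightarrow> real \<Rightarrow> (nat \<Rightarrow> real) set" where
  "ordered_simplex n t = {\<theta> \<in> {1..n} \<rightarrow>\<^sub>E {0..t}. mono_on {1..n} \<theta>}"

text \<open>The iterated difference in the coordinates listed in the first argument.\<close>

primrec cube_diff ::
    "nat list \<Rightarrow> ((nat \<Rightarrow> real) \<Rightarrow> real) \<Rightarrow> (nat \<Rightarrow> real) \<Rightarrow> (nat \<Rightarrow> real) \<Rightarrow> real" where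
  "cube_diff [] g \<theta> r = g \<theta>"
| "cube_diff (i # js) g \<theta> r = cube_diff js g (\<theta>(i := r i)) r - cube_diff js g \<theta> r"

definition cube :: "nat \<Rightarrow> nat set \<Rightarrow> (nat \<Rightarrow> real) \<Rightarrow> (nat \<Rightarrow> real) \<Rightarrow> (nat \<Rightarrow> real) set" where
  "cube n I \<theta> r = (\<Pi>\<^sub>E i\<in>{1..n}. if i \<in> I then {\<theta> i..r i} else {\<theta> i})"

text \<open>
  An index set \<open>I\<close> with \<open>k\<close> elements stands for the multi-index \<open>i\<^sub>1 < \<dots> < i\<^sub>k\<close>; only the values
  of \<open>r\<close> on \<open>I\<close> matter.
\<close>

definition admissible_cubes ::
    "nat \<Rightarrow> real \<Rightarrow> nat set \<Rightarrow> ((nat \<Rightarrow> real) \<times> (nat \<Rightarrow> real)) set" where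
  "admissible_cubes n t I = {(\<theta>, r). \<theta> \<in> ordered_simplex n t \<and>
     (\<forall>i\<in>I. 0 \<le> \<theta> i \<and> \<theta> i < r i \<and> r i \<le> t) \<and>
     (\<forall>i\<in>I. \<forall>j\<in>I. i < j \<longrightarrow> r i \<le> \<theta> j) \<and>
     cube n I \<theta> r \<subseteq> ordered_simplex n t}"

definition holder_norm :: "real \<Rightarrow> nat \<Rightarrow> real \<Rightarrow> ((nat \<Rightarrow> real) \<Rightarrow> real) \<Rightarrow> ennreal" where
  "holder_norm lam n t g = (SUP \<theta>\<in>ordered_simplex n t. ennreal \<bar>g \<theta>\<bar>) +
     (\<Sum>k=1..n. \<Sum>I\<in>{I. I \<subseteq> {1..n} \<and> card I = k}.
        SUP (\<theta>, r)\<in>admissible_cubes n t I.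
          ennreal (\<bar>cube_diff (sorted_list_of_set I) g \<theta> r\<bar> /
                   (\<Prod>i\<in>I. \<bar>r i - \<theta> i\<bar> powr lam)))"

definition holder_space :: "real \<Rightarrow> nat \<Rightarrow> real \<Rightarrow> ((nat \<Rightarrow> real) \<Rightarrow> real) set" where
  "holder_space lam n t = {g. holder_norm lam n t g < \<infinity>}"

section \<open>Square-integrable functions on the cube\<close>

definition cube_measure :: "nat \<Rightarrow> real \<Rightarrow> (nat \<Rightarrow> real) measure" where
  "cube_measure n t = PiM {1..n} (\<lambda>_. restrict_space lborel {0..t})"

definition L2_space :: "nat \<Rightarrow> real \<Rightarrow> ((nat \<Rightarrow> real) \<Rightarrow> real) set" where
  "L2_space n t = {f \<in> borel_measurable (cube_measure n t).
     integrable (cube_measure n t) (\<lambda>\<theta>. (f \<theta>)\<^sup>2)}"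

definition L2_norm :: "nat \<Rightarrow> real \<Rightarrow> ((nat \<Rightarrow> real) \<Rightarrow> real) \<Rightarrow> real" where
  "L2_norm n t f = sqrt (LINT \<theta>|cube_measure n t. (f \<theta>)\<^sup>2)"

text \<open>
  Continuous linear operators from the Hoelder space on the simplex to \<open>L\<^sup>2\<close> of the cube.
  Elements of \<open>L\<^sup>2\<close> are identified when they agree almost everywhere.
\<close>

definition continuous_linear_operator ::
    "real \<Rightarrow> nat \<Rightarrow> real \<Rightarrow> (((nat \<Rightarrow> real) \<Rightarrow> real) \<Rightarrow> (nat \<Rightarrow> real) \<Rightarrow> real) \<Rightarrow> bool" where
  "continuous_linear_operator lam n t A \<longleftrightarrow>
     (\<forall>g\<in>holder_space lam n t. A g \<in> L2_space n t) \<and>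
     (\<forall>f\<in>holder_space lam n t. \<forall>g\<in>holder_space lam n t. \<forall>a b.
        AE \<theta> in cube_measure n t.
          A (\<lambda>x. a * f x + b * g x) \<theta> = a * A f \<theta> + b * A g \<theta>) \<and>
     (\<forall>g\<in>holder_space lam n t. \<forall>e>0. \<exists>d>0. \<forall>f\<in>holder_space lam n t.
        holder_norm lam n t (\<lambda>x. f x - g x) < ennreal d \<longrightarrow>
        L2_norm n t (\<lambda>\<theta>. A f \<theta> - A g \<theta>) < e)"

section \<open>The operators \<open>K\<^sup>*\<close>\<close>

text \<open>
  The value for \<open>n = 0\<close> is a dummy. In the recursive clause, \<open>n = Suc (Suc m)\<close>, \<open>bar\<close> is
  \<open>(\<theta>\<^sub>1, \<dots>, \<theta>\<^bsub>n-1\<^esub>)\<close>, and \<open>h(\<cdot>, r)\<close> is \<open>\<lambda>x. h (x(n := r))\<close>.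
\<close>

fun Kstar ::
    "real \<Rightarrow> nat \<Rightarrow> real \<Rightarrow> real \<Rightarrow> ((nat \<Rightarrow> real) \<Rightarrow> real) \<Rightarrow> (nat \<Rightarrow> real) \<Rightarrow> real" where
  "Kstar H 0 s t h \<theta> = 0"
| "Kstar H (Suc 0) s t h \<theta> =
     h \<theta> * KH H t (\<theta> 1) * indicator {s<..<t} (\<theta> 1)
   + (LINT r:{\<theta> 1<..<t}|lborel. (h (\<theta>(1 := r)) - h \<theta>) * dKH H r (\<theta> 1))
       * indicator {s<..<t} (\<theta> 1)
   + (LINT r:{s<..<t}|lborel. h (\<theta>(1 := r)) * dKH H r (\<theta> 1))
       * indicator {0<..<s} (\<theta> 1) * of_bool (s \<noteq> 0)"
| "Kstar H (Suc (Suc m)) s t h \<theta> = (let n = Suc (Suc m); bar = restrict \<theta> {1..n - 1} in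
     Kstar H (Suc m) 0 (\<theta> n) (\<lambda>x. h (x(n := \<theta> n))) bar * KH H t (\<theta> n)
       * indicator ({1..n - 1} \<rightarrow>\<^sub>E {0..\<theta> n}) bar * indicator {s<..<t} (\<theta> n)
   + (LINT r:{\<theta> n<..<t}|lborel.
        Kstar H (Suc m) 0 (\<theta> n) (\<lambda>x. h (x(n := r)) - h (x(n := \<theta> n))) bar * dKH H r (\<theta> n))
       * indicator ({1..n - 1} \<rightarrow>\<^sub>E {0..\<theta> n}) bar * indicator {s<..<t} (\<theta> n)
   + (LINT r:{Max (\<theta> ` {1..n})<..<t}|lborel.
        Kstar H (Suc m) (\<theta> n) r (\<lambda>x. h (x(n := r))) bar * dKH H r (\<theta> n))
       * indicator ({1..n - 1} \<rightarrow>\<^sub>E {0..t}) bar * indicator {s<..<t} (\<theta> n)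
   + (LINT r:{max (Max (\<theta> ` {1..n - 1})) s<..<t}|lborel.
        Kstar H (Suc m) 0 r (\<lambda>x. h (x(n := r))) bar * dKH H r (\<theta> n))
       * indicator ({1..n - 1} \<rightarrow>\<^sub>E {0..t}) bar * indicator {0<..<s} (\<theta> n) * of_bool (s \<noteq> 0))"

end

theory Submission
  imports Defs
begin

text \<open>
  The last coordinate splits off: freezing it turns a Hoelder function on the \<open>n\<close>-simplex into one on
  the \<open>(n-1)\<close>-simplex, and a difference of two such slices at \<open>u < r\<close> gains a factor \<open>(r - u)\<^sup>\<lambda>\<close>. Hence
  \<open>\<bar>K\<^sup>* h\<bar>\<close> is pointwise at most the Hoelder norm of \<open>h\<close> times a majorant that does not depend on \<open>h\<close> and
  satisfies a recursion in \<open>n\<close>. Minkowski's integral inequality, in the form of a weighted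
  Cauchy-Schwarz inequality, shows by induction that the \<open>L\<^sup>2\<close> norm of the majorant is
  \<open>O((t - s)\<^sup>H)\<close>: the singularity \<open>(r - y) powr (H - 3/2)\<close> of the kernel is compensated once by
  \<open>(r - y)\<^sup>\<lambda>\<close> and once by the factor \<open>(r - y)\<^sup>H\<close> from the induction hypothesis, and the latter is where
  \<open>H > 1/4\<close> enters. The operator is linear at every point where the majorant is finite.
\<close>

section \<open>Estimates for the Volterra kernel\<close>

text \<open>The induction hypothesis has to carry the rate \<open>(t - s) powr H\<close>, not mere
  boundedness. For a last coordinate \<open>y\<close> in \<open>]s,t[\<close> the rate at the next
  level comes from integrating squares such as \<open>(t - y) powr (2 * H - 1)\<close>; for
  \<open>y < s\<close> it comes from the norm of \<open>(r - y) powr (H - 3/2)\<close> over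
  \<open>]0,s[\<close>, which is of order \<open>(r - s) powr (H - 1)\<close> and integrates to
  order \<open>(t - s) powr H\<close>. There the remaining coordinates only have to be bounded. But
  where the inner operator starts at \<open>y\<close> and ends at \<open>r\<close>, its rate
  \<open>(r - y) powr H\<close> is what makes the integral in \<open>r\<close> converge. The other
  obstacle is measurability: \<open>h\<close> off the simplex and \<open>dKH\<close> off
  \<open>0 < y < r\<close> are arbitrary. On the cube neither contributes to the operator, so it
  agrees there with \<open>Kop\<close>, taken with measurable kernels and applied to
  \<open>h\<close> cut off by the indicator of the simplex. The cut-off is measurable because a
  Hoelder function is continuous on the closed simplex. Only then can the integrals be split for
  linearity.\<close>

lemma nn_integral_powr_left:
  fixes a b q :: real
  assumes "a \<le> b" "-1 < q"
  shows "(\<integral>\<^sup>+u\<in>{a<..<b}. ennreal ((u - a) powr q) \<partial>lborel) = ennreal ((b - a) powr (q + 1) / (q + 1))"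
proof -
  have "((\<lambda>u. (u - a) powr q) has_integral
      ((b - a) powr (q + 1) / (q + 1) - (a - a) powr (q + 1) / (q + 1))) {a..b}"
  \<comment> \<open>For \<open>q < 0\<close> the integrand is singular at \<open>a\<close>, but
    \<open>q + 1 > 0\<close> keeps the antiderivative continuous there, which is all that the
    interior version asks at the endpoints.\<close>
  proof (rule fundamental_theorem_of_calculus_interior)
    show "continuous_on {a..b} (\<lambda>u. (u - a) powr (q + 1) / (q + 1))"
      using assms by (intro continuous_intros continuous_on_powr') auto
    show "((\<lambda>u. (u - a) powr (q + 1) / (q + 1)) has_vector_derivative (x - a) powr q) (at x)"
      if "x \<in> {a<..<b}" for x
      unfolding has_real_derivative_iff_has_vector_derivative[symmetric]
      using assms that by (auto intro!: derivative_eq_intros)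
  qed fact
  then have "((\<lambda>u. (u - a) powr q) has_integral ((b - a) powr (q + 1) / (q + 1))) {a<..<b}"
    by (simp add: has_integral_Icc_iff_Ioo)
  from nn_integral_has_integral_lebesgue[OF _ this] show ?thesis
    by (simp add: mult.commute ennreal_mult ennreal_indicator)
qed

lemma nn_integral_powr_right:
  fixes a b q :: real
  assumes "a \<le> b" "-1 < q"
  shows "(\<integral>\<^sup>+u\<in>{a<..<b}. ennreal ((b - u) powr q) \<partial>lborel) = ennreal ((b - a) powr (q + 1) / (q + 1))"
proof -
  have "((\<lambda>u. (b - u) powr q) has_integral
      (- ((b - b) powr (q + 1) / (q + 1)) - - ((b - a) powr (q + 1) / (q + 1)))) {a..b}"
  proof (rule fundamental_theorem_of_calculus_interior)
    show "continuous_on {a..b} (\<lambda>u. - ((b - u) powr (q + 1) / (q + 1)))"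
      using assms by (intro continuous_intros continuous_on_powr') auto
    show "((\<lambda>u. - ((b - u) powr (q + 1) / (q + 1))) has_vector_derivative (b - x) powr q) (at x)"
      if "x \<in> {a<..<b}" for x
      unfolding has_real_derivative_iff_has_vector_derivative[symmetric]
      using assms that by (auto intro!: derivative_eq_intros)
  qed fact
  then have "((\<lambda>u. (b - u) powr q) has_integral ((b - a) powr (q + 1) / (q + 1))) {a<..<b}"
    by (simp add: has_integral_Icc_iff_Ioo)
  from nn_integral_has_integral_lebesgue[OF _ this] show ?thesis
    by (simp add: mult.commute ennreal_mult ennreal_indicator)
qed

text \<open>The singularity at \<open>r\<close> lies outside the domain, at distance
  \<open>r - s\<close>. The endpoint 0 contributes a nonpositive amount, which is dropped; what
  remains depends on the gap \<open>r - s\<close> alone.\<close>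

lemma nn_integral_powr_outside:
  fixes r s q :: real
  assumes "0 \<le> s" "s < r" "q < -1"
  shows "(\<integral>\<^sup>+y\<in>{0<..<s}. ennreal ((r - y) powr q) \<partial>lborel) \<le> ennreal ((r - s) powr (q + 1) / - (q + 1))"
proof -
  have "((\<lambda>y. (r - y) powr q) has_integral
      (- ((r - s) powr (q + 1) / (q + 1)) - - ((r - 0) powr (q + 1) / (q + 1)))) {0..s}"
  proof (rule fundamental_theorem_of_calculus_interior)
    show "continuous_on {0..s} (\<lambda>u. - ((r - u) powr (q + 1) / (q + 1)))"
      using assms by (intro continuous_intros) auto
    show "((\<lambda>u. - ((r - u) powr (q + 1) / (q + 1))) has_vector_derivative (r - x) powr q) (at x)"
      if "x \<in> {0<..<s}" for x
      unfolding has_real_derivative_iff_has_vector_derivative[symmetric]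
      using assms that by (auto intro!: derivative_eq_intros)
  qed fact
  then have "((\<lambda>u. (r - u) powr q) has_integral
      (- ((r - s) powr (q + 1) / (q + 1)) - - ((r - 0) powr (q + 1) / (q + 1)))) {0<..<s}"
    by (simp add: has_integral_Icc_iff_Ioo)
  from nn_integral_has_integral_lebesgue[OF _ this] have
    "(\<integral>\<^sup>+y\<in>{0<..<s}. ennreal ((r - y) powr q) \<partial>lborel)
      = ennreal (- ((r - s) powr (q + 1) / (q + 1)) - - ((r - 0) powr (q + 1) / (q + 1)))"
    by (simp add: mult.commute ennreal_mult ennreal_indicator)
  also have "\<dots> \<le> ennreal ((r - s) powr (q + 1) / - (q + 1))"
  proof (intro ennreal_leI)
    define p where "p = q + 1"
    have "(r - 0) powr p / p \<le> 0"
      using assms by (intro divide_nonneg_neg) (auto simp: p_def)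
    then have "- ((r - s) powr p / p) - - ((r - 0) powr p / p) \<le> (r - s) powr p / - p"
      unfolding divide_minus_right by linarith
    then show "- ((r - s) powr (q + 1) / (q + 1)) - - ((r - 0) powr (q + 1) / (q + 1))
        \<le> (r - s) powr (q + 1) / - (q + 1)"
      unfolding p_def .
  qed
  finally show ?thesis .
qed

definition KH_integrand :: "real \<Rightarrow> real \<Rightarrow> real \<Rightarrow> real" where
  "KH_integrand H y u = (u - y) powr (H - 3/2) * (1 - (y / u) powr (1/2 - H))"

text \<open>The exponent \<open>1 - 2 * H\<close> is chosen so that the bound is still integrable in \<open>u\<close> near \<open>y\<close>, while
  its square is integrable in \<open>y\<close> near \<open>0\<close> precisely when \<open>H > 1/4\<close>.\<close>

lemma KH_integrand_bound:
  assumes "0 < H" "H < 1/2" "0 < y" "y < u"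
  shows "0 \<le> KH_integrand H y u"
    and "KH_integrand H y u \<le> (u - y) powr (- H - 1/2) * y powr (2 * H - 1)"
proof -
  have x: "0 < y / u" "y / u < 1" using assms by auto
  have le1: "(y / u) powr (1/2 - H) \<le> 1" using x assms by (intro powr_le1) auto
  \<comment> \<open>On \<open>]0,1[\<close> a smaller exponent gives a larger power. Used for
    \<open>y / u\<close> with \<open>1/2 - H \<le> 1\<close> this replaces the bracket by
    \<open>(u - y) / u\<close>; used for \<open>(u - y) / u\<close> with
    \<open>1 - 2 * H \<le> 1\<close> it produces the factor that weakens the singularity at
    \<open>u = y\<close>.\<close>
  have "y / u = (y / u) powr 1" using x by (simp only: powr_one less_imp_le)
  also have "\<dots> \<le> (y / u) powr (1/2 - H)" using x assms by (intro powr_mono') auto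
  finally have "1 - (y / u) powr (1/2 - H) \<le> (u - y) / u" using assms by (simp add: field_simps)
  also have "\<dots> = ((u - y) / u) powr 1" using assms by simp
  also have "\<dots> \<le> ((u - y) / u) powr (1 - 2 * H)" using assms by (intro powr_mono') auto
  also have "\<dots> = (u - y) powr (1 - 2 * H) * u powr (2 * H - 1)"
    using assms by (simp add: powr_divide powr_minus_divide[symmetric] divide_powr_uminus)
  also have "\<dots> \<le> (u - y) powr (1 - 2 * H) * y powr (2 * H - 1)"
    using assms by (intro mult_left_mono powr_mono2') auto
  finally have "KH_integrand H y u
      \<le> (u - y) powr (H - 3/2) * ((u - y) powr (1 - 2 * H) * y powr (2 * H - 1))"
    unfolding KH_integrand_def by (intro mult_left_mono) auto
  also have "\<dots> = (u - y) powr (- H - 1/2) * y powr (2 * H - 1)"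
    using powr_add[of "u - y" "H - 3/2" "1 - 2 * H"] by (simp add: algebra_simps)
  finally show "KH_integrand H y u \<le> (u - y) powr (- H - 1/2) * y powr (2 * H - 1)" .
  show "0 \<le> KH_integrand H y u" using le1 by (simp add: KH_integrand_def)
qed

lemma KH_integrand_measurable [measurable]:
  "(\<lambda>(y, u). KH_integrand H y u) \<in> borel_measurable (borel \<Otimes>\<^sub>M borel)"
  unfolding KH_integrand_def by measurable

lemma nn_integral_KH_integrand:
  assumes "0 < H" "H < 1/2" "0 < y" "y < t"
  shows "(\<integral>\<^sup>+u\<in>{y<..<t}. ennreal (KH_integrand H y u) \<partial>lborel)
     \<le> ennreal ((t - y) powr (1/2 - H) / (1/2 - H) * y powr (2 * H - 1))"
proof -
  have "(\<integral>\<^sup>+u\<in>{y<..<t}. ennreal (KH_integrand H y u) \<partial>lborel)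
      \<le> (\<integral>\<^sup>+u. ennreal ((u - y) powr (- H - 1/2)) * indicator {y<..<t} u * ennreal (y powr (2 * H - 1)) \<partial>lborel)"
    using KH_integrand_bound[OF assms(1-3)]
    by (intro nn_integral_mono) (auto split: split_indicator simp flip: ennreal_mult'' intro!: ennreal_leI)
  also have "\<dots> = ennreal ((t - y) powr (1/2 - H) / (1/2 - H)) * ennreal (y powr (2 * H - 1))"
    using assms nn_integral_powr_left[of y t "- H - 1/2"] by (subst nn_integral_multc) auto
  finally show ?thesis using assms by (simp flip: ennreal_mult'')
qed

lemma KH_integrand_integrable:
  assumes "0 < H" "H < 1/2" "0 < y"
  shows "set_integrable lborel {y<..<t} (KH_integrand H y)"
proof (cases "y < t")
  case True
  have "(\<integral>\<^sup>+u. ennreal (indicator {y<..<t} u * KH_integrand H y u) \<partial>lborel)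
    = (\<integral>\<^sup>+u\<in>{y<..<t}. ennreal (KH_integrand H y u) \<partial>lborel)"
    by (intro nn_integral_cong) (auto split: split_indicator)
  also have "\<dots> < \<infinity>"
    using nn_integral_KH_integrand[OF assms True] by (rule le_less_trans) simp
  finally show ?thesis
    unfolding set_integrable_def
    by (intro integrableI_nonneg) (auto split: split_indicator intro!: KH_integrand_bound assms)
qed (simp add: set_integrable_def)

text \<open>The integrand is singular at the lower limit \<open>y\<close>, so the fundamental
  theorem is applied only on \<open>[c,d]\<close>, a neighbourhood of \<open>r\<close> away from
  \<open>y\<close>. The integral over \<open>]y,c]\<close> is a finite constant there.\<close>

lemma KH_integral_deriv:
  assumes "0 < H" "H < 1/2" "0 < y" "y < r"
  shows "((\<lambda>t. LINT u:{y<..<t}|lborel. KH_integrand H y u) has_real_derivative KH_integrand H y r) (at r)"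
proof -
  define c d where "c = (y + r) / 2" and "d = r + 1"
  have cd: "y < c" "c < r" "r < d" using assms by (auto simp: c_def d_def)
  have cont: "continuous_on {c..d} (KH_integrand H y)"
    unfolding KH_integrand_def using assms cd by (intro continuous_intros) auto
  have split: "(LINT u:{y<..<t}|lborel. KH_integrand H y u)
      = (LINT u:{y<..c}|lborel. KH_integrand H y u) + (LBINT u=c..t. KH_integrand H y u)"
    if t: "t \<in> {c<..<d}" for t
  proof -
    have *: "{y<..<t} = {y<..c} \<union> {c<..<t}" using t cd by auto
    have "(LINT u:{y<..<t}|lborel. KH_integrand H y u)
        = (LINT u:{y<..c}|lborel. KH_integrand H y u) + (LINT u:{c<..<t}|lborel. KH_integrand H y u)"
      unfolding * by (rule set_integral_Un)
        (use t cd in \<open>auto intro!: set_integrable_subset[OF KH_integrand_integrable[OF assms(1-3), of t]]\<close>)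
    then show ?thesis using t by (simp add: interval_integral_Ioo)
  qed
  have "((\<lambda>t. LBINT u=c..t. KH_integrand H y u) has_vector_derivative KH_integrand H y r) (at r within {c..d})"
    using cd by (intro interval_integral_FTC2 cont) auto
  then have "((\<lambda>t. LBINT u=c..t. KH_integrand H y u) has_real_derivative KH_integrand H y r) (at r within {c<..<d})"
    unfolding has_real_derivative_iff_has_vector_derivative
    by (rule has_vector_derivative_within_subset) auto
  then have "((\<lambda>t. LBINT u=c..t. KH_integrand H y u) has_real_derivative KH_integrand H y r) (at r)"
    using cd at_within_open[of r "{c<..<d}"] by simp
  then have "((\<lambda>t. (LINT u:{y<..c}|lborel. KH_integrand H y u) + (LBINT u=c..t. KH_integrand H y u))
      has_real_derivative 0 + KH_integrand H y r) (at r)"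
    by (intro DERIV_add DERIV_const)
  then have "((\<lambda>t. LINT u:{y<..<t}|lborel. KH_integrand H y u) has_real_derivative 0 + KH_integrand H y r) (at r)"
    by (rule has_field_derivative_transform_within_open[where S = "{c<..<d}"]) (use cd split in auto)
  then show ?thesis by simp
qed

text \<open>The derivative of the first summand of the kernel cancels against the \<open>1\<close>
  in the bracket of the integrand at \<open>u = r\<close>, because their coefficients are
  \<open>H - 1/2\<close> and \<open>1/2 - H\<close>. The other part of the bracket is the
  density.\<close>

lemma dKH_eq:
  assumes "0 < H" "H < 1/2" "0 < y" "y < r"
  shows "dKH H r y = cH H * (H - 1/2) * (y / r) powr (1/2 - H) * (r - y) powr (H - 3/2)"
proof -
  have "((\<lambda>t. cH H * ((t - y) powr (H - 1/2) + (1/2 - H) * (LINT u:{y<..<t}|lborel. KH_integrand H y u)))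
     has_real_derivative cH H * ((H - 1/2) * (r - y) powr (H - 3/2) + (1/2 - H) * KH_integrand H y r)) (at r)"
    using assms by (auto intro!: derivative_eq_intros KH_integral_deriv)
  from DERIV_imp_deriv[OF this] show ?thesis
    unfolding dKH_def KH_def KH_with_const_def KH_integrand_def
    by (simp add: algebra_simps)
qed

text \<open>Integrating the bound of the integrand creates a denominator \<open>1/2 - H\<close>,
  which the factor in front of the integral cancels. The first summand is singular at
  \<open>y = t\<close>, the second at \<open>y = 0\<close>.\<close>

lemma KH_bound:
  assumes "0 < H" "H < 1/2" "0 < y" "y < t"
  shows "\<bar>KH H t y\<bar> \<le> \<bar>cH H\<bar> * ((t - y) powr (H - 1/2) + (t - y) powr (1/2 - H) * y powr (2 * H - 1))"
proof -
  let ?I = "LINT u:{y<..<t}|lborel. KH_integrand H y u"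
  have I0: "0 \<le> ?I"
    unfolding set_lebesgue_integral_def
    by (intro integral_nonneg_AE) (auto split: split_indicator intro!: AE_I2 KH_integrand_bound assms)
  have "ennreal (norm ?I) \<le> (\<integral>\<^sup>+u. norm (indicator {y<..<t} u *\<^sub>R KH_integrand H y u) \<partial>lborel)"
    using KH_integrand_integrable[OF assms(1-3), of t] unfolding set_lebesgue_integral_def set_integrable_def
    by (rule integral_norm_bound_ennreal)
  also have "\<dots> = (\<integral>\<^sup>+u\<in>{y<..<t}. ennreal (KH_integrand H y u) \<partial>lborel)"
    using KH_integrand_bound(1)[OF assms(1-3)]
    by (intro nn_integral_cong) (auto split: split_indicator)
  also note nn_integral_KH_integrand[OF assms]
  finally have I: "?I \<le> (t - y) powr (1/2 - H) / (1/2 - H) * y powr (2 * H - 1)"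
    using I0 assms by (subst (asm) ennreal_le_iff) auto
  have "(1/2 - H) * ?I \<le> (1/2 - H) * ((t - y) powr (1/2 - H) / (1/2 - H) * y powr (2 * H - 1))"
    using I assms by (intro mult_left_mono) auto
  also have "\<dots> = (t - y) powr (1/2 - H) * y powr (2 * H - 1)" using assms by simp
  finally have "\<bar>(t - y) powr (H - 1/2) + (1/2 - H) * ?I\<bar>
     \<le> (t - y) powr (H - 1/2) + (t - y) powr (1/2 - H) * y powr (2 * H - 1)"
    using I0 assms by simp
  then show ?thesis
    unfolding KH_def KH_with_const_def KH_integrand_def[symmetric] abs_mult
    by (intro mult_left_mono) auto
qed

text \<open>The domain of integration moves with both arguments. Reading its indicator as two
  inequalities turns the integrand into a jointly measurable function of all three
  variables.\<close>

lemma KH_measurable [measurable]: "(\<lambda>(t, y). KH H t y) \<in> borel_measurable (borel \<Otimes>\<^sub>M borel)"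
  unfolding KH_def KH_with_const_def set_lebesgue_integral_def indicator_def
    greaterThanLessThan_iff
  by measurable

section \<open>Minkowski's integral inequality\<close>

text \<open>Here \<open>b r\<close>, up to a common constant, is an explicit bound for the norm of
  \<open>f(., r)\<close>. Writing \<open>f\<close> as \<open>f / sqrt b\<close> times
  \<open>sqrt b\<close>, Cauchy-Schwarz in \<open>r\<close> splits off one factor equal to the
  integral of \<open>b\<close>; after exchanging the integrals, the weight \<open>1 / b\<close>
  reduces \<open>C * b^2\<close> to \<open>C * b\<close> and yields the second factor. Dividing by
  the bound instead of the norm itself avoids the values 0 and infinity.\<close>

lemma nn_integral_Minkowski:
  fixes f :: "'a \<Rightarrow> 'b \<Rightarrow> ennreal" and b :: "'b \<Rightarrow> real"
  assumes "sigma_finite_measure M" "sigma_finite_measure N"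
    and [measurable]: "(\<lambda>(x, r). f x r) \<in> borel_measurable (M \<Otimes>\<^sub>M N)"
      "b \<in> borel_measurable N" "A \<in> sets N"
    and pos: "\<And>r. r \<in> A \<Longrightarrow> 0 < b r"
    and bound: "\<And>r. r \<in> A \<Longrightarrow> (\<integral>\<^sup>+x. (f x r)\<^sup>2 \<partial>M) \<le> C * (ennreal (b r))\<^sup>2"
  shows "(\<integral>\<^sup>+x. (\<integral>\<^sup>+r\<in>A. f x r \<partial>N)\<^sup>2 \<partial>M) \<le> C * (\<integral>\<^sup>+r\<in>A. ennreal (b r) \<partial>N)\<^sup>2"
proof -
  interpret M: sigma_finite_measure M by fact
  interpret N: sigma_finite_measure N by fact
  interpret P: pair_sigma_finite M N ..
  let ?I = "\<integral>\<^sup>+r\<in>A. ennreal (b r) \<partial>N"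
  have CS: "(\<integral>\<^sup>+r\<in>A. f x r \<partial>N)\<^sup>2 \<le> (\<integral>\<^sup>+r. (f x r)\<^sup>2 * ennreal (1 / b r) * indicator A r \<partial>N) * ?I"
    if [measurable]: "x \<in> space M" for x
  proof -
    have root: "ennreal (1 / sqrt (b r)) * ennreal (sqrt (b r)) = 1" if "r \<in> A" for r
      using pos[OF that] by (simp flip: ennreal_mult)
    have "(\<integral>\<^sup>+r\<in>A. f x r \<partial>N)
        = (\<integral>\<^sup>+r. (f x r * ennreal (1 / sqrt (b r)) * indicator A r) * (ennreal (sqrt (b r)) * indicator A r) \<partial>N)"
      by (intro nn_integral_cong) (auto split: split_indicator simp: root mult.assoc)
    also have "\<dots>\<^sup>2 \<le> (\<integral>\<^sup>+r. (f x r * ennreal (1 / sqrt (b r)) * indicator A r)\<^sup>2 \<partial>N)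
        * (\<integral>\<^sup>+r. (ennreal (sqrt (b r)) * indicator A r)\<^sup>2 \<partial>N)"
      by (intro Cauchy_Schwarz_nn_integral) measurable
    also have "(\<integral>\<^sup>+r. (f x r * ennreal (1 / sqrt (b r)) * indicator A r)\<^sup>2 \<partial>N)
        = (\<integral>\<^sup>+r. (f x r)\<^sup>2 * ennreal (1 / b r) * indicator A r \<partial>N)"
    proof (intro nn_integral_cong)
      fix r
      have "(ennreal (1 / sqrt (b r)))\<^sup>2 = ennreal (1 / b r)" if "r \<in> A"
        using pos[OF that] by (subst ennreal_power) (auto simp: power_divide)
      then show "(f x r * ennreal (1 / sqrt (b r)) * indicator A r)\<^sup>2 = (f x r)\<^sup>2 * ennreal (1 / b r) * indicator A r"
        by (auto split: split_indicator simp: power_mult_distrib)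
    qed
    also have "(\<integral>\<^sup>+r. (ennreal (sqrt (b r)) * indicator A r)\<^sup>2 \<partial>N) = ?I"
    proof (intro nn_integral_cong)
      fix r
      have "(ennreal (sqrt (b r)))\<^sup>2 = ennreal (b r)" if "r \<in> A"
        using pos[OF that] by (subst ennreal_power) auto
      then show "(ennreal (sqrt (b r)) * indicator A r)\<^sup>2 = ennreal (b r) * indicator A r"
        by (auto split: split_indicator)
    qed
    finally show ?thesis .
  qed
  have "(\<integral>\<^sup>+x. (\<integral>\<^sup>+r\<in>A. f x r \<partial>N)\<^sup>2 \<partial>M)
      \<le> (\<integral>\<^sup>+x. (\<integral>\<^sup>+r. (f x r)\<^sup>2 * ennreal (1 / b r) * indicator A r \<partial>N) * ?I \<partial>M)"
    by (intro nn_integral_mono CS)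
  also have "\<dots> = (\<integral>\<^sup>+x. (\<integral>\<^sup>+r. (f x r)\<^sup>2 * ennreal (1 / b r) * indicator A r \<partial>N) \<partial>M) * ?I"
    by (intro nn_integral_multc) measurable
  also have "(\<integral>\<^sup>+x. (\<integral>\<^sup>+r. (f x r)\<^sup>2 * ennreal (1 / b r) * indicator A r \<partial>N) \<partial>M)
      = (\<integral>\<^sup>+r. (\<integral>\<^sup>+x. (f x r)\<^sup>2 * ennreal (1 / b r) * indicator A r \<partial>M) \<partial>N)"
    by (intro P.Fubini'[symmetric]) measurable
  also have "\<dots> \<le> (\<integral>\<^sup>+r. C * (ennreal (b r) * indicator A r) \<partial>N)"
  proof (intro nn_integral_mono)
    fix r assume [measurable]: "r \<in> space N"
    show "(\<integral>\<^sup>+x. (f x r)\<^sup>2 * ennreal (1 / b r) * indicator A r \<partial>M) \<le> C * (ennreal (b r) * indicator A r)"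
    proof (cases "r \<in> A")
      case True
      have "(\<integral>\<^sup>+x. (f x r)\<^sup>2 * ennreal (1 / b r) * indicator A r \<partial>M) = (\<integral>\<^sup>+x. (f x r)\<^sup>2 \<partial>M) * ennreal (1 / b r)"
        using True by (simp add: nn_integral_multc)
      also have "\<dots> \<le> C * (ennreal (b r))\<^sup>2 * ennreal (1 / b r)"
        by (intro mult_right_mono bound True) simp
      also have "\<dots> = C * ennreal (b r)"
        using pos[OF True] by (simp add: mult.assoc ennreal_power power2_eq_square flip: ennreal_mult)
      finally show ?thesis using True by simp
    qed simp
  qed
  also have "\<dots> = C * ?I" by (intro nn_integral_cmult) measurable
  finally show ?thesis
    by (simp add: power2_eq_square mult.assoc mult_right_mono)
qed

lemma ennreal_sum_square_le:
  fixes a b :: ennreal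
  shows "(a + b)\<^sup>2 \<le> 2 * a\<^sup>2 + 2 * b\<^sup>2"
proof (cases a; cases b)
  fix x y assume *: "a = ennreal x" "0 \<le> x" "b = ennreal y" "0 \<le> y"
  have "(x + y)\<^sup>2 \<le> 2 * x\<^sup>2 + 2 * y\<^sup>2" using sum_squares_bound[of x y] by (simp add: power2_sum)
  then have "ennreal ((x + y)\<^sup>2) \<le> ennreal (2 * x\<^sup>2 + 2 * y\<^sup>2)" by (rule ennreal_leI)
  moreover have "(ennreal x + ennreal y)\<^sup>2 = ennreal ((x + y)\<^sup>2)"
    using * by (simp add: ennreal_power flip: ennreal_plus)
  moreover have "ennreal (2 * x\<^sup>2 + 2 * y\<^sup>2) = 2 * (ennreal x)\<^sup>2 + 2 * (ennreal y)\<^sup>2"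
    using * by (simp add: ennreal_plus ennreal_mult ennreal_power)
  ultimately show ?thesis using * by simp
qed (auto simp: ennreal_mult_top power2_eq_square)

section \<open>A majorant of the iterated operator\<close>

text \<open>\<open>\<kappa> t y\<close> stands for a bound of \<open>\<bar>K\<^sub>H(t, y)\<bar>\<close> plus the Hoelder term, \<open>w r y\<close> for a bound of the density of
  \<open>\<bar>K\<^sub>H(dr, y)\<bar>\<close>. The simplex constraints are dropped: the \<open>L\<^sup>2\<close> bound survives without them.\<close>

fun Kmaj :: "(real \<Rightarrow> real \<Rightarrow> ennreal) \<Rightarrow> (real \<Rightarrow> real \<Rightarrow> ennreal) \<Rightarrow>
    nat \<Rightarrow> real \<Rightarrow> real \<Rightarrow> (nat \<Rightarrow> real) \<Rightarrow> ennreal" where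
  "Kmaj \<kappa> w 0 s t \<theta> = 0"
| "Kmaj \<kappa> w (Suc 0) s t \<theta> =
    (if s < \<theta> 1 \<and> \<theta> 1 < t then \<kappa> t (\<theta> 1)
     else if 0 < \<theta> 1 \<and> \<theta> 1 < s then \<integral>\<^sup>+r\<in>{s<..<t}. w r (\<theta> 1) \<partial>lborel else 0)"
| "Kmaj \<kappa> w (Suc (Suc m)) s t \<theta> = (let y = \<theta> (Suc (Suc m)); b = restrict \<theta> {1..Suc m} in
    if s < y \<and> y < t then
      \<kappa> t y * Kmaj \<kappa> w (Suc m) 0 y b + (\<integral>\<^sup>+r\<in>{y<..<t}. Kmaj \<kappa> w (Suc m) y r b * w r y \<partial>lborel)
    else if 0 < y \<and> y < s then \<integral>\<^sup>+r\<in>{s<..<t}. Kmaj \<kappa> w (Suc m) 0 r b * w r y \<partial>lborel else 0)"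

abbreviation vec_space :: "nat \<Rightarrow> (nat \<Rightarrow> real) measure" where
  "vec_space n \<equiv> PiM {1..n} (\<lambda>_. borel)"

lemma measurable_indicator_Ioo [measurable (raw)]:
  fixes a b f :: "'a \<Rightarrow> real"
  assumes [measurable]: "a \<in> borel_measurable M" "b \<in> borel_measurable M" "f \<in> borel_measurable M"
  shows "(\<lambda>x. indicator {a x<..<b x} (f x) :: ennreal) \<in> borel_measurable M"
  unfolding indicator_def greaterThanLessThan_iff by measurable

lemma measurable_compose2:
  assumes f: "(\<lambda>(x, y). f x y) \<in> measurable (A \<Otimes>\<^sub>M B) C"
    and [measurable]: "g \<in> measurable M A" "h \<in> measurable M B"
  shows "(\<lambda>x. f (g x) (h x)) \<in> measurable M C"
  using measurable_compose[OF measurable_Pair[OF assms(2,3)] f] by simp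

lemma measurable_compose3:
  assumes f: "(\<lambda>(x, y, z). f x y z) \<in> measurable (A \<Otimes>\<^sub>M B \<Otimes>\<^sub>M C) D"
    and [measurable]: "g \<in> measurable M A" "h \<in> measurable M B" "k \<in> measurable M C"
  shows "(\<lambda>x. f (g x) (h x) (k x)) \<in> measurable M D"
  using measurable_compose[OF measurable_Pair[OF assms(2) measurable_Pair[OF assms(3,4)]] f] by simp

lemma measurable_coordinate:
  "i \<in> {1..n} \<Longrightarrow> f \<in> measurable M (vec_space n) \<Longrightarrow> (\<lambda>x. f x i) \<in> borel_measurable M"
  by (rule measurable_compose[OF _ measurable_component_singleton])

lemma measurable_restrict_vec:
  "m \<le> n \<Longrightarrow> f \<in> measurable M (vec_space n) \<Longrightarrow> (\<lambda>x. restrict (f x) {1..m}) \<in> measurable M (vec_space m)"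
  by (rule measurable_compose[OF _ measurable_restrict_subset]) auto

text \<open>Measurability in the times and the vector jointly is what the induction can use: the
  recursion evaluates the shorter majorant at times \<open>y\<close> and \<open>r\<close>, of which
  one is a coordinate and the other an integration variable.\<close>

lemma Kmaj_measurable:
  assumes \<kappa>: "(\<lambda>(t, y). \<kappa> t y) \<in> borel_measurable (borel \<Otimes>\<^sub>M borel)"
    and w: "(\<lambda>(r, y). w r y) \<in> borel_measurable (borel \<Otimes>\<^sub>M borel)"
  shows "(\<lambda>(s, t, \<theta>). Kmaj \<kappa> w n s t \<theta>) \<in> borel_measurable (borel \<Otimes>\<^sub>M borel \<Otimes>\<^sub>M vec_space n)"
proof (induction n)
  case (Suc m)
  note [measurable (raw)] = measurable_compose2[OF \<kappa>] measurable_compose2[OF w]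
  show ?case
  proof (cases m)
    case 0
    note [measurable (raw)] = measurable_coordinate[of 1 "Suc 0", simplified]
    show ?thesis unfolding 0 Kmaj.simps One_nat_def by measurable
  next
    case (Suc k)
    note [measurable (raw)] = measurable_coordinate[of "Suc (Suc k)" "Suc (Suc k)", simplified]
      measurable_restrict_vec[of "Suc k" "Suc (Suc k)", simplified]
      measurable_compose3[OF Suc.IH[unfolded Suc]]
    show ?thesis unfolding Suc Kmaj.simps Let_def by measurable
  qed
qed simp

section \<open>Square integrability of the kernel bounds\<close>

definition deriv_majorant :: "real \<Rightarrow> real \<Rightarrow> real \<Rightarrow> real \<Rightarrow> ennreal" where
  "deriv_majorant M H r y = ennreal (M * (r - y) powr (H - 3/2))"

text \<open>The first two summands are those of \<open>KH_bound\<close>. The third is the integral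
  of \<open>(r - y) powr lam * (r - y) powr (H - 3/2)\<close> over \<open>]y,t[\<close>, the cost of
  the difference term for a function with Hoelder constant 1; it is finite because
  \<open>lam + H > 1/2\<close>.\<close>

definition kernel_majorant :: "real \<Rightarrow> real \<Rightarrow> real \<Rightarrow> real \<Rightarrow> real \<Rightarrow> ennreal" where
  "kernel_majorant M H lam t y = ennreal (M * ((t - y) powr (H - 1/2)
     + (t - y) powr (1/2 - H) * y powr (2 * H - 1)
     + (t - y) powr (lam + H - 1/2) / (lam + H - 1/2)))"

lemma deriv_majorant_measurable:
  "(\<lambda>(r, y). deriv_majorant M H r y) \<in> borel_measurable (borel \<Otimes>\<^sub>M borel)"
  unfolding deriv_majorant_def by measurable

lemma kernel_majorant_measurable:
  "(\<lambda>(t, y). kernel_majorant M H lam t y) \<in> borel_measurable (borel \<Otimes>\<^sub>M borel)"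
  unfolding kernel_majorant_def by measurable

text \<open>The first and third summands are multiples of \<open>p = (t - y) powr (H - 1/2)\<close>
  with total coefficient at most \<open>D\<close>, since \<open>(t - y) powr lam\<close> is at most
  \<open>T powr lam\<close>. The second is bounded by \<open>q\<close>. Both squares are then pure
  powers whose integrals scale like \<open>(t - s) powr (2 * H)\<close>.\<close>

lemma kernel_majorant_L2:
  assumes "0 \<le> M" "1/4 < H" "H < 1/2" "0 < lam" "1/2 < lam + H" "0 \<le> s" "s < t" "t \<le> T"
  defines "D \<equiv> 1 + T powr lam / (lam + H - 1/2)"
  shows "(\<integral>\<^sup>+y\<in>{s<..<t}. (kernel_majorant M H lam t y)\<^sup>2 \<partial>lborel)
    \<le> ennreal ((M\<^sup>2 * D\<^sup>2 / H + 2 * M\<^sup>2 / (4 * H - 1)) * (t - s) powr (2 * H))"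
proof -
  let ?A = "2 * M\<^sup>2 * D\<^sup>2" and ?B = "2 * M\<^sup>2 * (t - s) powr (1 - 2 * H)"
  have D: "0 \<le> D" using assms by (simp add: D_def)
  have pt: "(kernel_majorant M H lam t y)\<^sup>2
      \<le> ennreal ?A * ennreal ((t - y) powr (2 * H - 1)) + ennreal ?B * ennreal ((y - s) powr (4 * H - 2))"
    if y: "s < y" "y < t" for y
  proof -
    define p q where "p = (t - y) powr (H - 1/2)"
      and "q = (t - s) powr (1/2 - H) * (y - s) powr (2 * H - 1)"
    have "(t - y) powr (lam + H - 1/2) = (t - y) powr lam * p"
      unfolding p_def powr_add[symmetric] by (simp add: algebra_simps)
    also have "\<dots> \<le> T powr lam * p"
      using assms y by (intro mult_right_mono powr_mono2) (auto simp: p_def)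
    finally have 1: "(t - y) powr (lam + H - 1/2) / (lam + H - 1/2) \<le> T powr lam / (lam + H - 1/2) * p"
      using assms by (simp add: divide_right_mono)
    \<comment> \<open>As \<open>2 * H - 1 < 0\<close> and \<open>y - s \<le> y\<close>, the
      singularity may be moved from 0 to \<open>s\<close>. This loses nothing when
      \<open>s = 0\<close> and makes the integral over \<open>]s,t[\<close> a pure power of
      \<open>t - s\<close>; its convergence uses \<open>4 * H - 2 > -1\<close>.\<close>
    have 2: "(t - y) powr (1/2 - H) * y powr (2 * H - 1) \<le> q"
      unfolding q_def using assms y by (intro mult_mono powr_mono2 powr_mono2') auto
    let ?k = "(t - y) powr (H - 1/2) + (t - y) powr (1/2 - H) * y powr (2 * H - 1)
       + (t - y) powr (lam + H - 1/2) / (lam + H - 1/2)"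
    have k0: "0 \<le> ?k" using assms by simp
    have "?k \<le> D * p + q" using 1 2 by (simp add: D_def p_def[symmetric] algebra_simps)
    then have "(M * ?k)\<^sup>2 \<le> (M * (D * p + q))\<^sup>2"
      using k0 assms by (intro power_mono mult_left_mono) auto
    also have "\<dots> = M\<^sup>2 * (D * p + q)\<^sup>2" by (simp add: power_mult_distrib)
    also have "\<dots> \<le> M\<^sup>2 * (2 * (D * p)\<^sup>2 + 2 * q\<^sup>2)"
      using sum_squares_bound[of "D * p" q] by (intro mult_left_mono) (auto simp: power2_sum)
    also have "\<dots> = ?A * p\<^sup>2 + 2 * M\<^sup>2 * q\<^sup>2" by (simp add: algebra_simps power_mult_distrib)
    also have "p\<^sup>2 = (t - y) powr (2 * H - 1)"
      unfolding p_def power2_eq_square powr_add[symmetric] by simp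
    also have "q\<^sup>2 = (t - s) powr (1 - 2 * H) * (y - s) powr (4 * H - 2)"
      unfolding q_def power_mult_distrib unfolding power2_eq_square powr_add[symmetric] by simp
    finally have "(M * ?k)\<^sup>2 \<le> ?A * (t - y) powr (2 * H - 1) + ?B * (y - s) powr (4 * H - 2)"
      by (simp add: mult.assoc)
    then show ?thesis
      unfolding kernel_majorant_def using assms k0 
      by (subst ennreal_power) (auto simp flip: ennreal_mult ennreal_plus intro!: ennreal_leI)
  qed
  have "(\<integral>\<^sup>+y\<in>{s<..<t}. (kernel_majorant M H lam t y)\<^sup>2 \<partial>lborel)
     \<le> (\<integral>\<^sup>+y. ennreal ?A * (ennreal ((t - y) powr (2 * H - 1)) * indicator {s<..<t} y)
        + ennreal ?B * (ennreal ((y - s) powr (4 * H - 2)) * indicator {s<..<t} y) \<partial>lborel)"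
    using pt by (intro nn_integral_mono) (auto split: split_indicator)
  also have "\<dots> = ennreal ?A * (\<integral>\<^sup>+y\<in>{s<..<t}. ennreal ((t - y) powr (2 * H - 1)) \<partial>lborel)
     + ennreal ?B * (\<integral>\<^sup>+y\<in>{s<..<t}. ennreal ((y - s) powr (4 * H - 2)) \<partial>lborel)"
    by (subst nn_integral_add) (auto simp: nn_integral_cmult)
  also have "\<dots> = ennreal ?A * ennreal ((t - s) powr (2 * H) / (2 * H))
     + ennreal ?B * ennreal ((t - s) powr (4 * H - 1) / (4 * H - 1))"
    using assms nn_integral_powr_right[of s t "2 * H - 1"] nn_integral_powr_left[of s t "4 * H - 2"] by simp
  also have "\<dots> = ennreal (?A * ((t - s) powr (2 * H) / (2 * H)) + ?B * ((t - s) powr (4 * H - 1) / (4 * H - 1)))"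
    using assms by (simp flip: ennreal_mult ennreal_plus)
  also have "?B * ((t - s) powr (4 * H - 1) / (4 * H - 1)) = 2 * M\<^sup>2 / (4 * H - 1) * (t - s) powr (2 * H)"
    using powr_add[of "t - s" "1 - 2 * H" "4 * H - 1"] by simp
  finally show ?thesis by (simp add: algebra_simps)
qed

text \<open>Integrating in \<open>r\<close> before taking the norm in \<open>y\<close> is bounded
  the other way round: for fixed \<open>r\<close> the square of the density integrates over
  \<open>]0,s[\<close> to at most a multiple of \<open>(r - s) powr (2 * H - 2)\<close>, and the
  root of this is integrable up to \<open>r = s\<close>.\<close>

lemma deriv_majorant_L2:
  assumes "0 \<le> M" "0 < H" "H < 1" "0 \<le> s" "s < t"
  shows "(\<integral>\<^sup>+y\<in>{0<..<s}. (\<integral>\<^sup>+r\<in>{s<..<t}. deriv_majorant M H r y \<partial>lborel)\<^sup>2 \<partial>lborel)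
    \<le> ennreal (M\<^sup>2 / (2 - 2 * H) / H\<^sup>2 * (t - s) powr (2 * H))"
proof -
  note [measurable (raw)] = measurable_compose2[OF deriv_majorant_measurable]
  have "(\<integral>\<^sup>+y. (\<integral>\<^sup>+r\<in>{s<..<t}. deriv_majorant M H r y * indicator {0<..<s} y \<partial>lborel)\<^sup>2 \<partial>lborel)
     \<le> ennreal (M\<^sup>2 / (2 - 2 * H)) * (\<integral>\<^sup>+r\<in>{s<..<t}. ennreal ((r - s) powr (H - 1)) \<partial>lborel)\<^sup>2"
  proof (rule nn_integral_Minkowski)
    fix r assume r: "r \<in> {s<..<t}"
    have "(\<integral>\<^sup>+y. (deriv_majorant M H r y * indicator {0<..<s} y)\<^sup>2 \<partial>lborel)
      = (\<integral>\<^sup>+y. ennreal (M\<^sup>2) * (ennreal ((r - y) powr (2 * H - 3)) * indicator {0<..<s} y) \<partial>lborel)"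
    proof (intro nn_integral_cong)
      fix y
      have "((r - y) powr (H - 3/2))\<^sup>2 = (r - y) powr (2 * H - 3)"
        unfolding power2_eq_square powr_add[symmetric] by simp
      then show "(deriv_majorant M H r y * indicator {0<..<s} y)\<^sup>2
          = ennreal (M\<^sup>2) * (ennreal ((r - y) powr (2 * H - 3)) * indicator {0<..<s} y)"
        using assms unfolding deriv_majorant_def
        by (auto split: split_indicator simp: ennreal_power power_mult_distrib simp flip: ennreal_mult)
    qed
    also have "\<dots> = ennreal (M\<^sup>2) * (\<integral>\<^sup>+y\<in>{0<..<s}. ennreal ((r - y) powr (2 * H - 3)) \<partial>lborel)"
      by (intro nn_integral_cmult) simp
    also have "\<dots> \<le> ennreal (M\<^sup>2) * ennreal ((r - s) powr (2 * H - 3 + 1) / - (2 * H - 3 + 1))"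
      using assms r by (intro mult_left_mono nn_integral_powr_outside) auto
    also have "\<dots> = ennreal (M\<^sup>2 / (2 - 2 * H) * (r - s) powr (2 * H - 2))"
      using assms by (simp flip: ennreal_mult)
    also have "(r - s) powr (2 * H - 2) = ((r - s) powr (H - 1))\<^sup>2"
      unfolding power2_eq_square powr_add[symmetric] by simp
    finally show "(\<integral>\<^sup>+y. (deriv_majorant M H r y * indicator {0<..<s} y)\<^sup>2 \<partial>lborel)
       \<le> ennreal (M\<^sup>2 / (2 - 2 * H)) * (ennreal ((r - s) powr (H - 1)))\<^sup>2"
      using assms by (simp add: ennreal_power flip: ennreal_mult)
  qed (use sigma_finite_lborel in auto)
  also have "(\<integral>\<^sup>+r\<in>{s<..<t}. ennreal ((r - s) powr (H - 1)) \<partial>lborel) = ennreal ((t - s) powr H / H)"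
    using nn_integral_powr_left[of s t "H - 1"] assms by simp
  also have "ennreal (M\<^sup>2 / (2 - 2 * H)) * (ennreal ((t - s) powr H / H))\<^sup>2
      = ennreal (M\<^sup>2 / (2 - 2 * H) / H\<^sup>2 * (t - s) powr (2 * H))"
  proof -
    have "((t - s) powr H)\<^sup>2 = (t - s) powr (2 * H)"
      unfolding power2_eq_square powr_add[symmetric] by simp
    then show ?thesis
      using assms by (simp add: ennreal_power power_divide flip: ennreal_mult)
  qed
  also have "(\<integral>\<^sup>+y. (\<integral>\<^sup>+r\<in>{s<..<t}. deriv_majorant M H r y * indicator {0<..<s} y \<partial>lborel)\<^sup>2 \<partial>lborel)
     = (\<integral>\<^sup>+y\<in>{0<..<s}. (\<integral>\<^sup>+r\<in>{s<..<t}. deriv_majorant M H r y \<partial>lborel)\<^sup>2 \<partial>lborel)"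
    by (intro nn_integral_cong) (auto split: split_indicator)
  finally show ?thesis .
qed

section \<open>Integration over the cube\<close>

text \<open>Measurability is established once, over products of the full Borel line and so
  independently of the side of the cube. This carries it over to the restricted Lebesgue factors of
  \<open>cube_measure\<close>.\<close>

lemma measurable_cube_vec: "f \<in> measurable M (cube_measure n t) \<Longrightarrow> f \<in> measurable M (vec_space n)"
proof (erule measurable_compose)
  show "(\<lambda>x. x) \<in> measurable (cube_measure n t) (vec_space n)"
    unfolding cube_measure_def
  proof (intro measurable_PiM_single')
    fix i assume i: "i \<in> {1..n}"
    have "(\<lambda>x. x i) \<in> measurable (PiM {1..n} (\<lambda>_. restrict_space lborel {0..t})) (restrict_space lborel {0..t})"
      using i by (rule measurable_component_singleton)
    then show "(\<lambda>x. x i) \<in> borel_measurable (PiM {1..n} (\<lambda>_. restrict_space lborel {0..t}))"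
      by (simp add: measurable_restrict_space2_iff)
  qed (auto simp: space_PiM PiE_def)
qed

interpretation interval_product: product_sigma_finite "\<lambda>_. restrict_space lborel {0..t0::real}" for t0
  by (intro product_sigma_finite.intro sigma_finite_measure_restrict_space sigma_finite_lborel) auto

lemma sigma_finite_cube_measure: "sigma_finite_measure (cube_measure n t)"
  unfolding cube_measure_def by (intro interval_product.sigma_finite) simp

text \<open>Tonelli with the last coordinate outermost. That coordinate is released to the whole
  line, which can only increase the integral, so that the one-dimensional bounds over
  \<open>lborel\<close> apply.\<close>

lemma nn_integral_cube_Suc_le:
  assumes [measurable]: "f \<in> borel_measurable (vec_space (Suc n))"
  shows "(\<integral>\<^sup>+\<theta>. f \<theta> \<partial>cube_measure (Suc n) t)
    \<le> (\<integral>\<^sup>+y. \<integral>\<^sup>+x. f (x(Suc n := y)) \<partial>cube_measure n t \<partial>lborel)"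
proof -
  let ?R = "restrict_space lborel {0..t}"
  have ins: "{1..Suc n} = insert (Suc n) {1..n}" by auto
  have "f \<in> borel_measurable (cube_measure (Suc n) t)"
    using measurable_compose[OF measurable_cube_vec[OF measurable_ident_sets[OF refl]] assms] by simp
  then have "(\<integral>\<^sup>+\<theta>. f \<theta> \<partial>cube_measure (Suc n) t)
    = (\<integral>\<^sup>+y. \<integral>\<^sup>+x. f (x(Suc n := y)) \<partial>cube_measure n t \<partial>?R)"
    unfolding cube_measure_def ins by (intro interval_product.product_nn_integral_insert_rev) auto
  also have "\<dots> \<le> (\<integral>\<^sup>+y. \<integral>\<^sup>+x. f (x(Suc n := y)) \<partial>cube_measure n t \<partial>lborel)"
    by (auto simp: nn_integral_restrict_space intro!: nn_integral_mono split: split_indicator)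
  finally show ?thesis .
qed

text \<open>The side \<open>t0\<close> of the cube is independent of the end time \<open>t\<close>:
  when the last coordinate is integrated out, the remaining cube keeps its side, while the
  hypothesis is applied with times \<open>(0, y)\<close>, \<open>(y, r)\<close> and
  \<open>(0, r)\<close>.\<close>

lemma Kmaj_L2:
  fixes H lam M T :: real
  assumes "0 < M" "1/4 < H" "H < 1/2" "0 < lam" "1/2 < lam + H" "1 \<le> n"
  defines "\<kappa> \<equiv> kernel_majorant M H lam" and "w \<equiv> deriv_majorant M H"
  shows "\<exists>C\<ge>0. \<forall>t0 s t. 0 \<le> s \<longrightarrow> s < t \<longrightarrow> t \<le> T \<longrightarrow>
    (\<integral>\<^sup>+\<theta>. (Kmaj \<kappa> w n s t \<theta>)\<^sup>2 \<partial>cube_measure n t0) \<le> ennreal (C * (t - s) powr (2 * H))"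
  using \<open>1 \<le> n\<close>
proof (induction n rule: nat_induct_at_least)
  \<comment> \<open>\<open>D1\<close> is the constant for the kernel bound on \<open>]s,t[\<close>,
    \<open>D2\<close> the one for the integrated density on \<open>]0,s[\<close>.\<close>
  define D1 where "D1 = M\<^sup>2 * (1 + T powr lam / (lam + H - 1/2))\<^sup>2 / H + 2 * M\<^sup>2 / (4 * H - 1)"
  define D2 where "D2 = M\<^sup>2 / (2 - 2 * H) / H\<^sup>2"
  have D: "0 \<le> D1" "0 \<le> D2" using assms by (auto simp: D1_def D2_def)
  let ?W = "\<lambda>s t y. \<integral>\<^sup>+r\<in>{s<..<t}. w r y \<partial>lborel"
  note [measurable (raw)] = measurable_compose2[OF deriv_majorant_measurable[of M H], folded w_def]
    measurable_compose2[OF kernel_majorant_measurable[of M H lam], folded \<kappa>_def]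
  have [measurable]: "\<kappa> t \<in> borel_measurable borel" for t
    unfolding \<kappa>_def kernel_majorant_def[abs_def] by measurable
  have [measurable]: "(indicator {a<..<b} :: real \<Rightarrow> ennreal) \<in> borel_measurable borel" for a b
    by (rule borel_measurable_indicator) simp
  have k2: "(\<integral>\<^sup>+y\<in>{s<..<t}. (\<kappa> t y)\<^sup>2 \<partial>lborel) \<le> ennreal (D1 * (t - s) powr (2 * H))"
    and w2: "(\<integral>\<^sup>+y\<in>{0<..<s}. (?W s t y)\<^sup>2 \<partial>lborel) \<le> ennreal (D2 * (t - s) powr (2 * H))"
    if "0 \<le> s" "s < t" "t \<le> T" for s t
    unfolding \<kappa>_def w_def D1_def D2_def
    by (intro kernel_majorant_L2 deriv_majorant_L2; use that assms in simp)+
  {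
    case base
    show ?case unfolding One_nat_def
    proof (intro exI[of _ "D1 + D2"] conjI allI impI)
      fix t0 s t :: real assume st: "0 \<le> s" "s < t" "t \<le> T"
      have [measurable]: "Kmaj \<kappa> w (Suc 0) s t \<in> borel_measurable (vec_space (Suc 0))"
        unfolding \<kappa>_def w_def
        by (rule measurable_compose3[OF Kmaj_measurable[OF kernel_majorant_measurable deriv_majorant_measurable]]) auto
      have "(\<integral>\<^sup>+\<theta>. (Kmaj \<kappa> w (Suc 0) s t \<theta>)\<^sup>2 \<partial>cube_measure (Suc 0) t0)
        \<le> (\<integral>\<^sup>+y. \<integral>\<^sup>+x. (Kmaj \<kappa> w (Suc 0) s t (x(Suc 0 := y)))\<^sup>2 \<partial>cube_measure 0 t0 \<partial>lborel)"
        by (intro nn_integral_cube_Suc_le[of "\<lambda>\<theta>. (Kmaj \<kappa> w (Suc 0) s t \<theta>)\<^sup>2"]) measurable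
      also have "\<dots> = (\<integral>\<^sup>+y. (\<kappa> t y)\<^sup>2 * indicator {s<..<t} y + (?W s t y)\<^sup>2 * indicator {0<..<s} y \<partial>lborel)"
        by (intro nn_integral_cong)
          (auto simp: cube_measure_def PiM_empty nn_integral_count_space_finite split: split_indicator)
      also have "\<dots> = (\<integral>\<^sup>+y\<in>{s<..<t}. (\<kappa> t y)\<^sup>2 \<partial>lborel) + (\<integral>\<^sup>+y\<in>{0<..<s}. (?W s t y)\<^sup>2 \<partial>lborel)"
        by (intro nn_integral_add) measurable
      also have "\<dots> \<le> ennreal (D1 * (t - s) powr (2 * H)) + ennreal (D2 * (t - s) powr (2 * H))"
        by (intro add_mono k2 w2 st)
      finally show "(\<integral>\<^sup>+\<theta>. (Kmaj \<kappa> w (Suc 0) s t \<theta>)\<^sup>2 \<partial>cube_measure (Suc 0) t0) \<le> ennreal ((D1 + D2) * (t - s) powr (2 * H))"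
        using D by (simp add: distrib_right flip: ennreal_plus)
    qed (use D in simp)
  next
    case (Suc n)
    then obtain k where k: "n = Suc k" by (cases n) auto
    from Suc.IH obtain C where C: "0 \<le> C"
      "\<And>t0 s t. 0 \<le> s \<Longrightarrow> s < t \<Longrightarrow> t \<le> T \<Longrightarrow>
        (\<integral>\<^sup>+\<theta>. (Kmaj \<kappa> w n s t \<theta>)\<^sup>2 \<partial>cube_measure n t0) \<le> ennreal (C * (t - s) powr (2 * H))" by blast
    \<comment> \<open>\<open>D3\<close> belongs to the term whose inner operator runs from
      \<open>y\<close> to \<open>r\<close>. It yields \<open>(t - s) powr (4 * H)\<close>, twice the
      exponent asked for, and the surplus is absorbed into \<open>T powr (2 * H)\<close>.\<close>
    define D3 where "D3 = M\<^sup>2 / (2 * H - 1/2)\<^sup>2 / (4 * H) * T powr (2 * H)"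
    have D3: "0 \<le> D3" using assms by (simp add: D3_def)
    \<comment> \<open>One summand for each product in the recursion. The factors 2 come from
      squaring a sum of two terms; the case \<open>y < s\<close> consists of one term and has
      none.\<close>
    define E where "E = 2 * C * T powr (2 * H) * D1 + 2 * C * D3 + C * T powr (2 * H) * D2"
    show ?case
    proof (intro exI[of _ E] conjI allI impI)
      show "0 \<le> E" using C D D3 by (simp add: E_def)
      fix t0 s t :: real assume st: "0 \<le> s" "s < t" "t \<le> T"
      interpret cm: sigma_finite_measure "cube_measure n t0" by (rule sigma_finite_cube_measure)
      note Kmm = measurable_compose3[OF Kmaj_measurable[OF kernel_majorant_measurable[of M H lam] deriv_majorant_measurable[of M H]],
          folded \<kappa>_def w_def]
      have [measurable]: "Kmaj \<kappa> w (Suc n) s t \<in> borel_measurable (vec_space (Suc n))"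
        by (rule Kmm) auto
      have id: "(\<lambda>x. x) \<in> measurable (cube_measure n t0) (vec_space n)"
        by (rule measurable_cube_vec[where t = t0]) simp
      have [measurable]: "(\<lambda>x. Kmaj \<kappa> w n a b x) \<in> borel_measurable (cube_measure n t0)" for a b
        by (rule Kmm[OF _ _ id]) simp_all
      have [measurable]: "(\<lambda>(x, r). Kmaj \<kappa> w n a r x) \<in> borel_measurable (cube_measure n t0 \<Otimes>\<^sub>M lborel)" for a
        unfolding case_prod_beta
        by (rule Kmm[OF _ _ measurable_compose[OF measurable_fst id]]) simp_all
      have KW: "(\<lambda>(x, r). Kmaj \<kappa> w n a r x * w r y) \<in> borel_measurable (cube_measure n t0 \<Otimes>\<^sub>M lborel)" for a y
        by measurable
      let ?V = "\<lambda>y. ennreal (M * (t - y) powr (2 * H - 1/2) / (2 * H - 1/2))"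
      have pow2: "((x::real) powr q)\<^sup>2 = x powr (2 * q)" for x q
        unfolding power2_eq_square powr_add[symmetric] by simp
      have rec: "Kmaj \<kappa> w (Suc n) s t (x(Suc n := y)) =
          (if s < y \<and> y < t then
            \<kappa> t y * Kmaj \<kappa> w n 0 y x + (\<integral>\<^sup>+r\<in>{y<..<t}. Kmaj \<kappa> w n y r x * w r y \<partial>lborel)
           else if 0 < y \<and> y < s then \<integral>\<^sup>+r\<in>{s<..<t}. Kmaj \<kappa> w n 0 r x * w r y \<partial>lborel else 0)"
        if "x \<in> space (cube_measure n t0)" for x y
      proof -
        have "restrict (x(Suc n := y)) {1..n} = x"
          using that by (auto simp: cube_measure_def space_PiM PiE_def extensional_def restrict_def)
        then show ?thesis by (simp add: k Let_def)
      qed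
      \<comment> \<open>For inner start time 0 the interval need not be short, so the rate
        degenerates to the constant \<open>T powr (2 * H)\<close>.\<close>
      have up: "(\<integral>\<^sup>+x. (Kmaj \<kappa> w n 0 r x)\<^sup>2 \<partial>cube_measure n t0) \<le> ennreal (C * T powr (2 * H))"
        if "0 < r" "r \<le> T" for r
      proof -
        have "C * (r - 0) powr (2 * H) \<le> C * T powr (2 * H)"
          using that assms C(1) by (intro mult_left_mono powr_mono2) auto
        with C(2)[of 0 r t0] that show ?thesis by (auto intro: order_trans ennreal_leI)
      qed
      have near: "(\<integral>\<^sup>+x. (Kmaj \<kappa> w (Suc n) s t (x(Suc n := y)))\<^sup>2 \<partial>cube_measure n t0)
          \<le> ennreal (2 * C * T powr (2 * H)) * (\<kappa> t y)\<^sup>2 + ennreal (2 * C) * (?V y)\<^sup>2"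
        if y: "s < y" "y < t" for y
      proof -
        have "(\<integral>\<^sup>+x. (Kmaj \<kappa> w (Suc n) s t (x(Suc n := y)))\<^sup>2 \<partial>cube_measure n t0)
          \<le> (\<integral>\<^sup>+x. 2 * (\<kappa> t y)\<^sup>2 * (Kmaj \<kappa> w n 0 y x)\<^sup>2
              + 2 * (\<integral>\<^sup>+r\<in>{y<..<t}. Kmaj \<kappa> w n y r x * w r y \<partial>lborel)\<^sup>2 \<partial>cube_measure n t0)"
        proof (intro nn_integral_mono)
          fix x assume "x \<in> space (cube_measure n t0)"
          from rec[OF this, of y] y
          show "(Kmaj \<kappa> w (Suc n) s t (x(Suc n := y)))\<^sup>2 \<le> 2 * (\<kappa> t y)\<^sup>2 * (Kmaj \<kappa> w n 0 y x)\<^sup>2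
              + 2 * (\<integral>\<^sup>+r\<in>{y<..<t}. Kmaj \<kappa> w n y r x * w r y \<partial>lborel)\<^sup>2"
            using ennreal_sum_square_le[of "\<kappa> t y * Kmaj \<kappa> w n 0 y x"]
            by (simp add: power_mult_distrib mult.assoc)
        qed
        also have "\<dots> = 2 * (\<kappa> t y)\<^sup>2 * (\<integral>\<^sup>+x. (Kmaj \<kappa> w n 0 y x)\<^sup>2 \<partial>cube_measure n t0)
            + 2 * (\<integral>\<^sup>+x. (\<integral>\<^sup>+r\<in>{y<..<t}. Kmaj \<kappa> w n y r x * w r y \<partial>lborel)\<^sup>2 \<partial>cube_measure n t0)"
          by (subst nn_integral_add) (auto simp: nn_integral_cmult)
        also have "\<dots> \<le> 2 * (\<kappa> t y)\<^sup>2 * ennreal (C * T powr (2 * H))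
            + 2 * (ennreal C * (\<integral>\<^sup>+r\<in>{y<..<t}. ennreal (M * (r - y) powr (2 * H - 3/2)) \<partial>lborel)\<^sup>2)"
        \<comment> \<open>The inner norm is at most \<open>sqrt C * (r - y) powr H\<close> by
          induction; multiplied by the density this gives
          \<open>b r = M * (r - y) powr (2 * H - 3/2)\<close>, whose exponent exceeds
          \<open>-1\<close> since \<open>H > 1/4\<close>.\<close>
        proof (intro add_mono mult_left_mono up nn_integral_Minkowski)
          fix r assume r: "r \<in> {y<..<t}"
          have "(\<integral>\<^sup>+x. (Kmaj \<kappa> w n y r x * w r y)\<^sup>2 \<partial>cube_measure n t0)
              = (\<integral>\<^sup>+x. (Kmaj \<kappa> w n y r x)\<^sup>2 \<partial>cube_measure n t0) * (w r y)\<^sup>2"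
            by (simp add: power_mult_distrib nn_integral_multc)
          also have "\<dots> \<le> ennreal (C * (r - y) powr (2 * H)) * (w r y)\<^sup>2"
            using C(2)[of y r t0] r st y by (intro mult_right_mono) auto
          also have "\<dots> = ennreal (C * (r - y) powr (2 * H) * (M * (r - y) powr (H - 3/2))\<^sup>2)"
            using C assms by (simp add: w_def deriv_majorant_def ennreal_power flip: ennreal_mult)
          also have "C * (r - y) powr (2 * H) * (M * (r - y) powr (H - 3/2))\<^sup>2
              = C * (M * (r - y) powr (2 * H - 3/2))\<^sup>2"
            using powr_add[of "r - y" "2 * H" "2 * (H - 3/2)"] by (simp add: power_mult_distrib pow2 algebra_simps)
          finally show "(\<integral>\<^sup>+x. (Kmaj \<kappa> w n y r x * w r y)\<^sup>2 \<partial>cube_measure n t0)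
              \<le> ennreal C * (ennreal (M * (r - y) powr (2 * H - 3/2)))\<^sup>2"
            using C assms by (simp add: ennreal_power flip: ennreal_mult)
        qed (use y st assms(1-6) KW sigma_finite_lborel cm.sigma_finite_measure_axioms in auto)
        also have "(\<integral>\<^sup>+r\<in>{y<..<t}. ennreal (M * (r - y) powr (2 * H - 3/2)) \<partial>lborel)
            = (\<integral>\<^sup>+r. ennreal M * (ennreal ((r - y) powr (2 * H - 3/2)) * indicator {y<..<t} r) \<partial>lborel)"
          using assms by (intro nn_integral_cong) (auto simp: ennreal_mult mult.assoc)
        also have "\<dots> = ennreal M * ennreal ((t - y) powr (2 * H - 1/2) / (2 * H - 1/2))"
          using nn_integral_powr_left[of y t "2 * H - 3/2"] y assms by (subst nn_integral_cmult) auto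
        also have "\<dots> = ?V y" using assms by (simp flip: ennreal_mult)
        also have "2 * (\<kappa> t y)\<^sup>2 * ennreal (C * T powr (2 * H)) = ennreal (2 * C * T powr (2 * H)) * (\<kappa> t y)\<^sup>2"
          using C by (simp add: ennreal_mult mult_ac)
        also have "2 * (ennreal C * (?V y)\<^sup>2) = ennreal (2 * C) * (?V y)\<^sup>2"
          using C by (simp add: ennreal_mult mult_ac)
        finally show ?thesis .
      qed
      \<comment> \<open>The inner operator starts at 0 and contributes no rate; the power of
        \<open>t - s\<close> comes from the integrated density alone, through
        \<open>w2\<close>.\<close>
      have far: "(\<integral>\<^sup>+x. (Kmaj \<kappa> w (Suc n) s t (x(Suc n := y)))\<^sup>2 \<partial>cube_measure n t0)
          \<le> ennreal (C * T powr (2 * H)) * (?W s t y)\<^sup>2"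
        if y: "0 < y" "y < s" for y
      proof -
        have "(\<integral>\<^sup>+x. (Kmaj \<kappa> w (Suc n) s t (x(Suc n := y)))\<^sup>2 \<partial>cube_measure n t0)
          = (\<integral>\<^sup>+x. (\<integral>\<^sup>+r\<in>{s<..<t}. Kmaj \<kappa> w n 0 r x * w r y \<partial>lborel)\<^sup>2 \<partial>cube_measure n t0)"
          using y by (intro nn_integral_cong) (simp add: rec)
        also have "\<dots> \<le> ennreal (C * T powr (2 * H))
            * (\<integral>\<^sup>+r\<in>{s<..<t}. ennreal (M * (r - y) powr (H - 3/2)) \<partial>lborel)\<^sup>2"
        proof (intro nn_integral_Minkowski)
          fix r assume r: "r \<in> {s<..<t}"
          have "(\<integral>\<^sup>+x. (Kmaj \<kappa> w n 0 r x * w r y)\<^sup>2 \<partial>cube_measure n t0)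
              = (\<integral>\<^sup>+x. (Kmaj \<kappa> w n 0 r x)\<^sup>2 \<partial>cube_measure n t0) * (w r y)\<^sup>2"
            by (simp add: power_mult_distrib nn_integral_multc)
          also have "\<dots> \<le> ennreal (C * T powr (2 * H)) * (w r y)\<^sup>2"
            using r st by (intro mult_right_mono up) auto
          finally show "(\<integral>\<^sup>+x. (Kmaj \<kappa> w n 0 r x * w r y)\<^sup>2 \<partial>cube_measure n t0)
            \<le> ennreal (C * T powr (2 * H)) * (ennreal (M * (r - y) powr (H - 3/2)))\<^sup>2"
            by (simp add: w_def deriv_majorant_def)
        qed (use y st assms(1-6) KW sigma_finite_lborel cm.sigma_finite_measure_axioms in auto)
        finally show ?thesis by (simp add: w_def deriv_majorant_def)
      qed
      have zero: "(\<integral>\<^sup>+x. (Kmaj \<kappa> w (Suc n) s t (x(Suc n := y)))\<^sup>2 \<partial>cube_measure n t0) = 0"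
        if y: "\<not> (s < y \<and> y < t)" "\<not> (0 < y \<and> y < s)" for y
      proof -
        have "(\<integral>\<^sup>+x. (Kmaj \<kappa> w (Suc n) s t (x(Suc n := y)))\<^sup>2 \<partial>cube_measure n t0)
            = (\<integral>\<^sup>+x. 0 \<partial>cube_measure n t0)"
          using y by (intro nn_integral_cong) (simp only: rec if_False power2_eq_square mult_zero_left)
        then show ?thesis by simp
      qed
      have V2: "(\<integral>\<^sup>+y\<in>{s<..<t}. (?V y)\<^sup>2 \<partial>lborel) \<le> ennreal (D3 * (t - s) powr (2 * H))"
      proof -
        have "(\<integral>\<^sup>+y\<in>{s<..<t}. (?V y)\<^sup>2 \<partial>lborel)
          = (\<integral>\<^sup>+y. ennreal (M\<^sup>2 / (2 * H - 1/2)\<^sup>2) * (ennreal ((t - y) powr (4 * H - 1)) * indicator {s<..<t} y) \<partial>lborel)"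
          using assms by (intro nn_integral_cong)
            (auto split: split_indicator simp: ennreal_power power_divide power_mult_distrib pow2 simp flip: ennreal_mult)
        also have "\<dots> = ennreal (M\<^sup>2 / (2 * H - 1/2)\<^sup>2) * ennreal ((t - s) powr (4 * H) / (4 * H))"
          using nn_integral_powr_right[of s t "4 * H - 1"] st assms by (subst nn_integral_cmult) auto
        also have "\<dots> = ennreal (M\<^sup>2 / (2 * H - 1/2)\<^sup>2 / (4 * H) * (t - s) powr (4 * H))"
          using assms by (simp flip: ennreal_mult)
        also have "(t - s) powr (4 * H) = (t - s) powr (2 * H) * (t - s) powr (2 * H)"
          by (simp flip: powr_add)
        also have "ennreal (M\<^sup>2 / (2 * H - 1/2)\<^sup>2 / (4 * H) * ((t - s) powr (2 * H) * (t - s) powr (2 * H)))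
            \<le> ennreal (M\<^sup>2 / (2 * H - 1/2)\<^sup>2 / (4 * H) * (T powr (2 * H) * (t - s) powr (2 * H)))"
          using assms(1-6) st by (intro ennreal_leI mult_left_mono mult_right_mono powr_mono2) auto
        finally show ?thesis by (simp add: D3_def mult.assoc)
      qed
      have "(\<integral>\<^sup>+\<theta>. (Kmaj \<kappa> w (Suc n) s t \<theta>)\<^sup>2 \<partial>cube_measure (Suc n) t0)
        \<le> (\<integral>\<^sup>+y. \<integral>\<^sup>+x. (Kmaj \<kappa> w (Suc n) s t (x(Suc n := y)))\<^sup>2 \<partial>cube_measure n t0 \<partial>lborel)"
        by (intro nn_integral_cube_Suc_le[of "\<lambda>\<theta>. (Kmaj \<kappa> w (Suc n) s t \<theta>)\<^sup>2"]) measurable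
      also have "\<dots> \<le> (\<integral>\<^sup>+y. (ennreal (2 * C * T powr (2 * H)) * ((\<kappa> t y)\<^sup>2 * indicator {s<..<t} y)
            + ennreal (2 * C) * ((?V y)\<^sup>2 * indicator {s<..<t} y))
          + ennreal (C * T powr (2 * H)) * ((?W s t y)\<^sup>2 * indicator {0<..<s} y) \<partial>lborel)"
      proof (intro nn_integral_mono)
        fix y
        consider "s < y \<and> y < t" | "0 < y \<and> y < s" | "\<not> (s < y \<and> y < t)" "\<not> (0 < y \<and> y < s)" by blast
        then show "(\<integral>\<^sup>+x. (Kmaj \<kappa> w (Suc n) s t (x(Suc n := y)))\<^sup>2 \<partial>cube_measure n t0)
          \<le> (ennreal (2 * C * T powr (2 * H)) * ((\<kappa> t y)\<^sup>2 * indicator {s<..<t} y)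
            + ennreal (2 * C) * ((?V y)\<^sup>2 * indicator {s<..<t} y))
          + ennreal (C * T powr (2 * H)) * ((?W s t y)\<^sup>2 * indicator {0<..<s} y)"
        proof cases
          case 1 then show ?thesis using near[of y] by simp
        next
          case 2 then show ?thesis using far[of y] by simp
        next
          case 3 then show ?thesis using zero[of y] by simp
        qed
      qed
      also have "\<dots> = ennreal (2 * C * T powr (2 * H)) * (\<integral>\<^sup>+y\<in>{s<..<t}. (\<kappa> t y)\<^sup>2 \<partial>lborel)
          + ennreal (2 * C) * (\<integral>\<^sup>+y\<in>{s<..<t}. (?V y)\<^sup>2 \<partial>lborel)
          + ennreal (C * T powr (2 * H)) * (\<integral>\<^sup>+y\<in>{0<..<s}. (?W s t y)\<^sup>2 \<partial>lborel)"
        by (simp add: nn_integral_add nn_integral_cmult)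
      also have "\<dots> \<le> ennreal (2 * C * T powr (2 * H)) * ennreal (D1 * (t - s) powr (2 * H))
          + ennreal (2 * C) * ennreal (D3 * (t - s) powr (2 * H))
          + ennreal (C * T powr (2 * H)) * ennreal (D2 * (t - s) powr (2 * H))"
        by (intro add_mono mult_left_mono k2 w2 V2 st) auto
      also have "\<dots> = ennreal (E * (t - s) powr (2 * H))"
        using C D D3 by (simp add: E_def algebra_simps flip: ennreal_mult ennreal_plus)
      finally show "(\<integral>\<^sup>+\<theta>. (Kmaj \<kappa> w (Suc n) s t \<theta>)\<^sup>2 \<partial>cube_measure (Suc n) t0)
        \<le> ennreal (E * (t - s) powr (2 * H))" .
    qed
  }
qed

section \<open>The operators with globally measurable kernels\<close>

text \<open>Unlike \<open>dKH\<close>, whose values off \<open>0 < y < r\<close> are uncontrolled derivatives, this density is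
  measurable everywhere.\<close>

definition deriv_density :: "real \<Rightarrow> real \<Rightarrow> real \<Rightarrow> real" where
  "deriv_density H r y =
    (if 0 < y \<and> y < r then cH H * (H - 1/2) * (y / r) powr (1/2 - H) * (r - y) powr (H - 3/2) else 0)"

text \<open>The kernels are parameters so that measurability, domination and linearity can be
  derived from abstract bounds on them. The indicators of \<open>Kstar\<close> become case
  distinctions; the one of the cube of side \<open>t\<close> is left out because the comparison with
  \<open>Kstar\<close> is made at points of that cube, where it equals 1.\<close>

fun Kop :: "(real \<Rightarrow> real \<Rightarrow> real) \<Rightarrow> (real \<Rightarrow> real \<Rightarrow> real) \<Rightarrow>
    nat \<Rightarrow> real \<Rightarrow> real \<Rightarrow> ((nat \<Rightarrow> real) \<Rightarrow> real) \<Rightarrow> (nat \<Rightarrow> real) \<Rightarrow> real" where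
  "Kop k d 0 s t h \<theta> = 0"
| "Kop k d (Suc 0) s t h \<theta> = (let y = \<theta> 1 in
    if s < y \<and> y < t then h \<theta> * k t y + (LINT r:{y<..<t}|lborel. (h (\<theta>(1 := r)) - h \<theta>) * d r y)
    else if 0 < y \<and> y < s then LINT r:{s<..<t}|lborel. h (\<theta>(1 := r)) * d r y else 0)"
| "Kop k d (Suc (Suc m)) s t h \<theta> =
    (let n = Suc (Suc m); y = \<theta> n; b = restrict \<theta> {1..Suc m} in
    if s < y \<and> y < t then
      (if \<forall>i\<in>{1..Suc m}. 0 \<le> \<theta> i \<and> \<theta> i \<le> y then
        Kop k d (Suc m) 0 y (\<lambda>x. h (x(n := y))) b * k t y
        + (LINT r:{y<..<t}|lborel. Kop k d (Suc m) 0 y (\<lambda>x. h (x(n := r)) - h (x(n := y))) b * d r y)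
       else 0)
      + (LINT r:{Max (\<theta> ` {1..n})<..<t}|lborel. Kop k d (Suc m) y r (\<lambda>x. h (x(n := r))) b * d r y)
    else if 0 < y \<and> y < s then
      LINT r:{max (Max (\<theta> ` {1..Suc m})) s<..<t}|lborel. Kop k d (Suc m) 0 r (\<lambda>x. h (x(n := r))) b * d r y
    else 0)"

lemma simplex_extend:
  assumes "x \<in> ordered_simplex n u" "u \<le> r" "0 \<le> r" "r \<le> t"
  shows "x(Suc n := r) \<in> ordered_simplex (Suc n) t"
proof -
  have x: "x \<in> {1..n} \<rightarrow>\<^sub>E {0..u}" "mono_on {1..n} x" using assms by (auto simp: ordered_simplex_def)
  have le: "0 \<le> x i" "x i \<le> u" if "i \<in> {1..n}" for i using PiE_mem[OF x(1) that] by auto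
  have "x(Suc n := r) \<in> {1..Suc n} \<rightarrow>\<^sub>E {0..t}"
    using x(1) le assms by (intro PiE_I) (force simp: le_Suc_eq PiE_iff extensional_def)+
  moreover have "mono_on {1..Suc n} (x(Suc n := r))"
  proof (rule mono_onI)
    fix i j assume ij: "i \<in> {1..Suc n}" "j \<in> {1..Suc n}" "i \<le> j"
    show "(x(Suc n := r)) i \<le> (x(Suc n := r)) j"
    proof (cases "j = Suc n")
      case True
      then show ?thesis using le[of i] ij assms by auto
    next
      case False
      then show ?thesis using mono_onD[OF x(2), of i j] ij by auto
    qed
  qed
  ultimately show ?thesis by (simp add: ordered_simplex_def)
qed

lemma simplex_one: "\<theta> \<in> {1..Suc 0} \<rightarrow>\<^sub>E {0..t} \<Longrightarrow> \<theta> \<in> ordered_simplex (Suc 0) t"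
  by (auto simp: ordered_simplex_def mono_on_def)

text \<open>The vector \<open>\<theta>\<close> ranges over the whole cube, yet \<open>h\<close> is
  read on the simplex only: each inner operator has an end time \<open>u \<le> r\<close>, so by
  induction it reads the slice at \<open>r\<close> on the simplex of side \<open>u\<close>, and
  appending \<open>r\<close> to such a vector keeps it ordered. Likewise the density contributes
  only at \<open>0 < y < r\<close>, where the derivative has its closed form.\<close>

lemma Kstar_eq_Kop:
  assumes H: "0 < H" "H < 1/2" and "0 \<le> s" "\<theta> \<in> {1..n} \<rightarrow>\<^sub>E {0..t}"
    and "\<And>x. x \<in> ordered_simplex n t \<Longrightarrow> h x = h' x"
  shows "Kstar H n s t h \<theta> = Kop (KH H) (deriv_density H) n s t h' \<theta>"
  using assms(3-)
proof (induction n arbitrary: s t h h' \<theta>)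
  case 0
  then show ?case by simp
next
  case (Suc m)
  note hh = Suc.prems(3)
  have d: "dKH H r y = deriv_density H r y" if "0 < y" "y < r" for r y
    using dKH_eq[OF H that] that by (simp add: deriv_density_def)
  show ?case
  proof (cases m)
    case 0
    have \<theta>: "\<theta> \<in> {1..Suc 0} \<rightarrow>\<^sub>E {0..t}" using Suc.prems 0 by simp
    then have "0 \<le> \<theta> 1" by (auto simp: PiE_iff)
    have h: "h \<theta> = h' \<theta>" using \<theta> 0 by (intro hh) (simp add: simplex_one)
    have hr: "h (\<theta>(1 := r)) = h' (\<theta>(1 := r))" if "0 < r" "r < t" for r
      using \<theta> 0 that by (intro hh) (auto intro!: simplex_one simp: PiE_iff extensional_def)
    have 1: "(LINT r:{\<theta> 1<..<t}|lborel. (h (\<theta>(1 := r)) - h \<theta>) * dKH H r (\<theta> 1))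
        = (LINT r:{\<theta> 1<..<t}|lborel. (h' (\<theta>(1 := r)) - h' \<theta>) * deriv_density H r (\<theta> 1))"
      if "0 < \<theta> 1"
      by (rule set_lebesgue_integral_cong) (use that h hr d in auto)
    have 2: "(LINT r:{s<..<t}|lborel. h (\<theta>(1 := r)) * dKH H r (\<theta> 1))
        = (LINT r:{s<..<t}|lborel. h' (\<theta>(1 := r)) * deriv_density H r (\<theta> 1))"
      if "0 < \<theta> 1" "\<theta> 1 < s"
      by (rule set_lebesgue_integral_cong) (use that hr d in auto)
    show ?thesis
      unfolding 0 Kstar.simps Kop.simps Let_def
      using Suc.prems(1) 1 2 h by (auto split: split_indicator)
  next
    case (Suc k)
    define N where "N = Suc (Suc k)"
    define y b where "y = \<theta> N" and "b = restrict \<theta> {1..Suc k}"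
    have \<theta>: "\<theta> \<in> {1..N} \<rightarrow>\<^sub>E {0..t}" using Suc.prems Suc by (simp add: N_def)
    have \<theta>i: "0 \<le> \<theta> i" "\<theta> i \<le> t" if "i \<in> {1..N}" for i using PiE_mem[OF \<theta> that] by auto
    have bt: "b \<in> {1..Suc k} \<rightarrow>\<^sub>E {0..t}"
      using \<theta>i by (auto simp: b_def N_def)
    have IH: "Kstar H (Suc k) s' t' g b = Kop (KH H) (deriv_density H) (Suc k) s' t' g' b"
      if "0 \<le> s'" "b \<in> {1..Suc k} \<rightarrow>\<^sub>E {0..t'}" "\<And>x. x \<in> ordered_simplex (Suc k) t' \<Longrightarrow> g x = g' x"
      for s' t' g g'
      using Suc.IH[of s' b t' g g'] that Suc by simp
    have hN: "h (x(N := r)) = h' (x(N := r))"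
      if "x \<in> ordered_simplex (Suc k) u" "u \<le> r" "0 \<le> r" "r \<le> t" for x u r
    proof (rule hh)
      show "x(N := r) \<in> ordered_simplex (Suc m) t"
        unfolding Suc N_def using that by (rule simplex_extend)
    qed
    have box: "b \<in> {1..Suc k} \<rightarrow>\<^sub>E {0..u} \<longleftrightarrow> (\<forall>i\<in>{1..Suc k}. 0 \<le> \<theta> i \<and> \<theta> i \<le> u)" for u
      by (auto simp: b_def PiE_iff)
    have bM: "b \<in> {1..Suc k} \<rightarrow>\<^sub>E {0..r}" if "Max (\<theta> ` {1..Suc k}) < r" for r
    proof -
      have "\<theta> i \<le> r" if "i \<in> {1..Suc k}" for i
      proof -
        have "\<theta> i \<le> Max (\<theta> ` {1..Suc k})" using that by (intro Max_ge) auto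
        with \<open>Max (\<theta> ` {1..Suc k}) < r\<close> show ?thesis by linarith
      qed
      then show ?thesis using \<theta>i by (auto simp: b_def N_def)
    qed
    have yM: "y \<le> Max (\<theta> ` {1..N})" and MM: "Max (\<theta> ` {1..Suc k}) \<le> Max (\<theta> ` {1..N})"
      by (auto simp: y_def N_def intro!: Max_ge Max_mono)
    have 1: "Kstar H (Suc k) 0 y (\<lambda>x. h (x(N := y))) b
        = Kop (KH H) (deriv_density H) (Suc k) 0 y (\<lambda>x. h' (x(N := y))) b"
      if "0 < y" "y < t" "b \<in> {1..Suc k} \<rightarrow>\<^sub>E {0..y}"
      using that by (intro IH hN[of _ y]) auto
    have 2: "(LINT r:{y<..<t}|lborel. Kstar H (Suc k) 0 y (\<lambda>x. h (x(N := r)) - h (x(N := y))) b * dKH H r y)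
       = (LINT r:{y<..<t}|lborel. Kop (KH H) (deriv_density H) (Suc k) 0 y
            (\<lambda>x. h' (x(N := r)) - h' (x(N := y))) b * deriv_density H r y)"
      if "0 < y" "y < t" "b \<in> {1..Suc k} \<rightarrow>\<^sub>E {0..y}"
      using that by (intro set_lebesgue_integral_cong allI impI arg_cong2[where f="(*)"] IH d
        arg_cong2[where f="(-)"] hN[of _ y]) auto
    have 3: "(LINT r:{Max (\<theta> ` {1..N})<..<t}|lborel. Kstar H (Suc k) y r (\<lambda>x. h (x(N := r))) b * dKH H r y)
       = (LINT r:{Max (\<theta> ` {1..N})<..<t}|lborel.
           Kop (KH H) (deriv_density H) (Suc k) y r (\<lambda>x. h' (x(N := r))) b * deriv_density H r y)"
      if "0 < y"
      using that yM MM
      by (intro set_lebesgue_integral_cong allI impI arg_cong2[where f="(*)"] IH d bM hN) auto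
    have 4: "(LINT r:{max (Max (\<theta> ` {1..Suc k})) s<..<t}|lborel. Kstar H (Suc k) 0 r (\<lambda>x. h (x(N := r))) b * dKH H r y)
       = (LINT r:{max (Max (\<theta> ` {1..Suc k})) s<..<t}|lborel.
           Kop (KH H) (deriv_density H) (Suc k) 0 r (\<lambda>x. h' (x(N := r))) b * deriv_density H r y)"
      if "0 < y" "y < s"
      using that
      by (intro set_lebesgue_integral_cong allI impI arg_cong2[where f="(*)"] IH d bM hN) auto
    have N1: "N - 1 = Suc k" by (simp add: N_def)
    show ?thesis
      unfolding Suc Kstar.simps Kop.simps Let_def
      unfolding N_def[symmetric] N1 y_def[symmetric] b_def[symmetric] box[symmetric]
      using Suc.prems(1) bt 1 2 3 4 by (auto simp: indicator_def)
  qed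
qed

section \<open>Joint measurability of the operators\<close>

lemma measurable_extend_vec:
  "f \<in> measurable M (vec_space n) \<Longrightarrow> g \<in> borel_measurable M \<Longrightarrow> (\<lambda>x. (f x)(Suc n := g x)) \<in> measurable M (vec_space (Suc n))"
  by (rule measurable_fun_upd[where J = "{1..n}"]) auto

lemma measurable_update_vec:
  "i \<in> {1..n} \<Longrightarrow> f \<in> measurable M (vec_space n) \<Longrightarrow> g \<in> borel_measurable M \<Longrightarrow> (\<lambda>x. (f x)(i := g x)) \<in> measurable M (vec_space n)"
  by (rule measurable_fun_upd[where J = "{1..n}"]) auto

lemma measurable_Max_vec:
  assumes "k \<le> n" "f \<in> measurable M (vec_space n)"
  shows "(\<lambda>x. Max (f x ` {1..k})) \<in> borel_measurable M"
  using assms by (intro borel_measurable_Max) (auto intro!: measurable_coordinate[of _ n])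

lemma measurable_box_vec:
  assumes "k \<le> n" "f \<in> measurable M (vec_space n)" and [measurable]: "g \<in> borel_measurable M"
  shows "Measurable.pred M (\<lambda>x. \<forall>i\<in>{1..k}. 0 \<le> f x i \<and> f x i \<le> g x)"
proof (rule pred_intros_finite)
  fix i assume "i \<in> {1..k}"
  then have [measurable]: "(\<lambda>x. f x i) \<in> borel_measurable M"
    using assms by (intro measurable_coordinate[of _ n]) auto
  show "Measurable.pred M (\<lambda>x. 0 \<le> f x i \<and> f x i \<le> g x)" by measurable
qed simp

lemma measurable_indicator_Ioo_real [measurable (raw)]:
  fixes a b f :: "'a \<Rightarrow> real"
  assumes [measurable]: "a \<in> borel_measurable M" "b \<in> borel_measurable M" "f \<in> borel_measurable M"
  shows "(\<lambda>x. indicator {a x<..<b x} (f x) :: real) \<in> borel_measurable M"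
  unfolding indicator_def greaterThanLessThan_iff by measurable

abbreviation params :: "(nat \<Rightarrow> real) measure" where
  "params \<equiv> PiM UNIV (\<lambda>_. borel)"

lemma measurable_compose4:
  assumes f: "(\<lambda>(x, y, z, w). f x y z w) \<in> measurable (A \<Otimes>\<^sub>M B \<Otimes>\<^sub>M C \<Otimes>\<^sub>M D) E"
    and "g \<in> measurable M A" "h \<in> measurable M B" "k \<in> measurable M C" "l \<in> measurable M D"
  shows "(\<lambda>x. f (g x) (h x) (k x) (l x)) \<in> measurable M E"
  using measurable_compose[OF measurable_Pair[OF assms(2) measurable_Pair[OF assms(3) measurable_Pair[OF assms(4,5)]]] f]
  by simp

text \<open>The recursion freezes the last coordinate of \<open>h\<close>. Since the type of the parameter \<open>q\<close> of a family
  \<open>F q\<close> has to stay fixed in the induction, frozen coordinates are pushed onto a sequence.\<close>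

lemma Kop_measurable:
  assumes k: "(\<lambda>(t, y). k t y) \<in> borel_measurable (borel \<Otimes>\<^sub>M borel)"
    and d: "(\<lambda>(r, y). d r y) \<in> borel_measurable (borel \<Otimes>\<^sub>M borel)"
    and "(\<lambda>(q, x). F q x) \<in> borel_measurable (params \<Otimes>\<^sub>M vec_space n)"
  shows "(\<lambda>(q, s, t, \<theta>). Kop k d n s t (F q) \<theta>)
    \<in> borel_measurable (params \<Otimes>\<^sub>M borel \<Otimes>\<^sub>M borel \<Otimes>\<^sub>M vec_space n)"
  using assms(3)
proof (induction n arbitrary: F)
  case 0
  show ?case unfolding case_prod_beta Kop.simps by simp
next
  case (Suc m)
  define S where "S = params \<Otimes>\<^sub>M (borel :: real measure) \<Otimes>\<^sub>M (borel :: real measure) \<Otimes>\<^sub>M vec_space (Suc m)"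
  define L where "L = (lborel :: real measure)"
  note [measurable (raw)] = measurable_compose2[OF k] measurable_compose2[OF d]
    measurable_compose2[OF Suc.prems]
  have S[measurable]: "fst \<in> measurable S params" "(\<lambda>p. fst (snd p)) \<in> borel_measurable S"
    "(\<lambda>p. fst (snd (snd p))) \<in> borel_measurable S" and \<theta>[measurable]: "(\<lambda>p. snd (snd (snd p))) \<in> measurable S (vec_space (Suc m))"
    unfolding S_def by measurable
  have y[measurable]: "(\<lambda>p. snd (snd (snd p)) (Suc m)) \<in> borel_measurable S"
    by (rule measurable_coordinate[OF _ \<theta>]) simp
  have SL[measurable]: "(\<lambda>x. fst (fst x)) \<in> measurable (S \<Otimes>\<^sub>M L) params"
    "(\<lambda>p. fst (snd (fst p))) \<in> borel_measurable (S \<Otimes>\<^sub>M L)"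
    "(\<lambda>p. fst (snd (snd (fst p)))) \<in> borel_measurable (S \<Otimes>\<^sub>M L)"
    "(\<lambda>p. snd (snd (snd (fst p)))) \<in> measurable (S \<Otimes>\<^sub>M L) (vec_space (Suc m))"
    "(\<lambda>p. snd (snd (snd (fst p))) (Suc m)) \<in> borel_measurable (S \<Otimes>\<^sub>M L)"
    using measurable_compose[OF measurable_fst S(1)] measurable_compose[OF measurable_fst S(2)]
      measurable_compose[OF measurable_fst S(3)] measurable_compose[OF measurable_fst \<theta>]
      measurable_compose[OF measurable_fst y] by auto
  have snd[measurable]: "snd \<in> borel_measurable (S \<Otimes>\<^sub>M L)" by (simp add: L_def)
  interpret L: sigma_finite_measure L by (simp add: L_def sigma_finite_lborel)
  show ?case
  proof (cases m)
    case 0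
    have one: "1 \<in> {1..Suc 0}" by simp
    note [measurable] = measurable_update_vec[OF one SL(4)[unfolded 0] snd] y[unfolded 0 One_nat_def[symmetric]]
      SL(5)[unfolded 0 One_nat_def[symmetric]] \<theta>[unfolded 0] SL(4)[unfolded 0]
    note [measurable (raw)] = measurable_compose2[OF Suc.prems[unfolded 0]]
    show ?thesis
      unfolding S_def[symmetric] case_prod_beta
      unfolding 0 Kop.simps set_lebesgue_integral_def Let_def L_def[symmetric]
      by measurable
  next
    case (Suc j)
    define N where "N = Suc (Suc j)"
    \<comment> \<open>The value frozen last sits at index 0, and the older ones are shifted up. A
      difference of slices freezes two values: \<open>q 0\<close> is \<open>r\<close> and
      \<open>q 1\<close> is \<open>y\<close>. \<open>case_nat\<close> is the corresponding
      push.\<close>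
    define F1 F2 where
      "F1 = (\<lambda>q x. F (\<lambda>i. q (Suc i)) (x(N := q 0)))" and
      "F2 = (\<lambda>q x. F (\<lambda>i. q (Suc (Suc i))) (x(N := q 0)) - F (\<lambda>i. q (Suc (Suc i))) (x(N := q 1)))"
    have F1: "(\<lambda>x. F q (x(N := y))) = F1 (case_nat y q)" for q y by (simp add: F1_def)
    have F2: "(\<lambda>x. F q (x(N := r)) - F q (x(N := y))) = F2 (case_nat r (case_nat y q))" for q r y
      by (simp add: F2_def)
    have Fm: "(\<lambda>p. F (\<lambda>i. fst p (g i)) ((snd p)(N := fst p k))) \<in> borel_measurable (params \<Otimes>\<^sub>M vec_space (Suc j))" for g k
    proof (rule measurable_compose2[OF Suc.prems])
      show "(\<lambda>p i. fst p (g i)) \<in> measurable (params \<Otimes>\<^sub>M vec_space (Suc j)) params"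
        by (intro measurable_PiM_single') (auto intro!: measurable_compose[OF measurable_fst measurable_component_singleton])
      show "(\<lambda>p. (snd p)(N := fst p k)) \<in> measurable (params \<Otimes>\<^sub>M vec_space (Suc j)) (vec_space (Suc m))"
        unfolding N_def Suc
        by (intro measurable_extend_vec measurable_snd measurable_compose[OF measurable_fst measurable_component_singleton]) auto
    qed
    have "(\<lambda>(q, x). F1 q x) \<in> borel_measurable (params \<Otimes>\<^sub>M vec_space (Suc j))"
      unfolding F1_def case_prod_beta by (rule Fm)
    note K1 = measurable_compose4[where f = "\<lambda>q s t \<theta>. Kop k d (Suc j) s t (F1 q) \<theta>", OF Suc.IH[unfolded Suc, OF this]]
    have "(\<lambda>(q, x). F2 q x) \<in> borel_measurable (params \<Otimes>\<^sub>M vec_space (Suc j))"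
      unfolding F2_def case_prod_beta by (intro borel_measurable_diff Fm)
    note K2 = measurable_compose4[where f = "\<lambda>q s t \<theta>. Kop k d (Suc j) s t (F2 q) \<theta>", OF Suc.IH[unfolded Suc, OF this]]
    note \<theta>' = \<theta>[unfolded Suc]
    have le: "Suc j \<le> Suc (Suc j)" by simp
    note [measurable] = measurable_restrict_vec[OF le \<theta>'] measurable_restrict_vec[OF le SL(4)[unfolded Suc]]
      measurable_Max_vec[OF le \<theta>'] measurable_Max_vec[OF le_refl \<theta>'] measurable_Max_vec[OF le SL(4)[unfolded Suc]]
      measurable_Max_vec[OF le_refl SL(4)[unfolded Suc]] measurable_box_vec[OF le \<theta>' y[unfolded Suc]]
      y[unfolded Suc] SL(5)[unfolded Suc]
    note [measurable (raw)] = K1 K2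
    show ?thesis
      unfolding S_def[symmetric] case_prod_beta L_def[symmetric]
      unfolding Suc Kop.simps Let_def set_lebesgue_integral_def L_def[symmetric]
      unfolding N_def[symmetric] F2 F1
      unfolding N_def by measurable
  qed
qed

section \<open>Hoelder bounds on slices of the simplex\<close>

text \<open>A single real \<open>N\<close> bounds all difference quotients, with
  \<open>I = {}\<close> accounting for the supremum of the function. Unlike the norm, which is a sum
  of suprema, such an \<open>N\<close> passes to slices unchanged; multiplying out the denominators
  keeps the statement free of division.\<close>

definition holder_bound :: "real \<Rightarrow> nat \<Rightarrow> real \<Rightarrow> real \<Rightarrow> ((nat \<Rightarrow> real) \<Rightarrow> real) \<Rightarrow> bool" where
  "holder_bound lam n t N g \<longleftrightarrow> (\<forall>I\<subseteq>{1..n}. \<forall>(\<theta>, r)\<in>admissible_cubes n t I.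
     \<bar>cube_diff (sorted_list_of_set I) g \<theta> r\<bar> \<le> N * (\<Prod>i\<in>I. \<bar>r i - \<theta> i\<bar> powr lam))"

lemma holder_boundD:
  assumes "holder_bound lam n t N g" "I \<subseteq> {1..n}" "(\<theta>, r) \<in> admissible_cubes n t I"
  shows "\<bar>cube_diff (sorted_list_of_set I) g \<theta> r\<bar> \<le> N * (\<Prod>i\<in>I. \<bar>r i - \<theta> i\<bar> powr lam)"
  using assms unfolding holder_bound_def by blast

lemma ordered_simplex_mono: "u \<le> t \<Longrightarrow> ordered_simplex n u \<subseteq> ordered_simplex n t"
  unfolding ordered_simplex_def PiE_iff by fastforce

lemma cube_diff_slice:
  "k \<notin> set js \<Longrightarrow> cube_diff js (\<lambda>x. g (x(k := v))) \<theta> r = cube_diff js g (\<theta>(k := v)) r"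
  by (induction js arbitrary: \<theta>) (auto simp: fun_upd_twist)

text \<open>The last index of the list gives the innermost difference, so a difference of two slices
  in coordinate \<open>k\<close> is an iterated difference with \<open>k\<close> appended, based at
  the lower value \<open>u\<close>.\<close>

lemma cube_diff_slice_diff:
  "k \<notin> set js \<Longrightarrow> cube_diff js (\<lambda>x. g (x(k := r k)) - g (x(k := u))) \<theta> r
     = cube_diff (js @ [k]) g (\<theta>(k := u)) r"
  by (induction js arbitrary: \<theta>) (auto simp: fun_upd_twist)

lemma cube_diff_cong:
  "(\<And>i. i \<in> set js \<Longrightarrow> r i = r' i) \<Longrightarrow> cube_diff js g \<theta> r = cube_diff js g \<theta> r'"
  by (induction js arbitrary: \<theta>) auto

text \<open>The slice lives on the simplex of side \<open>u\<close>, so all edges of a cube in it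
  end at or before \<open>u\<close>. The last coordinate therefore stays above the others, and the
  new edge \<open>[u, r]\<close> lies to the right of all old ones, as the ordering of the edges
  demands.\<close>

lemma admissible_slice:
  assumes adm: "(\<theta>, \<rho>) \<in> admissible_cubes n u I" and I: "I \<subseteq> {1..n}" and u: "0 \<le> u" "u \<le> r" "r \<le> t"
  shows "(\<theta>(Suc n := r), \<rho>) \<in> admissible_cubes (Suc n) t I"
    and "u < r \<Longrightarrow> (\<theta>(Suc n := u), \<rho>(Suc n := r)) \<in> admissible_cubes (Suc n) t (insert (Suc n) I)"
proof -
  have \<theta>: "\<theta> \<in> ordered_simplex n u" and \<rho>: "\<forall>i\<in>I. 0 \<le> \<theta> i \<and> \<theta> i < \<rho> i \<and> \<rho> i \<le> u"
    "\<forall>i\<in>I. \<forall>j\<in>I. i < j \<longrightarrow> \<rho> i \<le> \<theta> j" and cube: "cube n I \<theta> \<rho> \<subseteq> ordered_simplex n u"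
    using adm by (auto simp: admissible_cubes_def)
  have nI: "Suc n \<notin> I" using I by auto
  have sub: "x \<in> ordered_simplex (Suc n) t"
    if "\<And>i. i \<in> {1..n} \<Longrightarrow> x i \<in> (if i \<in> I then {\<theta> i..\<rho> i} else {\<theta> i})" "x \<in> extensional {1..Suc n}"
      "u \<le> x (Suc n)" "x (Suc n) \<le> t" for x
  proof -
    have "restrict x {1..n} \<in> cube n I \<theta> \<rho>" using that(1) by (auto simp: cube_def)
    then have "(restrict x {1..n})(Suc n := x (Suc n)) \<in> ordered_simplex (Suc n) t"
      using cube that u by (intro simplex_extend) auto
    also have "(restrict x {1..n})(Suc n := x (Suc n)) = x"
      using that(2) by (auto simp: fun_eq_iff extensional_def restrict_def)
    finally show ?thesis .
  qed
  have "cube (Suc n) I (\<theta>(Suc n := r)) \<rho> \<subseteq> ordered_simplex (Suc n) t"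
  proof
    fix x assume x: "x \<in> cube (Suc n) I (\<theta>(Suc n := r)) \<rho>"
    have xi: "x i \<in> (if i \<in> I then {(\<theta>(Suc n := r)) i..\<rho> i} else {(\<theta>(Suc n := r)) i})" if "i \<in> {1..Suc n}" for i
      using x that unfolding cube_def by (rule PiE_mem)
    show "x \<in> ordered_simplex (Suc n) t"
    proof (rule sub)
      show "x i \<in> (if i \<in> I then {\<theta> i..\<rho> i} else {\<theta> i})" if "i \<in> {1..n}" for i
        using xi[of i] that by auto
      show "x \<in> extensional {1..Suc n}" using x by (auto simp: cube_def PiE_iff)
    qed (use xi[of "Suc n"] nI u in auto)
  qed
  then show "(\<theta>(Suc n := r), \<rho>) \<in> admissible_cubes (Suc n) t I"
    using \<rho> nI u simplex_extend[OF \<theta> u(2) _ u(3)] unfolding admissible_cubes_def by fastforce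
  assume "u < r"
  have "cube (Suc n) (insert (Suc n) I) (\<theta>(Suc n := u)) (\<rho>(Suc n := r)) \<subseteq> ordered_simplex (Suc n) t"
  proof
    fix x assume x: "x \<in> cube (Suc n) (insert (Suc n) I) (\<theta>(Suc n := u)) (\<rho>(Suc n := r))"
    have xi: "x i \<in> (if i \<in> insert (Suc n) I then {(\<theta>(Suc n := u)) i..(\<rho>(Suc n := r)) i} else {(\<theta>(Suc n := u)) i})"
      if "i \<in> {1..Suc n}" for i
      using x that unfolding cube_def by (rule PiE_mem)
    show "x \<in> ordered_simplex (Suc n) t"
    proof (rule sub)
      show "x i \<in> (if i \<in> I then {\<theta> i..\<rho> i} else {\<theta> i})" if "i \<in> {1..n}" for i
        using xi[of i] that by (auto split: if_splits)
      show "x \<in> extensional {1..Suc n}" using x by (auto simp: cube_def PiE_iff)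
    qed (use xi[of "Suc n"] u in auto)
  qed
  then show "(\<theta>(Suc n := u), \<rho>(Suc n := r)) \<in> admissible_cubes (Suc n) t (insert (Suc n) I)"
    using \<rho> nI u \<open>u < r\<close> I simplex_extend[OF \<theta>, of u t] unfolding admissible_cubes_def by fastforce
qed

lemma holder_bound_slice:
  assumes g: "holder_bound lam (Suc n) t N g" and u: "0 \<le> u" "u \<le> r" "r \<le> t"
  shows "holder_bound lam n u N (\<lambda>x. g (x(Suc n := r)))"
  unfolding holder_bound_def
proof safe
  fix I \<theta> \<rho> assume I: "I \<subseteq> {1..n}" and adm: "(\<theta>, \<rho>) \<in> admissible_cubes n u I"
  have nI: "Suc n \<notin> I" and "finite I" using I finite_subset[of I "{1..n}"] by auto
  then have "cube_diff (sorted_list_of_set I) (\<lambda>x. g (x(Suc n := r))) \<theta> \<rho>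
      = cube_diff (sorted_list_of_set I) g (\<theta>(Suc n := r)) \<rho>"
    by (intro cube_diff_slice) simp
  also have "\<bar>\<dots>\<bar> \<le> N * (\<Prod>i\<in>I. \<bar>\<rho> i - (\<theta>(Suc n := r)) i\<bar> powr lam)"
    using I by (intro holder_boundD[OF g] admissible_slice[OF adm I u]) auto
  also have "(\<Prod>i\<in>I. \<bar>\<rho> i - (\<theta>(Suc n := r)) i\<bar> powr lam) = (\<Prod>i\<in>I. \<bar>\<rho> i - \<theta> i\<bar> powr lam)"
    using nI by (intro prod.cong) auto
  finally show "\<bar>cube_diff (sorted_list_of_set I) (\<lambda>x. g (x(Suc n := r))) \<theta> \<rho>\<bar>
      \<le> N * (\<Prod>i\<in>I. \<bar>\<rho> i - \<theta> i\<bar> powr lam)" .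
qed

lemma holder_bound_slice_diff:
  assumes g: "holder_bound lam (Suc n) t N g" and u: "0 \<le> u" "u < r" "r \<le> t"
  shows "holder_bound lam n u (N * (r - u) powr lam) (\<lambda>x. g (x(Suc n := r)) - g (x(Suc n := u)))"
  unfolding holder_bound_def
proof safe
  fix I \<theta> \<rho> assume I: "I \<subseteq> {1..n}" and adm: "(\<theta>, \<rho>) \<in> admissible_cubes n u I"
  let ?r = "\<rho>(Suc n := r)"
  have nI: "Suc n \<notin> I" and fin: "finite I" using I finite_subset[of I "{1..n}"] by auto
  have "cube_diff (sorted_list_of_set I) (\<lambda>x. g (x(Suc n := r)) - g (x(Suc n := u))) \<theta> \<rho>
      = cube_diff (sorted_list_of_set I) (\<lambda>x. g (x(Suc n := ?r (Suc n))) - g (x(Suc n := u))) \<theta> ?r"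
    using nI fin by (simp, intro cube_diff_cong) auto
  also have "\<dots> = cube_diff (sorted_list_of_set I @ [Suc n]) g (\<theta>(Suc n := u)) ?r"
    using nI fin by (intro cube_diff_slice_diff) simp
  \<comment> \<open>\<open>Suc n\<close> exceeds every index in \<open>I\<close>, so appending it
    keeps the list sorted.\<close>
  also have "sorted_list_of_set I @ [Suc n] = sorted_list_of_set (insert (Suc n) I)"
  proof (rule sorted_distinct_set_unique)
    show "sorted (sorted_list_of_set I @ [Suc n])" using I fin by (auto simp: sorted_append)
    show "distinct (sorted_list_of_set I @ [Suc n])" using nI fin by simp
    show "set (sorted_list_of_set I @ [Suc n]) = set (sorted_list_of_set (insert (Suc n) I))"
      using fin by (simp only: set_append set_sorted_list_of_set finite_insert list.set) auto
  qed (rule sorted_list_of_set.sorted_sorted_key_list_of_set distinct_sorted_list_of_set)+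
  also have "\<bar>cube_diff (sorted_list_of_set (insert (Suc n) I)) g (\<theta>(Suc n := u)) ?r\<bar>
      \<le> N * (\<Prod>i\<in>insert (Suc n) I. \<bar>?r i - (\<theta>(Suc n := u)) i\<bar> powr lam)"
    using I u by (intro holder_boundD[OF g] admissible_slice(2)[OF adm I]) auto
  also have "(\<Prod>i\<in>insert (Suc n) I. \<bar>?r i - (\<theta>(Suc n := u)) i\<bar> powr lam)
      = (r - u) powr lam * (\<Prod>i\<in>I. \<bar>?r i - (\<theta>(Suc n := u)) i\<bar> powr lam)"
    using nI fin u by simp
  also have "(\<Prod>i\<in>I. \<bar>?r i - (\<theta>(Suc n := u)) i\<bar> powr lam) = (\<Prod>i\<in>I. \<bar>\<rho> i - \<theta> i\<bar> powr lam)"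
    using nI by (intro prod.cong) auto
  finally show "\<bar>cube_diff (sorted_list_of_set I) (\<lambda>x. g (x(Suc n := r)) - g (x(Suc n := u))) \<theta> \<rho>\<bar>
      \<le> N * (r - u) powr lam * (\<Prod>i\<in>I. \<bar>\<rho> i - \<theta> i\<bar> powr lam)"
    by (simp only: mult.assoc)
qed

text \<open>This is the case \<open>I = {}\<close>: the empty difference is the function itself, the
  empty product is 1, and the degenerate cube is the point \<open>x\<close>.\<close>

lemma holder_bound_abs:
  assumes "holder_bound lam n t N g" "x \<in> ordered_simplex n t"
  shows "\<bar>g x\<bar> \<le> N"
proof -
  have x: "x \<in> extensional {1..n}" using assms(2) by (auto simp: ordered_simplex_def PiE_iff)
  have "y = x" if "y \<in> cube n {} x x" for y
  proof (rule extensionalityI[of y "{1..n}"])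
    show "y \<in> extensional {1..n}" using that by (auto simp: cube_def PiE_iff)
    show "y i = x i" if "i \<in> {1..n}" for i
      using PiE_mem[OF \<open>y \<in> cube n {} x x\<close>[unfolded cube_def] that] by simp
  qed fact
  then have "(x, x) \<in> admissible_cubes n t {}"
    using assms(2) by (auto simp: admissible_cubes_def)
  from holder_boundD[OF assms(1) _ this] show ?thesis by simp
qed

lemma holder_bound_one:
  assumes g: "holder_bound lam (Suc 0) t N g" and \<theta>: "\<theta> \<in> {1..Suc 0} \<rightarrow>\<^sub>E {0..t}"
  shows "\<bar>g \<theta>\<bar> \<le> N" "0 \<le> r \<Longrightarrow> r \<le> t \<Longrightarrow> \<bar>g (\<theta>(1 := r))\<bar> \<le> N"
    and "\<theta> 1 < r \<Longrightarrow> r \<le> t \<Longrightarrow> \<bar>g (\<theta>(1 := r)) - g \<theta>\<bar> \<le> N * (r - \<theta> 1) powr lam"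
proof -
  \<comment> \<open>A vector of length one is the empty vector extended by its only coordinate; the
    slice lemmas for \<open>n = 0\<close> then give the one-dimensional Hoelder estimate.\<close>
  let ?e = "\<lambda>_::nat. undefined :: real"
  have t: "0 \<le> \<theta> 1" "\<theta> 1 \<le> t" using \<theta> by (auto simp: PiE_iff)
  have e: "?e \<in> ordered_simplex 0 u" for u by (auto simp: ordered_simplex_def mono_on_def)
  have eq: "\<theta>(1 := r) = ?e(Suc 0 := r)" for r
    using \<theta> by (auto simp: fun_eq_iff PiE_iff extensional_def)
  have eq': "\<theta> = ?e(Suc 0 := \<theta> 1)" using eq[of "\<theta> 1"] by simp
  show "\<bar>g \<theta>\<bar> \<le> N" using \<theta> by (intro holder_bound_abs[OF g] simplex_one)
  show "\<bar>g (\<theta>(1 := r))\<bar> \<le> N" if "0 \<le> r" "r \<le> t"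
    unfolding eq by (intro holder_bound_abs[OF g] simplex_extend[OF e, of r]) (use that in auto)
  show "\<bar>g (\<theta>(1 := r)) - g \<theta>\<bar> \<le> N * (r - \<theta> 1) powr lam" if "\<theta> 1 < r" "r \<le> t"
    using holder_bound_abs[OF holder_bound_slice_diff[OF g t(1) that] e] unfolding eq eq'[symmetric] .
qed

section \<open>Domination of integrals against the density\<close>

text \<open>A function that is not integrable has Bochner integral 0, so the inequality is safe in
  that case too. Domination can thus be proved before integrability is known.\<close>

lemma abs_set_integral_le:
  fixes f :: "real \<Rightarrow> real"
  shows "ennreal \<bar>LINT r:A|lborel. f r\<bar> \<le> (\<integral>\<^sup>+r\<in>A. ennreal \<bar>f r\<bar> \<partial>lborel)"
proof (cases "integrable lborel (\<lambda>r. indicator A r *\<^sub>R f r)")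
  case True
  from integral_norm_bound_ennreal[OF this]
  show ?thesis unfolding set_lebesgue_integral_def real_norm_def
    by (rule order_trans) (auto intro!: nn_integral_mono split: split_indicator)
qed (simp add: set_lebesgue_integral_def not_integrable_integral_eq)

text \<open>The larger set \<open>B\<close> serves to discard the maxima in the lower limits of the
  operator, which the majorant does not have.\<close>

lemma abs_set_integral_le_majorant:
  fixes f d :: "real \<Rightarrow> real" and F w :: "real \<Rightarrow> ennreal"
  assumes "\<And>r. r \<in> A \<Longrightarrow> r \<in> B" "\<And>r. r \<in> A \<Longrightarrow> ennreal \<bar>f r\<bar> \<le> F r" "\<And>r. r \<in> A \<Longrightarrow> ennreal \<bar>d r\<bar> \<le> w r"
  shows "ennreal \<bar>LINT r:A|lborel. f r * d r\<bar> \<le> (\<integral>\<^sup>+r\<in>B. F r * w r \<partial>lborel)"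
proof -
  have "ennreal \<bar>f r * d r\<bar> \<le> F r * w r" if "r \<in> A" for r
    using mult_mono[OF assms(2)[OF that] assms(3)[OF that]] by (simp add: abs_mult ennreal_mult)
  then have "(\<integral>\<^sup>+r\<in>A. ennreal \<bar>f r * d r\<bar> \<partial>lborel) \<le> (\<integral>\<^sup>+r\<in>B. F r * w r \<partial>lborel)"
    using assms(1) by (intro nn_integral_mono) (auto split: split_indicator)
  with abs_set_integral_le show ?thesis by (rule order_trans)
qed

lemma deriv_majorant_holder_integral:
  assumes "0 \<le> M" "1/2 < lam + H" "y \<le> t"
  shows "(\<integral>\<^sup>+r\<in>{y<..<t}. ennreal ((r - y) powr lam) * deriv_majorant M H r y \<partial>lborel)
     = ennreal (M * ((t - y) powr (lam + H - 1/2) / (lam + H - 1/2)))"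
proof -
  have "(\<integral>\<^sup>+r\<in>{y<..<t}. ennreal ((r - y) powr lam) * deriv_majorant M H r y \<partial>lborel)
    = (\<integral>\<^sup>+r. ennreal M * (ennreal ((r - y) powr (lam + H - 3/2)) * indicator {y<..<t} r) \<partial>lborel)"
    using assms unfolding deriv_majorant_def
    by (intro nn_integral_cong)
      (auto split: split_indicator simp: mult.left_commute powr_add[symmetric] algebra_simps simp flip: ennreal_mult)
  also have "\<dots> = ennreal M * ennreal ((t - y) powr (lam + H - 1/2) / (lam + H - 1/2))"
    using nn_integral_powr_left[of y t "lam + H - 3/2"] assms by (subst nn_integral_cmult) auto
  finally show ?thesis using assms by (simp flip: ennreal_mult)
qed

section \<open>Domination and linearity of the operators\<close>

lemma ennreal_abs_mult_le:
  assumes "ennreal \<bar>a\<bar> \<le> A" "ennreal \<bar>b\<bar> \<le> B"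
  shows "ennreal \<bar>a * b\<bar> \<le> A * B"
  using mult_mono[OF assms] by (simp add: abs_mult ennreal_mult)

lemma ennreal_abs_add_le: "ennreal \<bar>a + b\<bar> \<le> ennreal \<bar>a\<bar> + ennreal \<bar>b\<bar>"
  by (simp flip: ennreal_plus add: ennreal_leI abs_triangle_ineq)

lemma measurable_Kmaj_time:
  assumes "(\<lambda>(t, y). \<kappa> t y) \<in> borel_measurable (borel \<Otimes>\<^sub>M borel)"
    and "(\<lambda>(r, y). w r y) \<in> borel_measurable (borel \<Otimes>\<^sub>M borel)" and "b \<in> space (vec_space n)"
  shows "(\<lambda>r. Kmaj \<kappa> w n s r b) \<in> borel_measurable borel"
  by (rule measurable_compose3[OF Kmaj_measurable[OF assms(1,2)]]) (use assms(3) in auto)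

lemma restrict_in_vec: "restrict \<theta> {1..n} \<in> space (vec_space n)"
  by (auto simp: space_PiM)

lemma restrict_box:
  assumes "\<theta> \<in> {1..Suc n} \<rightarrow>\<^sub>E {0..t}" "\<And>i. i \<in> {1..n} \<Longrightarrow> \<theta> i \<le> u"
  shows "restrict \<theta> {1..n} \<in> {1..n} \<rightarrow>\<^sub>E {0..(u::real)}"
  using assms by (auto simp: PiE_iff)

lemma le_of_Max_less:
  fixes \<theta> :: "nat \<Rightarrow> real"
  assumes "Max (\<theta> ` {1..n}) < r" "i \<in> {1..n}"
  shows "\<theta> i < r"
proof -
  have "\<theta> i \<le> Max (\<theta> ` {1..n})" using assms(2) by (intro Max_ge) auto
  with assms(1) show ?thesis by linarith
qed

text \<open>The boundary term and the difference term share the factor \<open>N * Kmaj 0 y\<close>: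
  the slice at \<open>y\<close> has bound \<open>N\<close>, the difference of slices has
  \<open>N * (r - y) powr lam\<close>. The assumption \<open>kern\<close> is shaped so that their
  coefficients together are at most \<open>\<kappa> t y\<close>.\<close>

lemma Kop_bound:
  assumes \<kappa>: "(\<lambda>(t, y). \<kappa> t y) \<in> borel_measurable (borel \<Otimes>\<^sub>M borel)"
    and w: "(\<lambda>(r, y). w r y) \<in> borel_measurable (borel \<Otimes>\<^sub>M borel)"
    and kern: "\<And>t y. 0 < y \<Longrightarrow> y < t \<Longrightarrow> ennreal \<bar>k t y\<bar>
        + (\<integral>\<^sup>+r\<in>{y<..<t}. ennreal ((r - y) powr lam) * w r y \<partial>lborel) \<le> \<kappa> t y"
    and dens: "\<And>r y. ennreal \<bar>d r y\<bar> \<le> w r y"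
    and "holder_bound lam n t N h" "0 \<le> N" "0 \<le> s" "\<theta> \<in> {1..n} \<rightarrow>\<^sub>E {0..t}"
  shows "ennreal \<bar>Kop k d n s t h \<theta>\<bar> \<le> ennreal N * Kmaj \<kappa> w n s t \<theta>"
  using assms(5-)
proof (induction n arbitrary: s t h N \<theta>)
  case (Suc m)
  note [measurable (raw)] = measurable_compose2[OF w]
  note h = Suc.prems(1) and N = Suc.prems(2) and \<theta> = Suc.prems(4)
  let ?J = "\<lambda>y. \<integral>\<^sup>+r\<in>{y<..<t}. ennreal ((r - y) powr lam) * w r y \<partial>lborel"
  show ?case
  proof (cases m)
    case 0
    define y where "y = \<theta> 1"
    have h1: "holder_bound lam (Suc 0) t N h" and \<theta>1: "\<theta> \<in> {1..Suc 0} \<rightarrow>\<^sub>E {0..t}"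
      using h \<theta> 0 by simp_all
    note hb = holder_bound_one[OF h1 \<theta>1, folded y_def]
    consider "s < y" "y < t" | "\<not> (s < y \<and> y < t)" "0 < y" "y < s"
      | "\<not> (s < y \<and> y < t)" "\<not> (0 < y \<and> y < s)" by blast
    then show ?thesis
    proof cases
      case 1
      have "ennreal \<bar>h \<theta> * k t y\<bar> \<le> ennreal N * ennreal \<bar>k t y\<bar>"
        using hb(1) by (intro ennreal_abs_mult_le ennreal_leI) auto
      moreover have "ennreal \<bar>LINT r:{y<..<t}|lborel. (h (\<theta>(1 := r)) - h \<theta>) * d r y\<bar>
          \<le> (\<integral>\<^sup>+r\<in>{y<..<t}. (ennreal N * ennreal ((r - y) powr lam)) * w r y \<partial>lborel)"
        using hb(3) N by (intro abs_set_integral_le_majorant dens) (auto simp flip: ennreal_mult intro!: ennreal_leI)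
      moreover have "\<dots> = ennreal N * ?J y"
        by (subst nn_integral_cmult[symmetric]) (auto simp: mult.assoc)
      ultimately have "ennreal \<bar>h \<theta> * k t y + (LINT r:{y<..<t}|lborel. (h (\<theta>(1 := r)) - h \<theta>) * d r y)\<bar>
          \<le> ennreal N * ennreal \<bar>k t y\<bar> + ennreal N * ?J y"
        by (intro order_trans[OF ennreal_abs_add_le] add_mono) auto
      also have "\<dots> = ennreal N * (ennreal \<bar>k t y\<bar> + ?J y)" by (simp add: distrib_left)
      also have "\<dots> \<le> ennreal N * \<kappa> t y" using 1 Suc.prems(3) by (intro mult_left_mono kern) auto
      finally show ?thesis using 1 by (simp add: 0 y_def Let_def)
    next
      case 2
      have "ennreal \<bar>LINT r:{s<..<t}|lborel. h (\<theta>(1 := r)) * d r y\<bar> \<le> (\<integral>\<^sup>+r\<in>{s<..<t}. ennreal N * w r y \<partial>lborel)"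
        using hb(2) Suc.prems(3) by (intro abs_set_integral_le_majorant dens ennreal_leI) auto
      also have "\<dots> = ennreal N * (\<integral>\<^sup>+r\<in>{s<..<t}. w r y \<partial>lborel)"
        by (subst nn_integral_cmult[symmetric]) (auto simp: mult.assoc)
      finally show ?thesis using 2 by (simp add: 0 y_def Let_def)
    next
      case 3
      then have "Kop k d (Suc 0) s t h \<theta> = 0"
        unfolding Kop.simps Let_def y_def by (simp only: if_False)
      then show ?thesis by (simp add: 0)
    qed
  next
    case (Suc j)
    define n where "n = Suc (Suc j)"
    define y b where "y = \<theta> n" and "b = restrict \<theta> {1..Suc j}"
    have hn: "holder_bound lam (Suc (Suc j)) t N h" and \<theta>n: "\<theta> \<in> {1..Suc (Suc j)} \<rightarrow>\<^sub>E {0..t}"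
      using h \<theta> Suc by simp_all
    note IH = Suc.IH[unfolded Suc]
    note slice = holder_bound_slice[OF hn, folded n_def] and slice_diff = holder_bound_slice_diff[OF hn, folded n_def]
    have [measurable]: "(\<lambda>r. Kmaj \<kappa> w (Suc j) s r b) \<in> borel_measurable borel" for s
      unfolding b_def by (rule measurable_Kmaj_time[OF \<kappa> w restrict_in_vec])
    have rec: "Kop k d (Suc m) s t h \<theta> =
      (if s < y \<and> y < t then
        (if \<forall>i\<in>{1..Suc j}. 0 \<le> \<theta> i \<and> \<theta> i \<le> y then
          Kop k d (Suc j) 0 y (\<lambda>x. h (x(n := y))) b * k t y
          + (LINT r:{y<..<t}|lborel. Kop k d (Suc j) 0 y (\<lambda>x. h (x(n := r)) - h (x(n := y))) b * d r y)
         else 0)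
        + (LINT r:{Max (\<theta> ` {1..n})<..<t}|lborel. Kop k d (Suc j) y r (\<lambda>x. h (x(n := r))) b * d r y)
      else if 0 < y \<and> y < s then
        LINT r:{max (Max (\<theta> ` {1..Suc j})) s<..<t}|lborel. Kop k d (Suc j) 0 r (\<lambda>x. h (x(n := r))) b * d r y
      else 0)"
      unfolding Suc Kop.simps Let_def n_def y_def b_def ..
    have recM: "Kmaj \<kappa> w (Suc m) s t \<theta> =
      (if s < y \<and> y < t then
        \<kappa> t y * Kmaj \<kappa> w (Suc j) 0 y b + (\<integral>\<^sup>+r\<in>{y<..<t}. Kmaj \<kappa> w (Suc j) y r b * w r y \<partial>lborel)
      else if 0 < y \<and> y < s then \<integral>\<^sup>+r\<in>{s<..<t}. Kmaj \<kappa> w (Suc j) 0 r b * w r y \<partial>lborel else 0)"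
      unfolding Suc Kmaj.simps Let_def n_def y_def b_def ..
    consider "s < y" "y < t" | "\<not> (s < y \<and> y < t)" "0 < y" "y < s"
      | "\<not> (s < y \<and> y < t)" "\<not> (0 < y \<and> y < s)" by blast
    then show ?thesis
    proof cases
      case 1
      then have y: "0 < y" using Suc.prems(3) by simp
      let ?G = "Kmaj \<kappa> w (Suc j) 0 y b"
      let ?T12 = "if \<forall>i\<in>{1..Suc j}. 0 \<le> \<theta> i \<and> \<theta> i \<le> y then
          Kop k d (Suc j) 0 y (\<lambda>x. h (x(n := y))) b * k t y
          + (LINT r:{y<..<t}|lborel. Kop k d (Suc j) 0 y (\<lambda>x. h (x(n := r)) - h (x(n := y))) b * d r y)
         else 0"
      have T12: "ennreal \<bar>?T12\<bar> \<le> ennreal N * (\<kappa> t y * ?G)"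
      proof (cases "\<forall>i\<in>{1..Suc j}. 0 \<le> \<theta> i \<and> \<theta> i \<le> y")
        case True
        have b: "b \<in> {1..Suc j} \<rightarrow>\<^sub>E {0..y}"
          unfolding b_def using True by (intro restrict_box[OF \<theta>n]) auto
        have "ennreal \<bar>Kop k d (Suc j) 0 y (\<lambda>x. h (x(n := y))) b * k t y\<bar> \<le> ennreal N * ?G * ennreal \<bar>k t y\<bar>"
          using y 1 b N by (intro ennreal_abs_mult_le IH slice) auto
        \<comment> \<open>The induction hypothesis is used with \<open>N * (r - y) powr lam\<close>
          in place of \<open>N\<close>; the dependence on \<open>r\<close> is then entirely in the
          weight, and \<open>?J y\<close> remains.\<close>
        moreover have "ennreal \<bar>LINT r:{y<..<t}|lborel. Kop k d (Suc j) 0 y (\<lambda>x. h (x(n := r)) - h (x(n := y))) b * d r y\<bar>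
          \<le> (\<integral>\<^sup>+r\<in>{y<..<t}. (ennreal (N * (r - y) powr lam) * ?G) * w r y \<partial>lborel)"
          using y 1 b N by (intro abs_set_integral_le_majorant dens IH slice_diff) auto
        moreover have "\<dots> = (\<integral>\<^sup>+r. ennreal N * ?G * (ennreal ((r - y) powr lam) * w r y * indicator {y<..<t} r) \<partial>lborel)"
          using N by (intro nn_integral_cong) (simp add: ennreal_mult mult_ac)
        moreover have "\<dots> = ennreal N * ?G * ?J y"
          by (intro nn_integral_cmult) measurable
        ultimately have "ennreal \<bar>?T12\<bar> \<le> ennreal N * ?G * ennreal \<bar>k t y\<bar> + ennreal N * ?G * ?J y"
          unfolding if_P[OF True] by (intro order_trans[OF ennreal_abs_add_le] add_mono) auto
        also have "\<dots> = ennreal N * ?G * (ennreal \<bar>k t y\<bar> + ?J y)" by (simp add: distrib_left)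
        also have "\<dots> \<le> ennreal N * ?G * \<kappa> t y" using 1 y by (intro mult_left_mono kern) auto
        finally show ?thesis by (simp add: mult_ac)
      next
        case False
        show ?thesis unfolding if_not_P[OF False] by simp
      qed
      \<comment> \<open>Every \<open>r\<close> above the maximum is above \<open>y\<close> and above
        all other coordinates. The latter places the shorter vector in the cube of side
        \<open>r\<close>, as the induction hypothesis requires.\<close>
      have "ennreal \<bar>LINT r:{Max (\<theta> ` {1..n})<..<t}|lborel. Kop k d (Suc j) y r (\<lambda>x. h (x(n := r))) b * d r y\<bar>
          \<le> (\<integral>\<^sup>+r\<in>{y<..<t}. (ennreal N * Kmaj \<kappa> w (Suc j) y r b) * w r y \<partial>lborel)"
      proof (intro abs_set_integral_le_majorant dens)
        fix r assume r: "r \<in> {Max (\<theta> ` {1..n})<..<t}"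
        have lt: "\<theta> i < r" if "i \<in> {1..n}" for i using r that by (intro le_of_Max_less[of \<theta> n]) auto
        then have yr: "y < r" unfolding y_def n_def by simp
        then show "r \<in> {y<..<t}" using r by simp
        have "b \<in> {1..Suc j} \<rightarrow>\<^sub>E {0..r}"
          unfolding b_def using lt by (intro restrict_box[OF \<theta>n]) (auto simp: n_def intro: less_imp_le)
        then show "ennreal \<bar>Kop k d (Suc j) y r (\<lambda>x. h (x(n := r))) b\<bar> \<le> ennreal N * Kmaj \<kappa> w (Suc j) y r b"
          using y yr r N by (intro IH slice) auto
      qed
      also have "\<dots> = ennreal N * (\<integral>\<^sup>+r\<in>{y<..<t}. Kmaj \<kappa> w (Suc j) y r b * w r y \<partial>lborel)"
        by (subst nn_integral_cmult[symmetric]) (auto simp: mult.assoc)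
      finally have "ennreal \<bar>?T12 + (LINT r:{Max (\<theta> ` {1..n})<..<t}|lborel. Kop k d (Suc j) y r (\<lambda>x. h (x(n := r))) b * d r y)\<bar>
         \<le> ennreal N * (\<kappa> t y * ?G) + ennreal N * (\<integral>\<^sup>+r\<in>{y<..<t}. Kmaj \<kappa> w (Suc j) y r b * w r y \<partial>lborel)"
        by (intro order_trans[OF ennreal_abs_add_le] add_mono T12)
      then show ?thesis using 1 unfolding rec recM by (simp add: distrib_left)
    next
      case 2
      have "ennreal \<bar>LINT r:{max (Max (\<theta> ` {1..Suc j})) s<..<t}|lborel. Kop k d (Suc j) 0 r (\<lambda>x. h (x(n := r))) b * d r y\<bar>
          \<le> (\<integral>\<^sup>+r\<in>{s<..<t}. (ennreal N * Kmaj \<kappa> w (Suc j) 0 r b) * w r y \<partial>lborel)"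
      proof (intro abs_set_integral_le_majorant dens)
        fix r assume r: "r \<in> {max (Max (\<theta> ` {1..Suc j})) s<..<t}"
        have lt: "\<theta> i < r" if "i \<in> {1..Suc j}" for i using r that by (intro le_of_Max_less[of \<theta> "Suc j"]) auto
        show "r \<in> {s<..<t}" using r by simp
        have "b \<in> {1..Suc j} \<rightarrow>\<^sub>E {0..r}"
          unfolding b_def using lt by (intro restrict_box[OF \<theta>n]) (auto intro: less_imp_le)
        then show "ennreal \<bar>Kop k d (Suc j) 0 r (\<lambda>x. h (x(n := r))) b\<bar> \<le> ennreal N * Kmaj \<kappa> w (Suc j) 0 r b"
          using 2 r N by (intro IH slice) auto
      qed
      also have "\<dots> = ennreal N * (\<integral>\<^sup>+r\<in>{s<..<t}. Kmaj \<kappa> w (Suc j) 0 r b * w r y \<partial>lborel)"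
        by (subst nn_integral_cmult[symmetric]) (auto simp: mult.assoc)
      finally show ?thesis using 2 unfolding rec recM by simp
    next
      case 3
      then show ?thesis unfolding rec by (simp only: if_False) simp
    qed
  qed
qed simp

section \<open>Linearity where the majorant is finite\<close>

lemma Kop_slice_measurable:
  assumes k: "(\<lambda>(t, y). k t y) \<in> borel_measurable (borel \<Otimes>\<^sub>M borel)"
    and d: "(\<lambda>(r, y). d r y) \<in> borel_measurable (borel \<Otimes>\<^sub>M borel)"
    and f: "f \<in> borel_measurable (vec_space (Suc n))" and b: "b \<in> space (vec_space n)"
  shows "(\<lambda>r. Kop k d n s r (\<lambda>x. f (x(Suc n := r))) b) \<in> borel_measurable borel"
    and "(\<lambda>r. Kop k d n s t (\<lambda>x. f (x(Suc n := r)) - f (x(Suc n := u))) b) \<in> borel_measurable borel"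
proof -
  let ?F = "\<lambda>q x. f (x(Suc n := q (0::nat)))"
  have upd: "(\<lambda>p. f ((snd p)(Suc n := fst p 0))) \<in> borel_measurable (params \<Otimes>\<^sub>M vec_space n)"
    by (intro measurable_compose[OF measurable_extend_vec f] measurable_snd
        measurable_compose[OF measurable_fst measurable_component_singleton]) auto
  have updu: "(\<lambda>p. f ((snd p)(Suc n := u))) \<in> borel_measurable (params \<Otimes>\<^sub>M vec_space n)"
    by (intro measurable_compose[OF measurable_extend_vec f] measurable_snd) auto
  \<comment> \<open>The parameter sequence is constantly \<open>r\<close>; the family reads only its
    entry 0.\<close>
  have const: "(\<lambda>r _. r) \<in> measurable borel params" by (intro measurable_PiM_single') auto
  have b': "(\<lambda>_. b) \<in> measurable borel (vec_space n)" using b by simp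
  have 1: "(\<lambda>(q, x). ?F q x) \<in> borel_measurable (params \<Otimes>\<^sub>M vec_space n)"
    unfolding case_prod_beta by (rule upd)
  show "(\<lambda>r. Kop k d n s r (\<lambda>x. f (x(Suc n := r))) b) \<in> borel_measurable borel"
    by (rule measurable_compose4[where f = "\<lambda>q s t \<theta>. Kop k d n s t (?F q) \<theta>",
      OF Kop_measurable[OF k d 1] const _ _ b']) simp_all
  have 2: "(\<lambda>(q, x). ?F q x - f (x(Suc n := u))) \<in> borel_measurable (params \<Otimes>\<^sub>M vec_space n)"
    unfolding case_prod_beta by (intro borel_measurable_diff upd updu)
  show "(\<lambda>r. Kop k d n s t (\<lambda>x. f (x(Suc n := r)) - f (x(Suc n := u))) b) \<in> borel_measurable borel"
    by (rule measurable_compose4[where f = "\<lambda>q s t \<theta>. Kop k d n s t (\<lambda>x. ?F q x - f (x(Suc n := u))) \<theta>",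
      OF Kop_measurable[OF k d 2] const _ _ b']) simp_all
qed

lemma Kop_measurable_vec:
  assumes "(\<lambda>(t, y). k t y) \<in> borel_measurable (borel \<Otimes>\<^sub>M borel)"
    and "(\<lambda>(r, y). d r y) \<in> borel_measurable (borel \<Otimes>\<^sub>M borel)"
    and "f \<in> borel_measurable (vec_space n)"
  shows "Kop k d n s t f \<in> borel_measurable (vec_space n)"
proof -
  have "(\<lambda>(q, x). f x) \<in> borel_measurable (params \<Otimes>\<^sub>M vec_space n)"
    unfolding case_prod_beta using measurable_compose[OF measurable_snd assms(3)] .
  moreover have "(\<lambda>_ _. 0) \<in> measurable (vec_space n) params" by (intro measurable_const) (simp add: space_PiM)
  ultimately show ?thesis
    by (rule measurable_compose4[where f = "\<lambda>q s t \<theta>. Kop k d n s t f \<theta>", OF Kop_measurable[OF assms(1,2)]])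
      simp_all
qed

lemma set_integrable_majorant:
  fixes f d :: "real \<Rightarrow> real" and F w :: "real \<Rightarrow> ennreal"
  assumes [measurable]: "f \<in> borel_measurable borel" "d \<in> borel_measurable borel" "A \<in> sets borel"
    and le: "\<And>r. r \<in> A \<Longrightarrow> r \<in> B" "\<And>r. r \<in> A \<Longrightarrow> ennreal \<bar>f r\<bar> \<le> F r" "\<And>r. r \<in> A \<Longrightarrow> ennreal \<bar>d r\<bar> \<le> w r"
    and fin: "(\<integral>\<^sup>+r\<in>B. F r * w r \<partial>lborel) < \<infinity>"
  shows "set_integrable lborel A (\<lambda>r. f r * d r)"
  unfolding set_integrable_def
proof (rule integrableI_bounded)
  have "ennreal (norm (indicat_real A r *\<^sub>R (f r * d r))) \<le> F r * w r * indicator B r" for r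
    using ennreal_abs_mult_le[OF le(2,3), of r] le(1)[of r] by (auto split: split_indicator)
  then have "(\<integral>\<^sup>+r. ennreal (norm (indicat_real A r *\<^sub>R (f r * d r))) \<partial>lborel) \<le> (\<integral>\<^sup>+r\<in>B. F r * w r \<partial>lborel)"
    by (intro nn_integral_mono)
  with fin show "(\<integral>\<^sup>+r. ennreal (norm (indicat_real A r *\<^sub>R (f r * d r))) \<partial>lborel) < \<infinity>" by simp
qed simp

text \<open>Inside an integral over \<open>r\<close>, linearity of the shorter operator is available
  only at those \<open>r\<close> where its majorant is finite, hence the identity for almost every
  \<open>r\<close>.\<close>

lemma set_integral_linear_AE:
  fixes E F G d :: "real \<Rightarrow> real"
  assumes [measurable]: "E \<in> borel_measurable borel" "F \<in> borel_measurable borel" "G \<in> borel_measurable borel"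
      "d \<in> borel_measurable borel" "A \<in> sets borel"
    and F: "set_integrable lborel A (\<lambda>r. F r * d r)" and G: "set_integrable lborel A (\<lambda>r. G r * d r)"
    and eq: "AE r in lborel. r \<in> A \<longrightarrow> E r = a * F r + b * G r"
  shows "(LINT r:A|lborel. E r * d r) = a * (LINT r:A|lborel. F r * d r) + b * (LINT r:A|lborel. G r * d r)"
proof -
  have "(LINT r:A|lborel. E r * d r) = (LINT r:A|lborel. a * (F r * d r) + b * (G r * d r))"
  proof (rule set_lebesgue_integral_cong_AE)
    show "AE r\<in>A in lborel. E r * d r = a * (F r * d r) + b * (G r * d r)"
      using eq by eventually_elim (auto simp: algebra_simps)
  qed simp_all
  also have "\<dots> = a * (LINT r:A|lborel. F r * d r) + b * (LINT r:A|lborel. G r * d r)"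
    using F G by (subst set_integral_add) auto
  finally show ?thesis .
qed

text \<open>Finiteness of the majorant makes every integral in the recursion absolutely convergent,
  so the integrals are additive. To apply the induction hypothesis, finiteness must descend from a
  product to its factor \<open>Kmaj\<close> at the lower level; strict positivity of
  \<open>\<kappa>\<close> and \<open>w\<close> rules out a product of 0 and infinity.\<close>

lemma Kop_linear:
  assumes k: "(\<lambda>(t, y). k t y) \<in> borel_measurable (borel \<Otimes>\<^sub>M borel)"
    and d: "(\<lambda>(r, y). d r y) \<in> borel_measurable (borel \<Otimes>\<^sub>M borel)"
    and \<kappa>: "(\<lambda>(t, y). \<kappa> t y) \<in> borel_measurable (borel \<Otimes>\<^sub>M borel)"
    and w: "(\<lambda>(r, y). w r y) \<in> borel_measurable (borel \<Otimes>\<^sub>M borel)"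
    and kern: "\<And>t y. 0 < y \<Longrightarrow> y < t \<Longrightarrow> ennreal \<bar>k t y\<bar>
        + (\<integral>\<^sup>+r\<in>{y<..<t}. ennreal ((r - y) powr lam) * w r y \<partial>lborel) \<le> \<kappa> t y"
    and dens: "\<And>r y. ennreal \<bar>d r y\<bar> \<le> w r y"
    and \<kappa>_fin: "\<And>t y. 0 < y \<Longrightarrow> y < t \<Longrightarrow> 0 < \<kappa> t y \<and> \<kappa> t y < \<infinity>"
    and w_pos: "\<And>r y. 0 < y \<Longrightarrow> y < r \<Longrightarrow> 0 < w r y"
    and "f \<in> borel_measurable (vec_space n)" "g \<in> borel_measurable (vec_space n)"
    and "holder_bound lam n t Nf f" "holder_bound lam n t Ng g" "0 \<le> Nf" "0 \<le> Ng"
    and "0 \<le> s" "\<theta> \<in> {1..n} \<rightarrow>\<^sub>E {0..t}" "Kmaj \<kappa> w n s t \<theta> < \<infinity>"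
  shows "Kop k d n s t (\<lambda>x. a * f x + b * g x) \<theta> = a * Kop k d n s t f \<theta> + b * Kop k d n s t g \<theta>"
  using assms(9-)
proof (induction n arbitrary: s t f g Nf Ng \<theta>)
  case (Suc m)
  note [measurable (raw)] = measurable_compose2[OF w] measurable_compose2[OF d]
  note fg = Suc.prems(1-6) and s0 = Suc.prems(7) and \<theta> = Suc.prems(8) and fin = Suc.prems(9)
  let ?J = "\<lambda>y. \<integral>\<^sup>+r\<in>{y<..<t}. ennreal ((r - y) powr lam) * w r y \<partial>lborel"
  have dm: "(\<lambda>r. d r y) \<in> borel_measurable borel" for y by measurable
  have J_fin: "?J y < \<infinity>" if "0 < y" "y < t" for y
  proof -
    have "?J y \<le> ennreal \<bar>k t y\<bar> + ?J y" by simp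
    also have "\<dots> \<le> \<kappa> t y" by (rule kern[OF that])
    finally show ?thesis using \<kappa>_fin[OF that] by (auto intro: le_less_trans)
  qed
  show ?case
  proof (cases m)
    case 0
    define y where "y = \<theta> 1"
    have \<theta>1: "\<theta> \<in> {1..Suc 0} \<rightarrow>\<^sub>E {0..t}" using \<theta> 0 by simp
    have finM: "Kmaj \<kappa> w (Suc 0) s t \<theta> < \<infinity>" using fin 0 by simp
    have \<theta>v: "(\<lambda>_. \<theta>) \<in> measurable borel (vec_space (Suc 0))"
      using \<theta>1 by (intro measurable_const) (auto simp: space_PiM PiE_iff)
    have one: "1 \<in> {1..Suc 0}" by simp
    have upd: "(\<lambda>r. h (\<theta>(1 := r))) \<in> borel_measurable borel" if "h \<in> borel_measurable (vec_space (Suc 0))" for h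
      by (rule measurable_compose[OF measurable_update_vec[OF one \<theta>v] that]) simp
    have near: "set_integrable lborel {y<..<t} (\<lambda>r. (h (\<theta>(1 := r)) - h \<theta>) * d r y)"
      if h: "h \<in> borel_measurable (vec_space (Suc 0))" "holder_bound lam (Suc 0) t N h" "0 \<le> N" and y: "0 < y" "y < t" for h N
    proof (rule set_integrable_majorant[where B = "{y<..<t}" and F = "\<lambda>r. ennreal N * ennreal ((r - y) powr lam)" and w = "\<lambda>r. w r y"])
      show "ennreal \<bar>h (\<theta>(1 := r)) - h \<theta>\<bar> \<le> ennreal N * ennreal ((r - y) powr lam)" if "r \<in> {y<..<t}" for r
        using holder_bound_one(3)[OF h(2) \<theta>1, of r] that h(3) unfolding y_def by (simp flip: ennreal_mult)
      have "(\<integral>\<^sup>+r\<in>{y<..<t}. ennreal N * ennreal ((r - y) powr lam) * w r y \<partial>lborel) = ennreal N * ?J y"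
        by (subst nn_integral_cmult[symmetric]) (auto simp: mult.assoc)
      also have "\<dots> < \<infinity>" using J_fin[OF y] by (simp add: ennreal_mult_less_top)
      finally show "(\<integral>\<^sup>+r\<in>{y<..<t}. ennreal N * ennreal ((r - y) powr lam) * w r y \<partial>lborel) < \<infinity>" .
    qed (use upd[OF h(1)] dm dens in auto)
    have far: "set_integrable lborel {s<..<t} (\<lambda>r. h (\<theta>(1 := r)) * d r y)"
      if h: "h \<in> borel_measurable (vec_space (Suc 0))" "holder_bound lam (Suc 0) t N h" "0 \<le> N" and y: "0 < y" "y < s" for h N
    proof (rule set_integrable_majorant[where B = "{s<..<t}" and F = "\<lambda>r. ennreal N" and w = "\<lambda>r. w r y"])
      show "ennreal \<bar>h (\<theta>(1 := r))\<bar> \<le> ennreal N" if "r \<in> {s<..<t}" for r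
        using holder_bound_one(2)[OF h(2) \<theta>1, of r] that y by (intro ennreal_leI) auto
      have "(\<integral>\<^sup>+r\<in>{s<..<t}. w r y \<partial>lborel) < \<infinity>"
        using finM y unfolding Kmaj.simps y_def by (simp split: if_splits)
      then show "(\<integral>\<^sup>+r\<in>{s<..<t}. ennreal N * w r y \<partial>lborel) < \<infinity>"
        unfolding mult.assoc by (subst nn_integral_cmult) (auto simp: ennreal_mult_less_top)
    qed (use upd[OF h(1)] dm dens in auto)
    note fg0 = fg[unfolded 0]
    note um = upd[OF fg0(1)] upd[OF fg0(2)]
    have 1: "(LINT r:{y<..<t}|lborel. (a * f (\<theta>(1 := r)) + b * g (\<theta>(1 := r)) - (a * f \<theta> + b * g \<theta>)) * d r y)
       = a * (LINT r:{y<..<t}|lborel. (f (\<theta>(1 := r)) - f \<theta>) * d r y)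
       + b * (LINT r:{y<..<t}|lborel. (g (\<theta>(1 := r)) - g \<theta>) * d r y)" if "0 < y" "y < t"
    proof (rule set_integral_linear_AE[OF _ _ _ dm _ near[OF fg0(1,3,5) that] near[OF fg0(2,4,6) that]])
      show "AE r in lborel. r \<in> {y<..<t} \<longrightarrow> a * f (\<theta>(1 := r)) + b * g (\<theta>(1 := r)) - (a * f \<theta> + b * g \<theta>)
          = a * (f (\<theta>(1 := r)) - f \<theta>) + b * (g (\<theta>(1 := r)) - g \<theta>)"
        by (intro AE_I2 impI) (simp only: algebra_simps)
    qed (intro borel_measurable_diff borel_measurable_add borel_measurable_times borel_measurable_const um
      borel_open open_greaterThanLessThan)+
    have 2: "(LINT r:{s<..<t}|lborel. (a * f (\<theta>(1 := r)) + b * g (\<theta>(1 := r))) * d r y)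
       = a * (LINT r:{s<..<t}|lborel. f (\<theta>(1 := r)) * d r y)
       + b * (LINT r:{s<..<t}|lborel. g (\<theta>(1 := r)) * d r y)" if "0 < y" "y < s"
      by (rule set_integral_linear_AE[OF _ um dm _ far[OF fg0(1,3,5) that] far[OF fg0(2,4,6) that]])
        (intro borel_measurable_add borel_measurable_times borel_measurable_const um
          borel_open open_greaterThanLessThan AE_I2 impI refl)+
    show ?thesis
      unfolding 0 Kop.simps Let_def y_def[symmetric]
      using 1 2 s0 by (simp add: algebra_simps)
  next
    case (Suc j)
    define n where "n = Suc (Suc j)"
    define y bb where "y = \<theta> n" and "bb = restrict \<theta> {1..Suc j}"
    have \<theta>n: "\<theta> \<in> {1..Suc (Suc j)} \<rightarrow>\<^sub>E {0..t}" using \<theta> Suc by simp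
    have bv: "bb \<in> space (vec_space (Suc j))" unfolding bb_def by (rule restrict_in_vec)
    note IH = Suc.IH[unfolded Suc]
    note fgn = fg[unfolded Suc]
    have Kmm[measurable]: "(\<lambda>r. Kmaj \<kappa> w (Suc j) s r bb) \<in> borel_measurable borel" for s
      by (rule measurable_Kmaj_time[OF \<kappa> w bv])
    have slm: "(\<lambda>r. Kop k d (Suc j) s r (\<lambda>x. h (x(n := r))) bb) \<in> borel_measurable borel"
         "(\<lambda>r. Kop k d (Suc j) s' t' (\<lambda>x. h (x(n := r)) - h (x(n := u))) bb) \<in> borel_measurable borel"
      if "h \<in> borel_measurable (vec_space (Suc (Suc j)))" for h s s' t' u
      unfolding n_def by (intro Kop_slice_measurable[OF k d that bv])+
    have hm: "(\<lambda>x. h (x(n := r))) \<in> borel_measurable (vec_space (Suc j))"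
      if "h \<in> borel_measurable (vec_space (Suc (Suc j)))" for h r
      unfolding n_def by (intro measurable_compose[OF measurable_extend_vec that]) auto
    have rec: "Kop k d (Suc m) s t h \<theta> =
      (if s < y \<and> y < t then
        (if \<forall>i\<in>{1..Suc j}. 0 \<le> \<theta> i \<and> \<theta> i \<le> y then
          Kop k d (Suc j) 0 y (\<lambda>x. h (x(n := y))) bb * k t y
          + (LINT r:{y<..<t}|lborel. Kop k d (Suc j) 0 y (\<lambda>x. h (x(n := r)) - h (x(n := y))) bb * d r y)
         else 0)
        + (LINT r:{Max (\<theta> ` {1..n})<..<t}|lborel. Kop k d (Suc j) y r (\<lambda>x. h (x(n := r))) bb * d r y)
      else if 0 < y \<and> y < s then
        LINT r:{max (Max (\<theta> ` {1..Suc j})) s<..<t}|lborel. Kop k d (Suc j) 0 r (\<lambda>x. h (x(n := r))) bb * d r y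
      else 0)" for h
      unfolding Suc Kop.simps Let_def n_def y_def bb_def ..
    have recM: "Kmaj \<kappa> w (Suc m) s t \<theta> =
      (if s < y \<and> y < t then
        \<kappa> t y * Kmaj \<kappa> w (Suc j) 0 y bb + (\<integral>\<^sup>+r\<in>{y<..<t}. Kmaj \<kappa> w (Suc j) y r bb * w r y \<partial>lborel)
      else if 0 < y \<and> y < s then \<integral>\<^sup>+r\<in>{s<..<t}. Kmaj \<kappa> w (Suc j) 0 r bb * w r y \<partial>lborel else 0)"
      unfolding Suc Kmaj.simps Let_def n_def y_def bb_def ..
    let ?h = "\<lambda>x. a * f x + b * g x"
    have hmeas: "?h \<in> borel_measurable (vec_space (Suc (Suc j)))" using fgn(1,2) by simp
    \<comment> \<open>Covers both integrals whose inner operator ends at \<open>r\<close>. Here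
      \<open>u\<close> is the inner start time and \<open>v\<close> the lower limit in the majorant:
      \<open>u = v = y\<close> for \<open>s < y\<close>, and \<open>u = 0\<close>,
      \<open>v = s\<close> for \<open>y < s\<close>.\<close>
    have tail: "(LINT r:A|lborel. Kop k d (Suc j) u r (\<lambda>x. ?h (x(n := r))) bb * d r y)
        = a * (LINT r:A|lborel. Kop k d (Suc j) u r (\<lambda>x. f (x(n := r))) bb * d r y)
        + b * (LINT r:A|lborel. Kop k d (Suc j) u r (\<lambda>x. g (x(n := r))) bb * d r y)"
      if A: "A \<in> sets borel" "A \<subseteq> {v<..<t}" "\<And>r i. r \<in> A \<Longrightarrow> i \<in> {1..Suc j} \<Longrightarrow> \<theta> i < r"
        and v: "0 < y" "y \<le> v" "0 \<le> u"
        and fin: "(\<integral>\<^sup>+r\<in>{v<..<t}. Kmaj \<kappa> w (Suc j) u r bb * w r y \<partial>lborel) < \<infinity>" for A u v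
    proof -
      have box: "bb \<in> {1..Suc j} \<rightarrow>\<^sub>E {0..r}" if "r \<in> A" for r
        unfolding bb_def using A(3)[OF that] by (intro restrict_box[OF \<theta>n]) (auto intro: less_imp_le)
      have r: "0 < r" "r < t" "v < r" "y < r" if "r \<in> A" for r using A(2) that v by auto
      have int: "set_integrable lborel A (\<lambda>r. Kop k d (Suc j) u r (\<lambda>x. h (x(n := r))) bb * d r y)"
        if h: "h \<in> borel_measurable (vec_space (Suc (Suc j)))" "holder_bound lam (Suc (Suc j)) t N h" "0 \<le> N" for h N
      proof (rule set_integrable_majorant[where B = "{v<..<t}" and F = "\<lambda>r. ennreal N * Kmaj \<kappa> w (Suc j) u r bb" and w = "\<lambda>r. w r y"])
        show "ennreal \<bar>Kop k d (Suc j) u r (\<lambda>x. h (x(n := r))) bb\<bar> \<le> ennreal N * Kmaj \<kappa> w (Suc j) u r bb"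
          if "r \<in> A" for r
          unfolding n_def using r[OF that] box[OF that] h v
          by (intro Kop_bound[OF \<kappa> w kern dens] holder_bound_slice[OF h(2)]) auto
        have "(\<integral>\<^sup>+r\<in>{v<..<t}. ennreal N * Kmaj \<kappa> w (Suc j) u r bb * w r y \<partial>lborel)
            = ennreal N * (\<integral>\<^sup>+r\<in>{v<..<t}. Kmaj \<kappa> w (Suc j) u r bb * w r y \<partial>lborel)"
          by (subst nn_integral_cmult[symmetric]) (auto simp: mult.assoc)
        also have "\<dots> < \<infinity>" using fin by (simp add: ennreal_mult_less_top)
        finally show "(\<integral>\<^sup>+r\<in>{v<..<t}. ennreal N * Kmaj \<kappa> w (Suc j) u r bb * w r y \<partial>lborel) < \<infinity>" .
      qed (use slm(1)[OF h(1)] dm dens A in auto)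
      \<comment> \<open>A finite integral has an almost everywhere finite integrand, and
        \<open>w r y > 0\<close> on \<open>A\<close> passes this to the inner majorant.\<close>
      have "AE r in lborel. Kmaj \<kappa> w (Suc j) u r bb * w r y * indicator {v<..<t} r \<noteq> \<infinity>"
        using fin by (intro nn_integral_PInf_AE) auto
      then have eq: "AE r in lborel. r \<in> A \<longrightarrow> Kop k d (Suc j) u r (\<lambda>x. ?h (x(n := r))) bb
         = a * Kop k d (Suc j) u r (\<lambda>x. f (x(n := r))) bb + b * Kop k d (Suc j) u r (\<lambda>x. g (x(n := r))) bb"
      proof eventually_elim
        fix r assume *: "Kmaj \<kappa> w (Suc j) u r bb * w r y * indicator {v<..<t} r \<noteq> \<infinity>"
        show "r \<in> A \<longrightarrow> Kop k d (Suc j) u r (\<lambda>x. ?h (x(n := r))) bb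
         = a * Kop k d (Suc j) u r (\<lambda>x. f (x(n := r))) bb + b * Kop k d (Suc j) u r (\<lambda>x. g (x(n := r))) bb"
        proof
          assume rA: "r \<in> A"
          have "Kmaj \<kappa> w (Suc j) u r bb < \<infinity>"
            using * r[OF rA] w_pos[of y r] v(1) by (auto simp: ennreal_mult_eq_top_iff top.not_eq_extremum)
          then show "Kop k d (Suc j) u r (\<lambda>x. ?h (x(n := r))) bb
             = a * Kop k d (Suc j) u r (\<lambda>x. f (x(n := r))) bb + b * Kop k d (Suc j) u r (\<lambda>x. g (x(n := r))) bb"
            using r[OF rA] v box[OF rA] fgn(5,6)
            by (intro IH[where Nf = Nf and Ng = Ng] hm fgn(1,2) holder_bound_slice[OF fgn(3), folded n_def] holder_bound_slice[OF fgn(4), folded n_def]) auto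
        qed
      qed
      show ?thesis
        by (rule set_integral_linear_AE[OF slm(1)[OF hmeas] slm(1)[OF fgn(1)] slm(1)[OF fgn(2)] dm A(1)
          int[OF fgn(1,3,5)] int[OF fgn(2,4,6)] eq])
    qed
    consider "s < y" "y < t" | "\<not> (s < y \<and> y < t)" "0 < y" "y < s"
      | "\<not> (s < y \<and> y < t)" "\<not> (0 < y \<and> y < s)" by blast
    then show ?thesis
    proof cases
      case 1
      then have y: "0 < y" using s0 by simp
      let ?G = "Kmaj \<kappa> w (Suc j) 0 y bb"
      have finG: "\<kappa> t y * ?G < \<infinity>"
        and fin3: "(\<integral>\<^sup>+r\<in>{y<..<t}. Kmaj \<kappa> w (Suc j) y r bb * w r y \<partial>lborel) < \<infinity>"
        using fin 1 unfolding recM by auto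
      have G: "?G < \<infinity>"
        using finG \<kappa>_fin[OF y 1(2)] by (auto simp: ennreal_mult_less_top)
      have T3: "(LINT r:{Max (\<theta> ` {1..n})<..<t}|lborel. Kop k d (Suc j) y r (\<lambda>x. ?h (x(n := r))) bb * d r y)
        = a * (LINT r:{Max (\<theta> ` {1..n})<..<t}|lborel. Kop k d (Suc j) y r (\<lambda>x. f (x(n := r))) bb * d r y)
        + b * (LINT r:{Max (\<theta> ` {1..n})<..<t}|lborel. Kop k d (Suc j) y r (\<lambda>x. g (x(n := r))) bb * d r y)"
      proof (rule tail[of _ y])
        have lt: "\<theta> i < r" if "r \<in> {Max (\<theta> ` {1..n})<..<t}" "i \<in> {1..n}" for r i
          using that by (intro le_of_Max_less[of \<theta> n]) auto
        show "{Max (\<theta> ` {1..n})<..<t} \<subseteq> {y<..<t}"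
          using lt[of _ n] by (auto simp: y_def n_def)
        show "\<theta> i < r" if "r \<in> {Max (\<theta> ` {1..n})<..<t}" "i \<in> {1..Suc j}" for r i
          using that by (intro lt) (auto simp: n_def)
      qed (use y fin3 in auto)
      have T12: "Kop k d (Suc j) 0 y (\<lambda>x. ?h (x(n := y))) bb * k t y
          + (LINT r:{y<..<t}|lborel. Kop k d (Suc j) 0 y (\<lambda>x. ?h (x(n := r)) - ?h (x(n := y))) bb * d r y)
        = a * (Kop k d (Suc j) 0 y (\<lambda>x. f (x(n := y))) bb * k t y
          + (LINT r:{y<..<t}|lborel. Kop k d (Suc j) 0 y (\<lambda>x. f (x(n := r)) - f (x(n := y))) bb * d r y))
        + b * (Kop k d (Suc j) 0 y (\<lambda>x. g (x(n := y))) bb * k t y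
          + (LINT r:{y<..<t}|lborel. Kop k d (Suc j) 0 y (\<lambda>x. g (x(n := r)) - g (x(n := y))) bb * d r y))"
        if box: "\<forall>i\<in>{1..Suc j}. 0 \<le> \<theta> i \<and> \<theta> i \<le> y"
      proof -
        have bb: "bb \<in> {1..Suc j} \<rightarrow>\<^sub>E {0..y}"
          unfolding bb_def using box by (intro restrict_box[OF \<theta>n]) auto
        have int: "set_integrable lborel {y<..<t}
            (\<lambda>r. Kop k d (Suc j) 0 y (\<lambda>x. h (x(n := r)) - h (x(n := y))) bb * d r y)"
          if h: "h \<in> borel_measurable (vec_space (Suc (Suc j)))" "holder_bound lam (Suc (Suc j)) t N h" "0 \<le> N" for h N
        proof (rule set_integrable_majorant[where B = "{y<..<t}" and F = "\<lambda>r. ennreal (N * (r - y) powr lam) * ?G" and w = "\<lambda>r. w r y"])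
          show "ennreal \<bar>Kop k d (Suc j) 0 y (\<lambda>x. h (x(n := r)) - h (x(n := y))) bb\<bar> \<le> ennreal (N * (r - y) powr lam) * ?G"
            if "r \<in> {y<..<t}" for r
            unfolding n_def using that bb h y
            by (intro Kop_bound[OF \<kappa> w kern dens] holder_bound_slice_diff[OF h(2)]) auto
          have "(\<integral>\<^sup>+r\<in>{y<..<t}. ennreal (N * (r - y) powr lam) * ?G * w r y \<partial>lborel)
            = (\<integral>\<^sup>+r. ennreal N * ?G * (ennreal ((r - y) powr lam) * w r y * indicator {y<..<t} r) \<partial>lborel)"
            using h(3) by (intro nn_integral_cong) (simp add: ennreal_mult mult_ac)
          also have "\<dots> = ennreal N * ?G * ?J y"
            by (intro nn_integral_cmult) measurable
          also have "\<dots> < \<infinity>" using G J_fin[OF y 1(2)] by (simp add: ennreal_mult_less_top)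
          finally show "(\<integral>\<^sup>+r\<in>{y<..<t}. ennreal (N * (r - y) powr lam) * ?G * w r y \<partial>lborel) < \<infinity>" .
        qed (use slm(2)[OF h(1)] dm dens in auto)
        have e1: "Kop k d (Suc j) 0 y (\<lambda>x. ?h (x(n := y))) bb
          = a * Kop k d (Suc j) 0 y (\<lambda>x. f (x(n := y))) bb + b * Kop k d (Suc j) 0 y (\<lambda>x. g (x(n := y))) bb"
          using y 1 G bb fgn(5,6)
          by (intro IH[where Nf = Nf and Ng = Ng] hm fgn(1,2) holder_bound_slice[OF fgn(3), folded n_def] holder_bound_slice[OF fgn(4), folded n_def]) auto
        \<comment> \<open>The inner times \<open>0\<close> and \<open>y\<close> do not move with
          \<open>r\<close>, so finiteness of the single value \<open>?G\<close> gives linearity at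
          every \<open>r\<close>, without exceptional set.\<close>
        have e2: "Kop k d (Suc j) 0 y (\<lambda>x. ?h (x(n := r)) - ?h (x(n := y))) bb
          = a * Kop k d (Suc j) 0 y (\<lambda>x. f (x(n := r)) - f (x(n := y))) bb
          + b * Kop k d (Suc j) 0 y (\<lambda>x. g (x(n := r)) - g (x(n := y))) bb" if r: "r \<in> {y<..<t}" for r
        proof -
          have "(\<lambda>x. ?h (x(n := r)) - ?h (x(n := y)))
            = (\<lambda>x. a * (f (x(n := r)) - f (x(n := y))) + b * (g (x(n := r)) - g (x(n := y))))"
            by (simp add: fun_eq_iff algebra_simps)
          moreover have "Kop k d (Suc j) 0 y
             (\<lambda>x. a * (f (x(n := r)) - f (x(n := y))) + b * (g (x(n := r)) - g (x(n := y)))) bb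
            = a * Kop k d (Suc j) 0 y (\<lambda>x. f (x(n := r)) - f (x(n := y))) bb
            + b * Kop k d (Suc j) 0 y (\<lambda>x. g (x(n := r)) - g (x(n := y))) bb"
            using y r G bb fgn(5,6)
            by (intro IH[where Nf = "Nf * (r - y) powr lam" and Ng = "Ng * (r - y) powr lam"]
                borel_measurable_diff hm fgn(1,2) holder_bound_slice_diff[OF fgn(3), folded n_def]
                holder_bound_slice_diff[OF fgn(4), folded n_def]) auto
          ultimately show ?thesis by (simp only:)
        qed
        have "(LINT r:{y<..<t}|lborel. Kop k d (Suc j) 0 y (\<lambda>x. ?h (x(n := r)) - ?h (x(n := y))) bb * d r y)
          = a * (LINT r:{y<..<t}|lborel. Kop k d (Suc j) 0 y (\<lambda>x. f (x(n := r)) - f (x(n := y))) bb * d r y)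
          + b * (LINT r:{y<..<t}|lborel. Kop k d (Suc j) 0 y (\<lambda>x. g (x(n := r)) - g (x(n := y))) bb * d r y)"
          by (rule set_integral_linear_AE[OF slm(2)[OF hmeas] slm(2)[OF fgn(1)] slm(2)[OF fgn(2)] dm _
            int[OF fgn(1,3,5)] int[OF fgn(2,4,6)]])
            (rule borel_open open_greaterThanLessThan | intro AE_I2 impI e2, assumption)+
        with e1 show ?thesis by (simp only: ring_distribs mult_ac add_ac)
      qed
      show ?thesis
      proof (cases "\<forall>i\<in>{1..Suc j}. 0 \<le> \<theta> i \<and> \<theta> i \<le> y")
        case True
        show ?thesis unfolding rec if_P[OF True] using 1 T12[OF True] T3 by (simp only: if_True simp_thms ring_distribs mult_ac add_ac)
      next
        case False
        show ?thesis unfolding rec if_not_P[OF False] using 1 T3 by (simp only: if_True simp_thms add_0_left)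
      qed
    next
      case 2
      have fin4: "(\<integral>\<^sup>+r\<in>{s<..<t}. Kmaj \<kappa> w (Suc j) 0 r bb * w r y \<partial>lborel) < \<infinity>"
        using fin 2 unfolding recM by auto
      have "(LINT r:{max (Max (\<theta> ` {1..Suc j})) s<..<t}|lborel. Kop k d (Suc j) 0 r (\<lambda>x. ?h (x(n := r))) bb * d r y)
        = a * (LINT r:{max (Max (\<theta> ` {1..Suc j})) s<..<t}|lborel. Kop k d (Suc j) 0 r (\<lambda>x. f (x(n := r))) bb * d r y)
        + b * (LINT r:{max (Max (\<theta> ` {1..Suc j})) s<..<t}|lborel. Kop k d (Suc j) 0 r (\<lambda>x. g (x(n := r))) bb * d r y)"
      proof (rule tail[of _ s])
        show "\<theta> i < r" if "r \<in> {max (Max (\<theta> ` {1..Suc j})) s<..<t}" "i \<in> {1..Suc j}" for r i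
          using that by (intro le_of_Max_less[of \<theta> "Suc j"]) auto
      qed (use 2 fin4 in auto)
      then show ?thesis using 2 unfolding rec by (simp only: if_True if_False simp_thms)
    next
      case 3
      then show ?thesis unfolding rec by (simp only: if_False mult_zero_right add_0)
    qed
  qed
qed simp

section \<open>Measurability of Hoelder functions on the simplex\<close>

text \<open>The one-dimensional cubes, \<open>I = {i}\<close>. Any point between two ordered vectors
  that differ in one coordinate is ordered, so the whole segment lies in the simplex and is
  admissible.\<close>

lemma holder_bound_single:
  assumes h: "holder_bound lam n t N h" and x: "x \<in> ordered_simplex n t" "x(i := v) \<in> ordered_simplex n t"
    and i: "i \<in> {1..n}" "x i \<le> v"
  shows "\<bar>h (x(i := v)) - h x\<bar> \<le> N * (v - x i) powr lam"
proof (cases "x i = v")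
  case True
  then show ?thesis by (simp add: fun_upd_idem)
next
  case False
  then have lt: "x i < v" using i by simp
  have xE: "x \<in> {1..n} \<rightarrow>\<^sub>E {0..t}" and xm: "mono_on {1..n} x" and vE: "x(i := v) \<in> {1..n} \<rightarrow>\<^sub>E {0..t}"
    and vm: "mono_on {1..n} (x(i := v))" using x by (auto simp: ordered_simplex_def)
  have v: "v \<le> t" "0 \<le> x i" using PiE_mem[OF vE i(1)] PiE_mem[OF xE i(1)] by auto
  have "cube n {i} x (\<lambda>_. v) \<subseteq> ordered_simplex n t"
  proof
    fix z assume z: "z \<in> cube n {i} x (\<lambda>_. v)"
    have zi: "z j \<in> (if j \<in> {i} then {x j..v} else {x j})" if "j \<in> {1..n}" for j
      using z that unfolding cube_def by (rule PiE_mem)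
    have "z j \<in> {0..t}" if "j \<in> {1..n}" for j
      using zi[OF that] PiE_mem[OF xE that] v by (auto split: if_splits)
    then have "z \<in> {1..n} \<rightarrow>\<^sub>E {0..t}" using z by (auto simp: cube_def PiE_iff)
    moreover have "mono_on {1..n} z"
    proof (rule mono_onI)
      fix j k assume jk: "j \<in> {1..n}" "k \<in> {1..n}" "j \<le> k"
      show "z j \<le> z k"
        using mono_onD[OF xm jk] mono_onD[OF vm jk] zi[OF jk(1)] zi[OF jk(2)] by (auto split: if_splits)
    qed
    ultimately show "z \<in> ordered_simplex n t" by (simp add: ordered_simplex_def)
  qed
  then have "(x, \<lambda>_. v) \<in> admissible_cubes n t {i}"
    using x lt v by (simp add: admissible_cubes_def)
  from holder_boundD[OF h _ this] show ?thesis using i lt by simp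
qed

text \<open>Raising the coordinates one at a time, the last one first, stays inside the simplex.\<close>

lemma holder_bound_mono_pair:
  assumes h: "holder_bound lam n t N h" and x: "x \<in> ordered_simplex n t" and z: "z \<in> ordered_simplex n t"
    and le: "\<And>i. i \<in> {1..n} \<Longrightarrow> x i \<le> z i"
  shows "\<bar>h z - h x\<bar> \<le> N * (\<Sum>i\<in>{1..n}. (z i - x i) powr lam)"
proof -
  \<comment> \<open>\<open>W j\<close> carries the last \<open>j\<close> coordinates of
    \<open>z\<close> and the remaining ones of \<open>x\<close>. It is ordered since
    \<open>x i \<le> x k \<le> z k\<close> across the seam; passing to \<open>W (Suc j)\<close>
    raises coordinate \<open>n - j\<close>.\<close>
  define W where "W = (\<lambda>j i. if i \<in> {1..n} \<and> n - j < i then z i else x i)"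
  have xE: "x \<in> {1..n} \<rightarrow>\<^sub>E {0..t}" "mono_on {1..n} x" and zE: "z \<in> {1..n} \<rightarrow>\<^sub>E {0..t}" "mono_on {1..n} z"
    using x z by (auto simp: ordered_simplex_def)
  have W: "W j \<in> ordered_simplex n t" for j
  proof -
    have "W j \<in> {1..n} \<rightarrow>\<^sub>E {0..t}" using xE(1) zE(1) by (auto simp: W_def PiE_iff extensional_def)
    moreover have "mono_on {1..n} (W j)"
    proof (rule mono_onI)
      fix i k assume ik: "i \<in> {1..n}" "k \<in> {1..n}" "i \<le> k"
      show "W j i \<le> W j k"
        using mono_onD[OF xE(2) ik] mono_onD[OF zE(2) ik] le[OF ik(2)] ik(3) ik(1,2) by (auto simp: W_def)
    qed
    ultimately show ?thesis by (simp add: ordered_simplex_def)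
  qed
  have step: "W (Suc j) = (W j)(n - j := z (n - j))" and pos: "W j (n - j) = x (n - j)" if "j < n" for j
    using that by (auto simp: W_def fun_eq_iff)
  have "\<bar>h (W j) - h x\<bar> \<le> N * (\<Sum>i\<in>{n - j<..n}. (z i - x i) powr lam)" if "j \<le> n" for j
    using that
  proof (induction j)
    case 0
    have "W 0 = x" by (auto simp: W_def fun_eq_iff)
    then show ?case by simp
  next
    case (Suc j)
    then have j: "j < n" and mem: "n - j \<in> {1..n}" by auto
    have "\<bar>h (W (Suc j)) - h (W j)\<bar> \<le> N * (z (n - j) - x (n - j)) powr lam"
      using holder_bound_single[OF h W[of j] _ mem, of "z (n - j)"] W[of "Suc j"] le[OF mem] pos[OF j]
      unfolding step[OF j] by simp
    moreover have "{n - Suc j<..n} = insert (n - j) {n - j<..n}" using j by auto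
    ultimately show ?case using Suc by (simp add: distrib_left)
  qed
  from this[of n] have "\<bar>h (W n) - h x\<bar> \<le> N * (\<Sum>i\<in>{0<..n}. (z i - x i) powr lam)" by simp
  moreover have "W n = z"
    using xE(1) zE(1) by (auto simp: W_def fun_eq_iff PiE_iff extensional_def)
  moreover have "{0<..n} = {1..n}" by auto
  ultimately show ?thesis by simp
qed

text \<open>Two points of the simplex need not be comparable, but their coordinatewise maximum is
  again in the simplex and dominates both. Going through it costs the factor 2.\<close>

lemma holder_bound_pair:
  assumes h: "holder_bound lam n t N h" and "0 \<le> N" "0 < lam"
    and x: "x \<in> ordered_simplex n t" and y: "y \<in> ordered_simplex n t"
  shows "\<bar>h y - h x\<bar> \<le> 2 * N * (\<Sum>i\<in>{1..n}. \<bar>y i - x i\<bar> powr lam)"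
proof -
  define z where "z = (\<lambda>i. max (x i) (y i))"
  have xE: "x \<in> {1..n} \<rightarrow>\<^sub>E {0..t}" "mono_on {1..n} x" and yE: "y \<in> {1..n} \<rightarrow>\<^sub>E {0..t}" "mono_on {1..n} y"
    using x y by (auto simp: ordered_simplex_def)
  have "z \<in> {1..n} \<rightarrow>\<^sub>E {0..t}" using xE(1) yE(1) by (auto simp: z_def PiE_iff extensional_def max_def)
  moreover have "mono_on {1..n} z"
    using xE(2) yE(2) unfolding z_def mono_on_def by (meson max.mono)
  ultimately have z: "z \<in> ordered_simplex n t" by (simp add: ordered_simplex_def)
  have half: "\<bar>h z - h u\<bar> \<le> N * (\<Sum>i\<in>{1..n}. \<bar>y i - x i\<bar> powr lam)" if u: "u \<in> {x, y}" for u
  proof -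
    have "\<bar>h z - h u\<bar> \<le> N * (\<Sum>i\<in>{1..n}. (z i - u i) powr lam)"
      using u x y z by (intro holder_bound_mono_pair[OF h]) (auto simp: z_def)
    also have "\<dots> \<le> N * (\<Sum>i\<in>{1..n}. \<bar>y i - x i\<bar> powr lam)"
      using assms(2,3) u by (intro mult_left_mono sum_mono powr_mono2) (auto simp: z_def)
    finally show ?thesis .
  qed
  have "\<bar>h y - h x\<bar> \<le> \<bar>h z - h x\<bar> + \<bar>h z - h y\<bar>" by simp
  also have "\<dots> \<le> 2 * N * (\<Sum>i\<in>{1..n}. \<bar>y i - x i\<bar> powr lam)" using half[of x] half[of y] by simp
  finally show ?thesis .
qed

lemma holder_bound_continuous:
  assumes h: "holder_bound lam n t N h" and "0 \<le> N" "0 < lam"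
  shows "continuous_on (ordered_simplex n t) h"
  unfolding continuous_on_def
proof
  fix x assume x: "x \<in> ordered_simplex n t"
  let ?F = "at x within ordered_simplex n t"
  have "((\<lambda>y. y i) \<longlongrightarrow> x i) ?F" for i
    using continuous_on_product_coordinates[of i] unfolding continuous_on_def
    by (auto intro: tendsto_within_subset[where S = UNIV])
  then have "((\<lambda>y. y i - x i) \<longlongrightarrow> 0) ?F" for i
    by (rule Lim_null[THEN iffD1])
  then have "((\<lambda>y. \<bar>y i - x i\<bar> powr lam) \<longlongrightarrow> 0) ?F" for i
    using assms(3) by (intro tendsto_zero_powrI[where b = lam] tendsto_rabs_zero tendsto_const) auto
  then have "((\<lambda>y. 2 * N * (\<Sum>i\<in>{1..n}. \<bar>y i - x i\<bar> powr lam)) \<longlongrightarrow> 2 * N * (\<Sum>i\<in>{1..n}. 0)) ?F"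
    by (intro tendsto_mult_left tendsto_sum)
  then have lim: "((\<lambda>y. 2 * N * (\<Sum>i\<in>{1..n}. \<bar>y i - x i\<bar> powr lam)) \<longlongrightarrow> 0) ?F" by simp
  have "\<forall>\<^sub>F y in ?F. norm (h y - h x) \<le> 2 * N * (\<Sum>i\<in>{1..n}. \<bar>y i - x i\<bar> powr lam)"
    using holder_bound_pair[OF assms x] by (auto simp: eventually_at_filter)
  from Lim_null_comparison[OF this lim] show "(h \<longlongrightarrow> h x) ?F" by (rule Lim_null[THEN iffD2])
qed

lemma closed_ordered_simplex: "closed (ordered_simplex n t)"
proof -
  have cont: "continuous_on UNIV (\<lambda>x :: nat \<Rightarrow> real. x i)" for i by (rule continuous_on_product_coordinates)
  have "ordered_simplex n t = (\<Inter>i\<in>{1..n}. {x. 0 \<le> x i} \<inter> {x. x i \<le> t}) \<inter> (\<Inter>i\<in>-{1..n}. {x. x i = undefined})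
      \<inter> (\<Inter>(i, j)\<in>{(i, j). i \<in> {1..n} \<and> j \<in> {1..n} \<and> i \<le> j}. {x. x i \<le> x j})"
    by (auto simp: ordered_simplex_def PiE_iff extensional_def mono_on_def)
  also have "closed \<dots>"
    by (intro closed_Int closed_INT ballI) (auto intro!: closed_Collect_le closed_Collect_eq cont continuous_on_const)
  finally show ?thesis .
qed

text \<open>Links the product sigma-algebra to the topology of the function space: the index set is
  countable, and coordinates outside \<open>{1..n}\<close> are constantly
  \<open>undefined\<close>.\<close>

lemma measurable_vec_borel: "(\<lambda>x. x) \<in> measurable (vec_space n) borel"
proof (rule measurable_coordinatewise_then_product)
  fix i
  show "(\<lambda>x. x i) \<in> borel_measurable (vec_space n)"
  proof (cases "i \<in> {1..n}")
    case True
    then show ?thesis by (rule measurable_component_singleton)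
  next
    case False
    then have "x i = undefined" if "x \<in> space (vec_space n)" for x
      using that by (auto simp: space_PiM PiE_iff extensional_def)
    then show ?thesis by (subst measurable_cong[where g = "\<lambda>_. undefined"]) auto
  qed
qed

text \<open>A function continuous on a closed set becomes Borel measurable once it is set to 0
  elsewhere.\<close>

lemma holder_bound_measurable:
  assumes "holder_bound lam n t N h" "0 \<le> N" "0 < lam"
  shows "(\<lambda>x. indicator (ordered_simplex n t) x * h x) \<in> borel_measurable (vec_space n)"
proof -
  have "(\<lambda>x. indicator (ordered_simplex n t) x *\<^sub>R h x) \<in> borel_measurable borel"
    by (intro borel_measurable_continuous_on_indicator holder_bound_continuous[OF assms] borel_closed closed_ordered_simplex)
  from measurable_compose[OF measurable_vec_borel this] show ?thesis by simp
qed

section \<open>From the Hoelder norm to Hoelder bounds of the cut-off function\<close>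

text \<open>An iterated difference reads only the vertices of its cube. The base point
  \<open>x\<close> is general because each difference moves it to another point of the same
  cube.\<close>

lemma cube_diff_cube_cong:
  assumes "\<And>x. x \<in> cube n I \<theta> r \<Longrightarrow> f x = g x" "\<And>i. i \<in> I \<Longrightarrow> \<theta> i \<le> r i" "I \<subseteq> {1..n}"
    and "set js \<subseteq> I" "x \<in> cube n I \<theta> r"
  shows "cube_diff js f x r = cube_diff js g x r"
  using assms(4,5)
proof (induction js arbitrary: x)
  case (Cons i js)
  have "x(i := r i) \<in> cube n I \<theta> r"
    using Cons.prems assms(2,3) unfolding cube_def
    by (auto simp: PiE_iff extensional_def subset_iff)
  then show ?case using Cons by simp
qed (use assms(1) in simp)

lemma holder_bound_cong:
  assumes f: "holder_bound lam n t N f" and eq: "\<And>x. x \<in> ordered_simplex n t \<Longrightarrow> f x = g x"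
  shows "holder_bound lam n t N g"
  unfolding holder_bound_def
proof safe
  fix I \<theta> r assume I: "I \<subseteq> {1..n}" and adm: "(\<theta>, r) \<in> admissible_cubes n t I"
  have le: "\<theta> i < r i" if "i \<in> I" for i using adm that by (auto simp: admissible_cubes_def)
  have sub: "cube n I \<theta> r \<subseteq> ordered_simplex n t" and \<theta>: "\<theta> \<in> ordered_simplex n t"
    using adm by (auto simp: admissible_cubes_def)
  have "\<theta> \<in> cube n I \<theta> r"
    using \<theta> le unfolding cube_def ordered_simplex_def by (auto simp: PiE_iff less_imp_le)
  then have "cube_diff (sorted_list_of_set I) g \<theta> r = cube_diff (sorted_list_of_set I) f \<theta> r"
    using I sub le eq finite_subset[OF I]
    by (intro cube_diff_cube_cong[of n I \<theta> r]) (auto simp: less_imp_le subset_iff)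
  with holder_boundD[OF f I adm]
  show "\<bar>cube_diff (sorted_list_of_set I) g \<theta> r\<bar> \<le> N * (\<Prod>i\<in>I. \<bar>r i - \<theta> i\<bar> powr lam)" by simp
qed

lemma holder_norm_bound:
  assumes fin: "holder_norm lam n t g < \<infinity>"
  shows "holder_bound lam n t (enn2real (holder_norm lam n t g)) g"
  unfolding holder_bound_def
proof safe
  fix I \<theta> r assume I: "I \<subseteq> {1..n}" and adm: "(\<theta>, r) \<in> admissible_cubes n t I"
  let ?N = "holder_norm lam n t g"
  let ?q = "\<lambda>I \<theta> r. \<bar>cube_diff (sorted_list_of_set I) g \<theta> r\<bar> / (\<Prod>i\<in>I. \<bar>r i - \<theta> i\<bar> powr lam)"
  let ?S = "\<lambda>I. SUP (\<theta>, r)\<in>admissible_cubes n t I. ennreal (?q I \<theta> r)"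
  have finI: "finite I" using I finite_subset by blast
  have pos: "0 < (\<Prod>i\<in>I. \<bar>r i - \<theta> i\<bar> powr lam)"
    using adm by (intro prod_pos) (auto simp: admissible_cubes_def)
  have "ennreal (?q I \<theta> r) \<le> ?N"
  proof (cases "I = {}")
    case True
    have "ennreal \<bar>g \<theta>\<bar> \<le> (SUP \<theta>\<in>ordered_simplex n t. ennreal \<bar>g \<theta>\<bar>)"
      using adm by (intro SUP_upper) (auto simp: admissible_cubes_def)
    also have "\<dots> \<le> ?N" unfolding holder_norm_def by simp
    finally show ?thesis using True by simp
  next
    case False
    have "ennreal (?q I \<theta> r) \<le> ?S I"
      using adm by (intro SUP_upper2[of "(\<theta>, r)"]) auto
    also have "\<dots> \<le> (\<Sum>I\<in>{J. J \<subseteq> {1..n} \<and> card J = card I}. ?S I)"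
      using I by (intro member_le_sum) auto
    also have "\<dots> \<le> (\<Sum>k=1..n. \<Sum>I\<in>{J. J \<subseteq> {1..n} \<and> card J = k}. ?S I)"
    proof (rule member_le_sum)
      show "card I \<in> {1..n}" using I False finI card_mono[of "{1..n}" I] by (auto simp: Suc_le_eq card_gt_0_iff)
    qed auto
    also have "\<dots> \<le> ?N" unfolding holder_norm_def by simp
    finally show ?thesis .
  qed
  also have "?N = ennreal (enn2real ?N)" using fin by simp
  finally have "?q I \<theta> r \<le> enn2real ?N" by (subst (asm) ennreal_le_iff) auto
  then show "\<bar>cube_diff (sorted_list_of_set I) g \<theta> r\<bar> \<le> enn2real ?N * (\<Prod>i\<in>I. \<bar>r i - \<theta> i\<bar> powr lam)"
    using pos by (simp add: pos_divide_le_eq)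
qed

lemma holder_norm_mono:
  assumes "u \<le> t" shows "holder_norm lam n u g \<le> holder_norm lam n t g"
proof -
  have "admissible_cubes n u I \<subseteq> admissible_cubes n t I" for I
    using ordered_simplex_mono[OF assms, of n] assms unfolding admissible_cubes_def by force
  then show ?thesis
    unfolding holder_norm_def
    by (intro add_mono sum_mono SUP_subset_mono ordered_simplex_mono assms) auto
qed

section \<open>The Volterra kernel satisfies the abstract bounds\<close>

lemma deriv_density_le:
  assumes "0 < H" "H < 1/2" "\<bar>cH H\<bar> \<le> M"
  shows "ennreal \<bar>deriv_density H r y\<bar> \<le> deriv_majorant M H r y"
proof (cases "0 < y \<and> y < r")
  case True
  have "\<bar>deriv_density H r y\<bar> = \<bar>cH H\<bar> * ((1/2 - H) * (y / r) powr (1/2 - H)) * (r - y) powr (H - 3/2)"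
    using True assms by (simp add: deriv_density_def abs_mult)
  also have "\<dots> \<le> M * 1 * (r - y) powr (H - 3/2)"
    using True assms by (intro mult_mono mult_le_one powr_le1) auto
  finally show ?thesis unfolding deriv_majorant_def by (intro ennreal_leI) simp
qed (auto simp: deriv_density_def)

lemma KH_kernel_majorant:
  assumes "0 < H" "H < 1/2" "1/2 < lam + H" "\<bar>cH H\<bar> \<le> M" "0 < y" "y < t"
  shows "ennreal \<bar>KH H t y\<bar> + (\<integral>\<^sup>+r\<in>{y<..<t}. ennreal ((r - y) powr lam) * deriv_majorant M H r y \<partial>lborel)
    \<le> kernel_majorant M H lam t y"
proof -
  let ?p = "(t - y) powr (H - 1/2) + (t - y) powr (1/2 - H) * y powr (2 * H - 1)"
  have "\<bar>KH H t y\<bar> \<le> \<bar>cH H\<bar> * ?p" using KH_bound assms by simp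
  also have "\<dots> \<le> M * ?p" using assms by (intro mult_right_mono) auto
  finally have A: "ennreal \<bar>KH H t y\<bar> \<le> ennreal (M * ?p)" by (rule ennreal_leI)
  have B: "(\<integral>\<^sup>+r\<in>{y<..<t}. ennreal ((r - y) powr lam) * deriv_majorant M H r y \<partial>lborel)
     = ennreal (M * ((t - y) powr (lam + H - 1/2) / (lam + H - 1/2)))"
    using assms by (intro deriv_majorant_holder_integral) auto
  have C: "ennreal (M * ?p) + ennreal (M * ((t - y) powr (lam + H - 1/2) / (lam + H - 1/2)))
     = kernel_majorant M H lam t y"
    using assms unfolding kernel_majorant_def by (simp add: distrib_left flip: ennreal_plus)
  show ?thesis unfolding B C[symmetric] by (rule add_right_mono[OF A])
qed

lemma deriv_density_measurable:
  "(\<lambda>(r, y). deriv_density H r y) \<in> borel_measurable (borel \<Otimes>\<^sub>M borel)"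
  unfolding deriv_density_def by measurable

text \<open>The cut-off \<open>h'\<close> is measurable, inherits the Hoelder bound of
  \<open>h\<close> because all admissible cubes lie in the simplex, and produces the same operator
  on the cube. The results on \<open>Kop\<close> are applied to \<open>h'\<close> in place of
  \<open>h\<close>.\<close>

lemma Kstar_cube_representation:
  fixes H lam s t :: real
  assumes H: "0 < H" "H < 1/2" and lam: "0 < lam" and s: "0 \<le> s" and h: "h \<in> holder_space lam n t"
  obtains h' where "\<And>x. h' x = indicator (ordered_simplex n t) x * h x"
    and "h' \<in> borel_measurable (vec_space n)"
    and "holder_bound lam n t (enn2real (holder_norm lam n t h)) h'"
    and "\<And>\<theta>. \<theta> \<in> space (cube_measure n t) \<Longrightarrow>
      Kstar H n s t h \<theta> = Kop (KH H) (deriv_density H) n s t h' \<theta>"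
proof
  let ?h' = "\<lambda>x. indicator (ordered_simplex n t) x * h x"
  have hb: "holder_bound lam n t (enn2real (holder_norm lam n t h)) h"
    using h by (intro holder_norm_bound) (simp add: holder_space_def)
  show "?h' \<in> borel_measurable (vec_space n)" using hb lam by (intro holder_bound_measurable) auto
  show "holder_bound lam n t (enn2real (holder_norm lam n t h)) ?h'" by (rule holder_bound_cong[OF hb]) simp
  show "Kstar H n s t h \<theta> = Kop (KH H) (deriv_density H) n s t ?h' \<theta>"
    if "\<theta> \<in> space (cube_measure n t)" for \<theta>
    using that by (intro Kstar_eq_Kop H s) (auto simp: cube_measure_def space_PiM)
qed auto

section \<open>Norm bound and linearity of the operator\<close>

lemma Kstar_L2:
  fixes H lam s t C :: real
  defines "M \<equiv> \<bar>cH H\<bar> + 1"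
  assumes H: "1/4 < H" "H < 1/2" and lam: "0 < lam" "1/2 < lam + H" and st: "0 \<le> s" "s < t"
    and C: "0 \<le> C" "(\<integral>\<^sup>+\<theta>. (Kmaj (kernel_majorant M H lam) (deriv_majorant M H) n s t \<theta>)\<^sup>2 \<partial>cube_measure n t)
        \<le> ennreal (C * (t - s) powr (2 * H))"
    and h: "h \<in> holder_space lam n t"
  shows "Kstar H n s t h \<in> L2_space n t"
    and "L2_norm n t (Kstar H n s t h) \<le> sqrt C * enn2real (holder_norm lam n t h) * (t - s) powr H"
proof -
  let ?N = "enn2real (holder_norm lam n t h)" and ?G = "Kmaj (kernel_majorant M H lam) (deriv_majorant M H) n s t"
  have H0: "0 < H" using H by simp
  obtain h' where h': "h' \<in> borel_measurable (vec_space n)" "holder_bound lam n t ?N h'"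
    and eq: "\<And>\<theta>. \<theta> \<in> space (cube_measure n t) \<Longrightarrow>
      Kstar H n s t h \<theta> = Kop (KH H) (deriv_density H) n s t h' \<theta>"
    using Kstar_cube_representation[OF H0 H(2) lam(1) st(1) h] by metis
  have id: "(\<lambda>x. x) \<in> measurable (cube_measure n t) (vec_space n)"
    by (rule measurable_cube_vec[where t = t]) simp
  have "Kop (KH H) (deriv_density H) n s t h' \<in> borel_measurable (cube_measure n t)"
    using measurable_compose[OF id Kop_measurable_vec[OF KH_measurable deriv_density_measurable h'(1)]] .
  then have meas: "Kstar H n s t h \<in> borel_measurable (cube_measure n t)"
    by (rule measurable_cong[THEN iffD1, rotated]) (simp add: eq)
  have Gm: "?G \<in> borel_measurable (cube_measure n t)"
    by (rule measurable_compose3[OF Kmaj_measurable[OF kernel_majorant_measurable deriv_majorant_measurable] _ _ id]) simp_all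
  have bound: "ennreal \<bar>Kstar H n s t h \<theta>\<bar> \<le> ennreal ?N * ?G \<theta>" if "\<theta> \<in> space (cube_measure n t)" for \<theta>
    unfolding eq[OF that]
    using that H0 H lam st
    by (intro Kop_bound[OF kernel_majorant_measurable deriv_majorant_measurable KH_kernel_majorant deriv_density_le h'(2)])
      (auto simp: M_def cube_measure_def space_PiM)
  have "(\<integral>\<^sup>+\<theta>. ennreal ((Kstar H n s t h \<theta>)\<^sup>2) \<partial>cube_measure n t) \<le> (\<integral>\<^sup>+\<theta>. (ennreal ?N)\<^sup>2 * (?G \<theta>)\<^sup>2 \<partial>cube_measure n t)"
  proof (intro nn_integral_mono)
    fix \<theta> assume "\<theta> \<in> space (cube_measure n t)"
    from power_mono[OF bound[OF this], of 2]
    show "ennreal ((Kstar H n s t h \<theta>)\<^sup>2) \<le> (ennreal ?N)\<^sup>2 * (?G \<theta>)\<^sup>2"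
      by (simp add: ennreal_power power_mult_distrib)
  qed
  also have "\<dots> = (ennreal ?N)\<^sup>2 * (\<integral>\<^sup>+\<theta>. (?G \<theta>)\<^sup>2 \<partial>cube_measure n t)"
    by (intro nn_integral_cmult borel_measurable_power_ennreal Gm)
  also have "\<dots> \<le> (ennreal ?N)\<^sup>2 * ennreal (C * (t - s) powr (2 * H))"
    by (intro mult_left_mono C) simp
  also have "\<dots> = ennreal (?N\<^sup>2 * (C * (t - s) powr (2 * H)))"
    using C(1) by (simp add: ennreal_power flip: ennreal_mult)
  finally have int: "(\<integral>\<^sup>+\<theta>. ennreal ((Kstar H n s t h \<theta>)\<^sup>2) \<partial>cube_measure n t)
      \<le> ennreal (?N\<^sup>2 * (C * (t - s) powr (2 * H)))" .
  have sq: "(\<lambda>\<theta>. (Kstar H n s t h \<theta>)\<^sup>2) \<in> borel_measurable (cube_measure n t)"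
    using meas by (rule borel_measurable_power)
  have integrable: "integrable (cube_measure n t) (\<lambda>\<theta>. (Kstar H n s t h \<theta>)\<^sup>2)"
    by (rule integrableI_nonneg[OF sq]) (use int in \<open>auto intro: le_less_trans\<close>)
  then show "Kstar H n s t h \<in> L2_space n t" using meas by (simp add: L2_space_def)
  have "ennreal (LINT \<theta>|cube_measure n t. (Kstar H n s t h \<theta>)\<^sup>2) \<le> ennreal (?N\<^sup>2 * (C * (t - s) powr (2 * H)))"
    using int nn_integral_eq_integral[OF integrable] by simp
  then have "(LINT \<theta>|cube_measure n t. (Kstar H n s t h \<theta>)\<^sup>2) \<le> ?N\<^sup>2 * (C * (t - s) powr (2 * H))"
    using C(1) by (subst (asm) ennreal_le_iff) auto
  then have "L2_norm n t (Kstar H n s t h) \<le> sqrt (?N\<^sup>2 * (C * (t - s) powr (2 * H)))"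
    unfolding L2_norm_def by (rule real_sqrt_le_mono)
  also have "(t - s) powr (2 * H) = ((t - s) powr H)\<^sup>2"
    unfolding power2_eq_square powr_add[symmetric] by simp
  also have "sqrt (?N\<^sup>2 * (C * ((t - s) powr H)\<^sup>2)) = sqrt C * ?N * (t - s) powr H"
    by (simp add: real_sqrt_mult)
  finally show "L2_norm n t (Kstar H n s t h) \<le> sqrt C * ?N * (t - s) powr H" .
qed

text \<open>A square-integrable majorant is finite almost everywhere, and at such points linearity
  holds exactly. The summand 1 in \<open>M\<close> makes both kernel majorants strictly positive,
  even if \<open>cH H\<close> were 0.\<close>

lemma Kstar_linear_AE:
  fixes H lam s t C :: real
  defines "M \<equiv> \<bar>cH H\<bar> + 1"
  assumes H: "1/4 < H" "H < 1/2" and lam: "0 < lam" "1/2 < lam + H" and st: "0 \<le> s" "s < t"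
    and C: "(\<integral>\<^sup>+\<theta>. (Kmaj (kernel_majorant M H lam) (deriv_majorant M H) n s t \<theta>)\<^sup>2 \<partial>cube_measure n t)
        \<le> ennreal (C * (t - s) powr (2 * H))"
    and f: "f \<in> holder_space lam n t" and g: "g \<in> holder_space lam n t"
  shows "AE \<theta> in cube_measure n t.
    Kstar H n s t (\<lambda>x. a * f x + b * g x) \<theta> = a * Kstar H n s t f \<theta> + b * Kstar H n s t g \<theta>"
proof -
  let ?G = "Kmaj (kernel_majorant M H lam) (deriv_majorant M H) n s t"
  have H0: "0 < H" and M: "0 < M" using H by (auto simp: M_def)
  obtain f' where f': "\<And>x. f' x = indicator (ordered_simplex n t) x * f x" "f' \<in> borel_measurable (vec_space n)"
    "holder_bound lam n t (enn2real (holder_norm lam n t f)) f'"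
    and eqf: "\<And>\<theta>. \<theta> \<in> space (cube_measure n t) \<Longrightarrow>
      Kstar H n s t f \<theta> = Kop (KH H) (deriv_density H) n s t f' \<theta>"
    using Kstar_cube_representation[OF H0 H(2) lam(1) st(1) f] by metis
  obtain g' where g': "\<And>x. g' x = indicator (ordered_simplex n t) x * g x" "g' \<in> borel_measurable (vec_space n)"
    "holder_bound lam n t (enn2real (holder_norm lam n t g)) g'"
    and eqg: "\<And>\<theta>. \<theta> \<in> space (cube_measure n t) \<Longrightarrow>
      Kstar H n s t g \<theta> = Kop (KH H) (deriv_density H) n s t g' \<theta>"
    using Kstar_cube_representation[OF H0 H(2) lam(1) st(1) g] by metis
  have id: "(\<lambda>x. x) \<in> measurable (cube_measure n t) (vec_space n)"
    by (rule measurable_cube_vec[where t = t]) simp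
  have Gm: "?G \<in> borel_measurable (cube_measure n t)"
    by (rule measurable_compose3[OF Kmaj_measurable[OF kernel_majorant_measurable deriv_majorant_measurable] _ _ id]) simp_all
  have "AE \<theta> in cube_measure n t. (?G \<theta>)\<^sup>2 \<noteq> \<infinity>"
  proof (rule nn_integral_PInf_AE)
    show "(\<lambda>\<theta>. (?G \<theta>)\<^sup>2) \<in> borel_measurable (cube_measure n t)"
      using Gm by (rule borel_measurable_power_ennreal)
    show "(\<integral>\<^sup>+\<theta>. (?G \<theta>)\<^sup>2 \<partial>cube_measure n t) \<noteq> \<infinity>"
      using C by (auto simp: top_unique)
  qed
  then show ?thesis
  proof (rule AE_mp, intro AE_I2 impI)
    fix \<theta> assume \<theta>: "\<theta> \<in> space (cube_measure n t)" and fin: "(?G \<theta>)\<^sup>2 \<noteq> \<infinity>"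
    have \<theta>E: "\<theta> \<in> {1..n} \<rightarrow>\<^sub>E {0..t}" using \<theta> by (auto simp: cube_measure_def space_PiM)
    have G: "?G \<theta> < \<infinity>"
      using fin by (cases "?G \<theta>") (auto simp: power2_eq_square ennreal_mult_top)
    have kern: "0 < kernel_majorant M H lam u y \<and> kernel_majorant M H lam u y < \<infinity>" if "0 < y" "y < u" for u y
      unfolding kernel_majorant_def using that M lam
      by (auto intro!: mult_pos_pos add_pos_nonneg)
    have dens: "0 < deriv_majorant M H r y" if "0 < y" "y < r" for r y
      unfolding deriv_majorant_def using that M by simp
    have "Kstar H n s t (\<lambda>x. a * f x + b * g x) \<theta>
      = Kop (KH H) (deriv_density H) n s t (\<lambda>x. a * f' x + b * g' x) \<theta>"
      using \<theta>E by (intro Kstar_eq_Kop H0 H st) (auto simp: f' g')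
    also have "\<dots> = a * Kop (KH H) (deriv_density H) n s t f' \<theta> + b * Kop (KH H) (deriv_density H) n s t g' \<theta>"
      using H0 H lam st
      by (intro Kop_linear[OF KH_measurable deriv_density_measurable kernel_majorant_measurable
          deriv_majorant_measurable KH_kernel_majorant deriv_density_le kern dens f'(2) g'(2) f'(3) g'(3) _ _ _ \<theta>E G])
        (auto simp: M_def)
    finally show "Kstar H n s t (\<lambda>x. a * f x + b * g x) \<theta> = a * Kstar H n s t f \<theta> + b * Kstar H n s t g \<theta>"
      by (simp only: eqf[OF \<theta>] eqg[OF \<theta>])
  qed
qed

theorem proposition3p4:
  fixes T H lam :: real and n :: nat
  assumes "0 < T" and "1/4 < H" and "H < 1/2" and "1 \<le> n"
    and "0 < lam" and "lam < 1" and "1/2 < lam + H"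
  shows "(\<exists>C>0. \<forall>h\<in>holder_space lam n T. \<forall>s t. 0 \<le> s \<and> s < t \<and> t \<le> T \<longrightarrow>
            Kstar H n s t h \<in> L2_space n t \<and>
            L2_norm n t (Kstar H n s t h) \<le>
              C * enn2real (holder_norm lam n t h) * \<bar>t - s\<bar> powr H)
       \<and> (\<forall>s t. 0 \<le> s \<and> s < t \<and> t \<le> T \<longrightarrow>
            continuous_linear_operator lam n t (Kstar H n s t))"
proof -
  define M where "M = \<bar>cH H\<bar> + 1"
  have "0 < M" by (simp add: M_def)
  from Kmaj_L2[OF this assms(2,3,5,7,4), of T] obtain C where C: "0 \<le> C"
    and G: "\<And>t0 s t. 0 \<le> s \<Longrightarrow> s < t \<Longrightarrow> t \<le> T \<Longrightarrow>
      (\<integral>\<^sup>+\<theta>. (Kmaj (kernel_majorant M H lam) (deriv_majorant M H) n s t \<theta>)\<^sup>2 \<partial>cube_measure n t0)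
        \<le> ennreal (C * (t - s) powr (2 * H))" by blast
  note L2 = Kstar_L2[OF assms(2,3,5,7) _ _ C G[unfolded M_def]]
  note lin = Kstar_linear_AE[OF assms(2,3,5,7) _ _ G[unfolded M_def]]
  show ?thesis
  \<comment> \<open>\<open>C\<close> is only known to be nonnegative, and the constant has to be
    positive.\<close>
  proof (intro conjI exI[of _ "sqrt C + 1"] ballI allI impI; (elim conjE)?)
    show "0 < sqrt C + 1" using C by (simp add: add_nonneg_pos)
  next
    fix h s t assume h: "h \<in> holder_space lam n T" and st: "0 \<le> s" "s < t" "t \<le> T"
    have "holder_norm lam n t h \<le> holder_norm lam n T h" by (rule holder_norm_mono[OF st(3)])
    then have ht: "h \<in> holder_space lam n t" using h by (auto simp: holder_space_def)
    show "Kstar H n s t h \<in> L2_space n t" by (rule L2(1)[OF st(1,2) st ht])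
    have "L2_norm n t (Kstar H n s t h) \<le> sqrt C * enn2real (holder_norm lam n t h) * (t - s) powr H"
      by (rule L2(2)[OF st(1,2) st ht])
    also have "\<dots> \<le> (sqrt C + 1) * enn2real (holder_norm lam n t h) * \<bar>t - s\<bar> powr H"
      unfolding abs_of_pos[OF diff_gt_0_iff_gt[THEN iffD2, OF st(2)]] by (intro mult_right_mono) auto
    finally show "L2_norm n t (Kstar H n s t h)
        \<le> (sqrt C + 1) * enn2real (holder_norm lam n t h) * \<bar>t - s\<bar> powr H" .
  next
    fix s t :: real assume st: "0 \<le> s" "s < t" "t \<le> T"
    note L2 = L2[OF st(1,2) st] and lin = lin[OF st(1,2) st]
    show "continuous_linear_operator lam n t (Kstar H n s t)"
      unfolding continuous_linear_operator_def
    proof (intro conjI ballI allI impI)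
      fix g and e :: real assume g: "g \<in> holder_space lam n t" and e: "0 < e"
      \<comment> \<open>\<open>X\<close> bounds the operator norm on side \<open>t\<close>. It may
        be 0, so \<open>d = e / (X + 1)\<close> is used, which also makes \<open>X * d < e\<close>
        strict.\<close>
      define X where "X = sqrt C * (t - s) powr H"
      have X: "0 \<le> X" using C by (simp add: X_def)
      show "\<exists>d>0. \<forall>f\<in>holder_space lam n t. holder_norm lam n t (\<lambda>x. f x - g x) < ennreal d \<longrightarrow>
          L2_norm n t (\<lambda>\<theta>. Kstar H n s t f \<theta> - Kstar H n s t g \<theta>) < e"
      proof (intro exI[of _ "e / (X + 1)"] conjI ballI impI)
        show "0 < e / (X + 1)" using e X by (intro divide_pos_pos) auto
        fix f assume f: "f \<in> holder_space lam n t"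
          and fg: "holder_norm lam n t (\<lambda>x. f x - g x) < ennreal (e / (X + 1))"
        have fgs: "(\<lambda>x. f x - g x) \<in> holder_space lam n t"
          using fg by (auto simp: holder_space_def intro: less_trans)
        have m: "Kstar H n s t f \<in> borel_measurable (cube_measure n t)"
          "Kstar H n s t g \<in> borel_measurable (cube_measure n t)"
          "Kstar H n s t (\<lambda>x. f x - g x) \<in> borel_measurable (cube_measure n t)"
          using L2(1)[OF f] L2(1)[OF g] L2(1)[OF fgs] by (auto simp: L2_space_def)
        have ae: "AE \<theta> in cube_measure n t.
            Kstar H n s t (\<lambda>x. f x - g x) \<theta> = Kstar H n s t f \<theta> - Kstar H n s t g \<theta>"
          using lin[OF f g, of 1 "-1"] by simp
        have "L2_norm n t (\<lambda>\<theta>. Kstar H n s t f \<theta> - Kstar H n s t g \<theta>) = L2_norm n t (Kstar H n s t (\<lambda>x. f x - g x))"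
          unfolding L2_norm_def
        proof (rule arg_cong[where f = sqrt], rule integral_cong_AE)
          show "AE \<theta> in cube_measure n t. (Kstar H n s t f \<theta> - Kstar H n s t g \<theta>)\<^sup>2
              = (Kstar H n s t (\<lambda>x. f x - g x) \<theta>)\<^sup>2"
            using ae by eventually_elim simp
        qed (intro borel_measurable_power borel_measurable_diff m)+
        also have "\<dots> \<le> X * enn2real (holder_norm lam n t (\<lambda>x. f x - g x))"
          using L2(2)[OF fgs] by (simp add: X_def mult_ac)
        also have "\<dots> \<le> X * (e / (X + 1))"
        proof (intro mult_left_mono X)
          show "enn2real (holder_norm lam n t (\<lambda>x. f x - g x)) \<le> e / (X + 1)"
            using fg e X by (intro enn2real_leI) auto
        qed
        also have "\<dots> < e" using e X by (simp add: field_simps add_nonneg_pos)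
        finally show "L2_norm n t (\<lambda>\<theta>. Kstar H n s t f \<theta> - Kstar H n s t g \<theta>) < e" .
      qed
    qed (rule L2(1) lin, assumption+)+
  qed
qed

end
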